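(* Let $A\in\mathcal{C}_0$ and let $z,z'\in\mathbb{C}$ with $\operatorname{Im} z\le\operatorname{Im} z'$. (i) For every piecewise continuously differentiable simple curve $\Gamma_{z,z'}$ starting at $z'$ and ending at $z$, $$D_{\mathrm{fin}}\subset D\Big(\mathcal{T}\exp\Big(-i\int_{\Gamma_{z,z'}}d\zeta\,A(\zeta)\Big)\Big),$$ and the restriction $\mathcal{T}\exp\big(-i\int_{\Gamma_{z,z'}}d\zeta\,A(\zeta)\big)\big|_{D_{\mathrm{fin}}}$ does not depend on the choice of the simple curve from $z'$ to $z$ but only on $z$ and $z'$. Accordingly write $$U(A;z,z'):=\mathcal{T}\exp\Big(-i\int_{\Gamma_{z,z'}}d\zeta\,A(\zeta)\Big)\Big|_{D_{\mathrm{fin}}}.$$ (ii) $U(A;z,z')$ is closable and $$U(A;z,z')^*\supset\overline{U(A^*;z'^*,z^* )}.$$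
   Context: $\mathcal{H}$ is a complex Hilbert space and $H_0$ a non-negative self-adjoint operator in $\mathcal{H}$ with spectral measure $E_{H_0}$. For $E\ge0$ put $V_E:=R(E_{H_0}([0,E]))$ (range), and $D_{\mathrm{fin}}:=\bigcup_{E\ge0}V_E$, a dense subspace. A linear operator $T$ in $\mathcal{H}$ belongs to the class $\mathcal{C}_0$ if: (I) $T$ and $T^*$ are densely defined and closed; (II) $T$ and $T^*$ are $H_0^{1/2}$-bounded; (III) there is a constant $b\ge0$ such that for all $E\ge0$, $T$ and $T^*$ map $V_E$ into $V_{E+b}$. For $A\in\mathcal{C}_0$ and $z\in\mathbb{C}$, $A(z)$ denotes the closure of the (closable) operator $e^{izH_0}Ae^{-izH_0}$. $z^*$ is the complex conjugate of $z$; $\overline{S}$ is the closure of an operator $S$. Products of operators have their natural domains. Curves and ordering: a piecewise continuously differentiable simple curve from $z'$ to $z$ is a piecewise continuously differentiable injective map $\Gamma:[\alpha,\beta]\to\mathbb{C}$ with $\Gamma(\alpha)=z'$, $\Gamma(\beta)=z$ (if $z=z'$, the degenerate case $\alpha=\beta$ is meant); its image is also denoted $\Gamma$. For $\zeta_1=\Gamma(t_1),\zeta_2=\Gamma(t_2)$ write $\zeta_1\succ\zeta_2$ iff $t_1>t_2$. Integrals over $\Gamma^n$ are strong iterated line integrals: $\int_{\Gamma^n}d\zeta_1\cdots d\zeta_n\,f(\zeta_1,\dots,\zeta_n)=\int_{[\alpha,\beta]^n}dt_1\cdots dt_n\,\Gamma'(t_1)\cdots\Gamma'(t_n)f(\Gamma(t_1),\dots,\Gamma(t_n))$.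 Time-ordered product: for an operator-valued function $F$, $\mathcal{T}(F(\zeta_1)\cdots F(\zeta_n)):=\sum_{\sigma\in\mathfrak{S}_n}\chi_{P_\sigma}(\zeta_1,\dots,\zeta_n)F(\zeta_{\sigma(1)})\cdots F(\zeta_{\sigma(n)})$, where $P_\sigma=\{(\zeta_1,\dots,\zeta_n)\in\Gamma^n:\zeta_{\sigma(1)}\succ\cdots\succ\zeta_{\sigma(n)}\}$ and $\chi_{P_\sigma}$ is its characteristic function. Time-ordered exponential: let $C(F)$ be the linear span of all $\Psi\in\mathcal{H}$ such that for every $n$ the map $(\zeta_1,\dots,\zeta_n)\mapsto F(\zeta_1)\cdots F(\zeta_n)\Psi$ is (defined and) strongly continuous on some region containing $\Gamma^n$. The operator $\mathcal{T}\exp(\int_\Gamma d\zeta\,F(\zeta))$ has domain consisting of all $\Psi\in C(F)$ with $\sum_{n\ge0}\frac1{n!}\|\int_{\Gamma^n}d\zeta_1\cdots d\zeta_n\,\mathcal{T}(F(\zeta_1)\cdots F(\zeta_n))\Psi\|<\infty$, and acts by $\Psi\mapsto\sum_{n\ge0}\frac1{n!}\int_{\Gamma^n}d\zeta_1\cdots d\zeta_n\,\mathcal{T}(F(\zeta_1)\cdots F(\zeta_n))\Psi$ (the $n=0$ term being $\Psi$). *)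

theory Defs
  imports "HOL-Analysis.Analysis" "HOL-Combinatorics.Permutations"
begin

section \<open>Complex Hilbert spaces\<close>

text \<open>The norm and the topology are those of the underlying real Hilbert space, whose inner
  product is the real part of \<open>cinner\<close>; \<open>cinner\<close> is linear in its second argument.\<close>

class chilbert_space = real_inner + complete_space +
  fixes scaleC :: "complex \<Rightarrow> 'a \<Rightarrow> 'a" (infixr \<open>*\<^sub>C\<close> 75)
    and cinner :: "'a \<Rightarrow> 'a \<Rightarrow> complex"
  assumes scaleC_add_right: "c *\<^sub>C (x + y) = c *\<^sub>C x + c *\<^sub>C y"
    and scaleC_add_left: "(c + d) *\<^sub>C x = c *\<^sub>C x + d *\<^sub>C x"
    and scaleC_scaleC: "c *\<^sub>C d *\<^sub>C x = (c * d) *\<^sub>C x"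
    and scaleR_scaleC: "scaleR r x = complex_of_real r *\<^sub>C x"
    and cinner_commute: "cinner x y = cnj (cinner y x)"
    and cinner_add_right: "cinner x (y + w) = cinner x y + cinner x w"
    and cinner_scaleC_right: "cinner x (c *\<^sub>C y) = c * cinner x y"
    and inner_eq_Re_cinner: "inner x y = Re (cinner x y)"

instance chilbert_space \<subseteq> banach ..

instantiation complex :: chilbert_space
begin

definition scaleC_complex :: "complex \<Rightarrow> complex \<Rightarrow> complex"
  where "scaleC_complex c x = c * x"

definition cinner_complex :: "complex \<Rightarrow> complex \<Rightarrow> complex"
  where "cinner_complex x y = cnj x * y"

instance
  by standard
    (auto simp: scaleC_complex_def cinner_complex_def inner_complex_def scaleR_conv_of_real
      algebra_simps)

end

lemma vector_space_scaleC: "vector_space (scaleC :: complex \<Rightarrow> 'a::chilbert_space \<Rightarrow> 'a)"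
proof
  fix x :: 'a
  show "1 *\<^sub>C x = x"
    using scaleR_scaleC[of 1 x] by simp
qed (simp_all add: scaleC_add_right scaleC_add_left scaleC_scaleC)


section \<open>Unbounded operators\<close>

text \<open>An operator is represented by its graph: \<open>(x, y) \<in> T\<close> means that \<open>x\<close> lies in the domain of
  \<open>T\<close> and \<open>T x = y\<close>. The domain is \<open>Domain T\<close>, extension of operators is inclusion, and the closure
  of an operator is the topological closure of its graph.\<close>

type_synonym 'h operator = "('h \<times> 'h) set"

definition linear_operator :: "'h::chilbert_space operator \<Rightarrow> bool"
  where "linear_operator T \<longleftrightarrow>
    single_valued T \<and> module.subspace (\<lambda>c (x, y). (c *\<^sub>C x, c *\<^sub>C y)) T"

definition op_apply :: "'h operator \<Rightarrow> 'h \<Rightarrow> 'h"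
  where "op_apply T x = (THE y. (x, y) \<in> T)"

definition op_scale :: "complex \<Rightarrow> 'h::chilbert_space operator \<Rightarrow> 'h operator"
  where "op_scale c T = {(x, c *\<^sub>C y) | x y. (x, y) \<in> T}"

definition op_restrict :: "'h operator \<Rightarrow> 'h set \<Rightarrow> 'h operator"
  where "op_restrict T D = {(x, y). (x, y) \<in> T \<and> x \<in> D}"

text \<open>Products have their natural domains. In \<open>S \<circ>\<^sub>o T\<close> the operator \<open>T\<close> acts first, whereas
  relational composition reads from left to right.\<close>

abbreviation op_comp :: "'h operator \<Rightarrow> 'h operator \<Rightarrow> 'h operator" (infixr \<open>\<circ>\<^sub>o\<close> 75)
  where "S \<circ>\<^sub>o T \<equiv> T O S"

definition op_prod :: "'h operator list \<Rightarrow> 'h operator"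
  where "op_prod Ts = foldr (\<lambda>S T. S \<circ>\<^sub>o T) Ts Id"

definition densely_defined :: "'h::chilbert_space operator \<Rightarrow> bool"
  where "densely_defined T \<longleftrightarrow> closure (Domain T) = UNIV"

definition closable :: "'h::chilbert_space operator \<Rightarrow> bool"
  where "closable T \<longleftrightarrow> single_valued (closure T)"

definition adjoint_op :: "'h::chilbert_space operator \<Rightarrow> 'h operator"
  where "adjoint_op T = {(u, v). \<forall>(x, y)\<in>T. cinner u y = cinner v x}"

definition self_adjoint :: "'h::chilbert_space operator \<Rightarrow> bool"
  where "self_adjoint T \<longleftrightarrow> linear_operator T \<and> densely_defined T \<and> adjoint_op T = T"

definition nonnegative_op :: "'h::chilbert_space operator \<Rightarrow> bool"
  where "nonnegative_op T \<longleftrightarrow> (\<forall>(x, y)\<in>T. cinner x y \<in> \<real> \<and> 0 \<le> Re (cinner x y))"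

text \<open>\<open>T\<close> is \<open>S\<close>-bounded.\<close>

definition relatively_bounded :: "'h::chilbert_space operator \<Rightarrow> 'h operator \<Rightarrow> bool"
  where "relatively_bounded T S \<longleftrightarrow> Domain S \<subseteq> Domain T \<and>
    (\<exists>a\<ge>0. \<exists>b\<ge>0. \<forall>x\<in>Domain S.
      norm (op_apply T x) \<le> a * norm (op_apply S x) + b * norm x)"


section \<open>Spectral measures and functional calculus\<close>

definition orthogonal_projection :: "('h::chilbert_space \<Rightarrow> 'h) \<Rightarrow> bool"
  where "orthogonal_projection P \<longleftrightarrow> Vector_Spaces.linear scaleC scaleC P \<and>
    (\<forall>x. P (P x) = P x) \<and> (\<forall>x y. cinner (P x) y = cinner x (P y))"

definition projection_valued_measure :: "(real set \<Rightarrow> 'h::chilbert_space \<Rightarrow> 'h) \<Rightarrow> bool"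
  where "projection_valued_measure E \<longleftrightarrow>
    (\<forall>B\<in>sets borel. orthogonal_projection (E B)) \<and>
    (\<forall>x. E UNIV x = x) \<and>
    (\<forall>B :: nat \<Rightarrow> real set. range B \<subseteq> sets borel \<longrightarrow> disjoint_family B \<longrightarrow>
      (\<forall>x. (\<lambda>n. E (B n) x) sums E (\<Union>n. B n) x))"

definition diag_measure :: "(real set \<Rightarrow> 'h::chilbert_space \<Rightarrow> 'h) \<Rightarrow> 'h \<Rightarrow> real measure"
  where "diag_measure E x =
    measure_of UNIV (sets borel) (\<lambda>B. ennreal (Re (cinner x (E B x))))"

definition spectral_domain ::
    "(real set \<Rightarrow> 'h::chilbert_space \<Rightarrow> 'h) \<Rightarrow> (real \<Rightarrow> complex) \<Rightarrow> 'h set"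
  where "spectral_domain E f = {x. integrable (diag_measure E x) (\<lambda>l. (cmod (f l))\<^sup>2)}"

text \<open>\<open>\<integral> f(l) d\<langle>u, E(l) x\<rangle>\<close>, with the complex measure \<open>B \<mapsto> \<langle>u, E(B) x\<rangle>\<close> expressed by polarization
  through the positive measures \<open>B \<mapsto> \<langle>w, E(B) w\<rangle>\<close>. For \<open>u\<close> and \<open>x\<close> in \<open>spectral_domain E f\<close> all
  four integrals converge.\<close>

definition spectral_form ::
    "(real set \<Rightarrow> 'h::chilbert_space \<Rightarrow> 'h) \<Rightarrow> (real \<Rightarrow> complex) \<Rightarrow> 'h \<Rightarrow> 'h \<Rightarrow> complex"
  where "spectral_form E f u x =
    (\<Sum>k<4. \<i> ^ k * (LINT l|diag_measure E ((\<i> ^ k) *\<^sub>C u + x). f l)) / 4"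

text \<open>The operator \<open>f(H) = \<integral> f(l) dE(l)\<close> for a Borel function \<open>f\<close>; as \<open>spectral_domain E f\<close> is
  dense, \<open>y\<close> is determined by \<open>x\<close>.\<close>

definition spectral_integral ::
    "(real set \<Rightarrow> 'h::chilbert_space \<Rightarrow> 'h) \<Rightarrow> (real \<Rightarrow> complex) \<Rightarrow> 'h operator"
  where "spectral_integral E f = {(x, y). x \<in> spectral_domain E f \<and>
    (\<forall>u\<in>spectral_domain E f. cinner u y = spectral_form E f u x)}"

definition spectral_measure_of ::
    "'h::chilbert_space operator \<Rightarrow> (real set \<Rightarrow> 'h \<Rightarrow> 'h) \<Rightarrow> bool"
  where "spectral_measure_of H E \<longleftrightarrow>
    projection_valued_measure E \<and> spectral_integral E complex_of_real = H"


section \<open>The class \<open>\<C>\<^sub>0\<close>\<close>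

text \<open>From here on \<open>E\<close> stands for the spectral measure of the free Hamiltonian.\<close>

definition spec_subspace :: "(real set \<Rightarrow> 'h::chilbert_space \<Rightarrow> 'h) \<Rightarrow> real \<Rightarrow> 'h set"
  where "spec_subspace E e = range (E {0..e})"

definition D_fin :: "(real set \<Rightarrow> 'h::chilbert_space \<Rightarrow> 'h) \<Rightarrow> 'h set"
  where "D_fin E = (\<Union>e\<in>{0..}. spec_subspace E e)"

definition class_C0 :: "(real set \<Rightarrow> 'h::chilbert_space \<Rightarrow> 'h) \<Rightarrow> 'h operator set"
  where "class_C0 E = {T. linear_operator T \<and>
    densely_defined T \<and> closed T \<and> densely_defined (adjoint_op T) \<and> closed (adjoint_op T) \<and>
    relatively_bounded T (spectral_integral E (\<lambda>l. complex_of_real (sqrt l))) \<and>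
    relatively_bounded (adjoint_op T) (spectral_integral E (\<lambda>l. complex_of_real (sqrt l))) \<and>
    (\<exists>b\<ge>0. \<forall>e\<ge>0.
      spec_subspace E e \<subseteq> Domain T \<and>
      T `` spec_subspace E e \<subseteq> spec_subspace E (e + b) \<and>
      spec_subspace E e \<subseteq> Domain (adjoint_op T) \<and>
      adjoint_op T `` spec_subspace E e \<subseteq> spec_subspace E (e + b))}"

text \<open>\<open>A(z)\<close>, the closure of \<open>e\<^bsup>izH\<^esup> A e\<^bsup>-izH\<^esup>\<close>.\<close>

definition evolved ::
    "(real set \<Rightarrow> 'h::chilbert_space \<Rightarrow> 'h) \<Rightarrow> 'h operator \<Rightarrow> complex \<Rightarrow> 'h operator"
  where "evolved E A z = closure
    (spectral_integral E (\<lambda>l. exp (\<i> * z * complex_of_real l)) \<circ>\<^sub>o A \<circ>\<^sub>o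
     spectral_integral E (\<lambda>l. exp (- \<i> * z * complex_of_real l)))"


section \<open>Curves and iterated line integrals\<close>

text \<open>Unlike \<^const>\<open>piecewise_C1_differentiable_on\<close>, the derivative is required to be continuous
  up to the end points of each piece.\<close>

definition piecewise_C1 :: "real \<Rightarrow> real \<Rightarrow> (real \<Rightarrow> complex) \<Rightarrow> bool"
  where "piecewise_C1 a b \<Gamma> \<longleftrightarrow>
    (\<exists>n p. p 0 = a \<and> p n = b \<and> (\<forall>i<n. p i < p (Suc i) \<and>
      (\<exists>D. continuous_on {p i..p (Suc i)} D \<and>
        (\<forall>t\<in>{p i..p (Suc i)}. (\<Gamma> has_vector_derivative D t) (at t within {p i..p (Suc i)})))))"

text \<open>Injectivity forces \<open>a = b\<close> precisely when \<open>z' = z\<close>.\<close>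

definition simple_curve ::
    "real \<Rightarrow> real \<Rightarrow> (real \<Rightarrow> complex) \<Rightarrow> complex \<Rightarrow> complex \<Rightarrow> bool"
  where "simple_curve a b \<Gamma> z' z \<longleftrightarrow>
    a \<le> b \<and> piecewise_C1 a b \<Gamma> \<and> inj_on \<Gamma> {a..b} \<and> \<Gamma> a = z' \<and> \<Gamma> b = z"

definition curve_succ ::
    "real \<Rightarrow> real \<Rightarrow> (real \<Rightarrow> complex) \<Rightarrow> complex \<Rightarrow> complex \<Rightarrow> bool"
  where "curve_succ a b \<Gamma> w1 w2 \<longleftrightarrow>
    (\<exists>t1\<in>{a..b}. \<exists>t2\<in>{a..b}. w1 = \<Gamma> t1 \<and> w2 = \<Gamma> t2 \<and> t1 > t2)"

text \<open>Points of \<open>\<complex>\<^sup>n\<close> are the elements of \<open>{..<n} \<rightarrow>\<^sub>E UNIV\<close>, the underlying set of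
  \<open>product_topology (\<lambda>_. euclidean) {..<n}\<close>; the coordinates are numbered from 0.\<close>

definition curve_power :: "real \<Rightarrow> real \<Rightarrow> (real \<Rightarrow> complex) \<Rightarrow> nat \<Rightarrow> (nat \<Rightarrow> complex) set"
  where "curve_power a b \<Gamma> n = {..<n} \<rightarrow>\<^sub>E \<Gamma> ` {a..b}"

text \<open>The integral of \<open>g\<close> over \<open>[a,b]\<^sup>n\<close>, the first coordinate being the outermost one.\<close>

primrec iterated_integral ::
    "real \<Rightarrow> real \<Rightarrow> nat \<Rightarrow> ((nat \<Rightarrow> real) \<Rightarrow> 'h::chilbert_space) \<Rightarrow> 'h"
  where
    "iterated_integral a b 0 g = g (\<lambda>_. undefined)"
  | "iterated_integral a b (Suc n) g =
      integral {a..b} (\<lambda>s. iterated_integral a b n (\<lambda>t. g (case_nat s t)))"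

definition line_integral ::
    "real \<Rightarrow> real \<Rightarrow> (real \<Rightarrow> complex) \<Rightarrow> nat \<Rightarrow> ((nat \<Rightarrow> complex) \<Rightarrow> 'h::chilbert_space) \<Rightarrow> 'h"
  where "line_integral a b \<Gamma> n f = iterated_integral a b n
    (\<lambda>t. (\<Prod>i<n. vector_derivative \<Gamma> (at (t i) within {a..b})) *\<^sub>C
      f (\<lambda>i\<in>{..<n}. \<Gamma> (t i)))"


section \<open>Time-ordered exponentials\<close>

text \<open>\<open>F(\<zeta>\<^sub>\<sigma>\<^sub>(\<^sub>1\<^sub>)) \<cdots> F(\<zeta>\<^sub>\<sigma>\<^sub>(\<^sub>n\<^sub>))\<close>\<close>

definition F_prod ::
    "(complex \<Rightarrow> 'h operator) \<Rightarrow> nat \<Rightarrow> (nat \<Rightarrow> nat) \<Rightarrow> (nat \<Rightarrow> complex) \<Rightarrow> 'h operator"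
  where "F_prod F n \<sigma> \<zeta> = op_prod (map (\<lambda>i. F (\<zeta> (\<sigma> i))) [0..<n])"

definition ordered_region ::
    "real \<Rightarrow> real \<Rightarrow> (real \<Rightarrow> complex) \<Rightarrow> nat \<Rightarrow> (nat \<Rightarrow> nat) \<Rightarrow> (nat \<Rightarrow> complex) set"
  where "ordered_region a b \<Gamma> n \<sigma> = {\<zeta> \<in> curve_power a b \<Gamma> n.
    \<forall>i. Suc i < n \<longrightarrow> curve_succ a b \<Gamma> (\<zeta> (\<sigma> i)) (\<zeta> (\<sigma> (Suc i)))}"

definition T_prod ::
    "real \<Rightarrow> real \<Rightarrow> (real \<Rightarrow> complex) \<Rightarrow> (complex \<Rightarrow> 'h::chilbert_space operator) \<Rightarrow> nat \<Rightarrow>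
      (nat \<Rightarrow> complex) \<Rightarrow> 'h \<Rightarrow> 'h"
  where "T_prod a b \<Gamma> F n \<zeta> x = (\<Sum>\<sigma> | \<sigma> permutes {..<n}.
    if \<zeta> \<in> ordered_region a b \<Gamma> n \<sigma> then op_apply (F_prod F n \<sigma> \<zeta>) x else 0)"

definition C_space ::
    "real \<Rightarrow> real \<Rightarrow> (real \<Rightarrow> complex) \<Rightarrow> (complex \<Rightarrow> 'h::chilbert_space operator) \<Rightarrow> 'h set"
  where "C_space a b \<Gamma> F = module.span scaleC {x. \<forall>n. \<exists>S.
    openin (product_topology (\<lambda>_. euclidean) {..<n}) S \<and>
    connectedin (product_topology (\<lambda>_. euclidean) {..<n}) S \<and>
    curve_power a b \<Gamma> n \<subseteq> S \<and>
    (\<forall>\<zeta>\<in>S. x \<in> Domain (F_prod F n id \<zeta>)) \<and>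
    continuous_map (subtopology (product_topology (\<lambda>_. euclidean) {..<n}) S) euclidean
      (\<lambda>\<zeta>. op_apply (F_prod F n id \<zeta>) x)}"

definition T_exp ::
    "real \<Rightarrow> real \<Rightarrow> (real \<Rightarrow> complex) \<Rightarrow> (complex \<Rightarrow> 'h::chilbert_space operator) \<Rightarrow> 'h operator"
  where "T_exp a b \<Gamma> F =
    {(x, \<Sum>n. (1 / fact n) *\<^sub>R line_integral a b \<Gamma> n (\<lambda>\<zeta>. T_prod a b \<Gamma> F n \<zeta> x)) | x.
      x \<in> C_space a b \<Gamma> F \<and>
      summable (\<lambda>n. 1 / fact n * norm (line_integral a b \<Gamma> n (\<lambda>\<zeta>. T_prod a b \<Gamma> F n \<zeta> x)))}"

text \<open>The time-ordered exponential of \<open>-\<i> \<integral>\<^sub>\<Gamma> A(\<zeta>) d\<zeta>\<close>.\<close>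

definition T_exp_evolved ::
    "(real set \<Rightarrow> 'h::chilbert_space \<Rightarrow> 'h) \<Rightarrow> 'h operator \<Rightarrow> real \<Rightarrow> real \<Rightarrow> (real \<Rightarrow> complex) \<Rightarrow>
      'h operator"
  where "T_exp_evolved E A a b \<Gamma> = T_exp a b \<Gamma> (\<lambda>\<zeta>. op_scale (- \<i>) (evolved E A \<zeta>))"

text \<open>\<open>U(A; z, z')\<close>, formed with an arbitrarily selected simple curve from \<open>z'\<close> to \<open>z\<close>.\<close>

definition U_op ::
    "(real set \<Rightarrow> 'h::chilbert_space \<Rightarrow> 'h) \<Rightarrow> 'h operator \<Rightarrow> complex \<Rightarrow> complex \<Rightarrow> 'h operator"
  where "U_op E A z z' = (let (a, b, \<Gamma>) = (SOME (a, b, \<Gamma>). simple_curve a b \<Gamma> z' z)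
    in op_restrict (T_exp_evolved E A a b \<Gamma>) (D_fin E))"

lemma simple_curve_exists: "\<exists>a b \<Gamma>. simple_curve a b \<Gamma> z' z"
proof (cases "z = z'")
  case True
  have "piecewise_C1 0 0 (\<lambda>_. z)"
    unfolding piecewise_C1_def by (rule exI[of _ 0]) (auto intro: exI[of _ "\<lambda>_. 0"])
  with True have "simple_curve 0 0 (\<lambda>_. z) z' z"
    by (simp add: simple_curve_def)
  then show ?thesis by blast
next
  case False
  let ?\<Gamma> = "\<lambda>t::real. z' + t *\<^sub>R (z - z')"
  have "(?\<Gamma> has_vector_derivative (z - z')) (at t within {0..1})" for t
    by (auto intro!: derivative_eq_intros)
  then have "piecewise_C1 0 1 ?\<Gamma>"
    unfolding piecewise_C1_def
    by (intro exI[of _ 1] exI[of _ real]) (auto intro!: exI[of _ "\<lambda>_. z - z'"])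
  moreover have "inj_on ?\<Gamma> {0..1}"
    using False by (auto simp: inj_on_def)
  ultimately have "simple_curve 0 1 ?\<Gamma> z' z"
    by (simp add: simple_curve_def)
  then show ?thesis by blast
qed

end

theory Submission
  imports Defs "HOL-Complex_Analysis.Complex_Analysis"
begin

text \<open>On \<open>V\<^bsub>e\<^esub>\<close> the operators \<open>e\<^bsup>i\<zeta>H\<^esup>\<close> are bounded and entire in \<open>\<zeta>\<close>, so the Dyson terms can be
  defined without any curve, by \<open>\<Phi>\<^sub>0 = x\<close>, \<open>\<Phi>\<^bsub>n+1\<^esub>' = -i A(\<zeta>) \<Phi>\<^bsub>n\<^esub>\<close>, \<open>\<Phi>\<^bsub>n+1\<^esub>(z') = 0\<close>, where each
  \<open>\<Phi>\<^bsub>n\<^esub>\<close> is entire. Along any curve the fundamental theorem of calculus identifies \<open>\<Phi>\<^bsub>n\<^esub>(z)\<close> with the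
  integral over ordered times, and by Fubini the time-ordered product integrates to \<open>n!\<close> times it;
  hence independence of the curve. Estimating \<open>\<Phi>\<^bsub>n\<^esub>\<close> along the segment from \<open>z'\<close>, each of the \<open>n\<close>
  factors \<open>A\<close> contributes \<open>O(n\<^bsup>1/2\<^esup>)\<close> and the free evolutions in between telescope to a factor
  exponential in \<open>n\<close>, which is beaten by \<open>1/n!\<close>. The adjoint relation holds term by term because
  \<open>\<Sum>k\<le>n. \<langle>\<Psi>\<^bsub>n-k\<^esub>(\<zeta>\<^sup>*), \<Phi>\<^bsub>k\<^esub>(\<zeta>)\<rangle>\<close> is constant in \<open>\<zeta>\<close>, \<open>\<Psi>\<close> being the Dyson terms of \<open>A\<^sup>*\<close>;
  closability follows since the adjoint is then densely defined.\<close>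

section \<open>Complex Hilbert spaces\<close>

text \<open>The Hilbert space is not assumed separable, and the time-ordered integrand jumps
  wherever two times coincide. Vector-valued integrals are therefore handled through boundedness and
  continuity off the diagonals, and whatever rests on Fubini's or Cauchy's theorem is first proved
  after pairing with a fixed vector. The factors \<open>evolved E A \<zeta>\<close> are closures of
  graphs and a priori only relations. That they are single-valued is seen by moving all factors onto
  a test vector of finite energy, which takes the adjoint of A; the dual operator thus already
  enters part (i). Unbounded functions of H0 are met only on V_e, or tested against V_e, where they
  agree with bounded multipliers cut off to [0, e]. The cut-off level rises by b with each factor,
  and the square root in (II) makes the ratio of successive majorants of order n^(-1/2), which is
  why the series converges.\<close>

interpretation cvs: vector_space "scaleC :: complex \<Rightarrow> 'a::chilbert_space \<Rightarrow> 'a"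
  by (rule vector_space_scaleC)

lemma cinner_add_left: "cinner (x + y) w = cinner x w + cinner y w"
  for x y w :: "'a::chilbert_space"
  by (metis cinner_commute cinner_add_right complex_cnj_add)

lemma cinner_scaleC_left: "cinner (c *\<^sub>C x) y = cnj c * cinner x y"
  for x y :: "'a::chilbert_space"
  by (metis cinner_commute cinner_scaleC_right complex_cnj_mult)

lemma cinner_self: "cinner x x = complex_of_real ((norm x)\<^sup>2)"
  for x :: "'a::chilbert_space"
proof (rule complex_eqI)
  show "Re (cinner x x) = Re (complex_of_real ((norm x)\<^sup>2))"
    by (simp add: inner_eq_Re_cinner[symmetric] power2_norm_eq_inner)
  have "Im (cinner x x) = Im (cnj (cinner x x))"
    using cinner_commute[of x x] by simp
  then show "Im (cinner x x) = Im (complex_of_real ((norm x)\<^sup>2))"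
    by simp
qed

lemma norm_scaleC: "norm (c *\<^sub>C x) = cmod c * norm x"
  for x :: "'a::chilbert_space"
proof -
  have "complex_of_real ((norm (c *\<^sub>C x))\<^sup>2) = cnj c * c * complex_of_real ((norm x)\<^sup>2)"
    using cinner_self[of "c *\<^sub>C x"] cinner_self[of x]
    by (simp add: cinner_scaleC_left cinner_scaleC_right mult_ac)
  also have "\<dots> = complex_of_real ((cmod c * norm x)\<^sup>2)"
    using complex_norm_square[of c] by (simp add: power_mult_distrib mult_ac)
  finally have "(norm (c *\<^sub>C x))\<^sup>2 = (cmod c * norm x)\<^sup>2"
    using of_real_eq_iff by blast
  then show ?thesis
    by (simp add: power2_eq_iff_nonneg)
qed

lemma cinner_scaleR_left: "cinner (r *\<^sub>R x) y = r *\<^sub>R cinner x y"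
  and cinner_scaleR_right: "cinner x (r *\<^sub>R y) = r *\<^sub>R cinner x y"
  for x y :: "'a::chilbert_space"
  by (simp_all add: scaleR_scaleC cinner_scaleC_left cinner_scaleC_right scaleR_conv_of_real
      del: scaleR_complex.ctr) (simp_all add: scaleC_complex_def)

text \<open>Rotating \<open>y\<close> by a unimodular \<open>c\<close> makes the complex inner
  product real and non-negative, which reduces the claim to the real Cauchy-Schwarz
  inequality.\<close>

lemma norm_cinner_le: "cmod (cinner x y) \<le> norm x * norm y"
  for x y :: "'a::chilbert_space"
proof (cases "cinner x y = 0")
  case False
  define c where "c = cnj (sgn (cinner x y))"
  have "cmod c = 1"
    using False by (simp add: c_def norm_sgn)
  have "c * cinner x y = complex_of_real (cmod (cinner x y))"
    using False complex_norm_square[of "cinner x y"]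
    by (simp add: c_def sgn_eq divide_simps mult.commute power2_eq_square)
  then have "cmod (cinner x y) = inner x (c *\<^sub>C y)"
    by (simp add: inner_eq_Re_cinner cinner_scaleC_right)
  also have "\<dots> \<le> norm x * norm (c *\<^sub>C y)"
    by (rule norm_cauchy_schwarz)
  finally show ?thesis
    using \<open>cmod c = 1\<close> by (simp add: norm_scaleC)
qed simp

lemma bounded_bilinear_cinner: "bounded_bilinear (cinner :: 'a::chilbert_space \<Rightarrow> _)"
proof
  show "\<exists>K. \<forall>x y :: 'a. norm (cinner x y) \<le> norm x * norm y * K"
    by (rule exI[of _ 1]) (simp add: norm_cinner_le)
qed (simp_all add: cinner_add_left cinner_add_right cinner_scaleR_left cinner_scaleR_right)

lemma bounded_bilinear_scaleC:
  "bounded_bilinear (scaleC :: complex \<Rightarrow> 'a::chilbert_space \<Rightarrow> 'a)"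
proof
  show "\<exists>K. \<forall>c. \<forall>x :: 'a. norm (c *\<^sub>C x) \<le> norm c * norm x * K"
    by (rule exI[of _ 1]) (simp add: norm_scaleC)
  show "(r *\<^sub>R c) *\<^sub>C x = r *\<^sub>R c *\<^sub>C x" "c *\<^sub>C r *\<^sub>R x = r *\<^sub>R c *\<^sub>C x"
    for r c and x :: 'a
    by (simp_all add: scaleR_scaleC[where 'a='a] scaleC_scaleC scaleR_conv_of_real[where 'a=complex] mult.commute)
qed (simp_all add: scaleC_add_left scaleC_add_right)

interpretation cinner: bounded_bilinear "cinner :: 'a::chilbert_space \<Rightarrow> _"
  by (rule bounded_bilinear_cinner)

interpretation scaleC: bounded_bilinear "scaleC :: complex \<Rightarrow> 'a::chilbert_space \<Rightarrow> 'a"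
  by (rule bounded_bilinear_scaleC)

lemma cinner_eqI: "(\<And>u. cinner u x = cinner u y) \<Longrightarrow> x = y"
  for x y :: "'a::chilbert_space"
  using cinner_self[of "x - y"] by (simp add: cinner.diff_right)

section \<open>Bounded functional calculus\<close>

definition bounded_borel :: "(real \<Rightarrow> complex) \<Rightarrow> bool"
  where "bounded_borel f \<longleftrightarrow> f \<in> borel_measurable borel \<and> bounded (range f)"

lemma bounded_borelI:
  "f \<in> borel_measurable borel \<Longrightarrow> (\<And>l. cmod (f l) \<le> M) \<Longrightarrow> bounded_borel f"
  unfolding bounded_borel_def by (auto intro: boundedI)

lemma bounded_borelE:
  assumes "bounded_borel f"
  obtains M where "M > 0" "\<And>l. cmod (f l) \<le> M"
  using assms unfolding bounded_borel_def bounded_pos by auto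

lemma bounded_borel_measurable [measurable_dest]:
  "bounded_borel f \<Longrightarrow> f \<in> borel_measurable borel"
  by (simp add: bounded_borel_def)

lemma bounded_borel_indicator [simp]: "B \<in> sets borel \<Longrightarrow> bounded_borel (indicator B)"
  by (rule bounded_borelI[of _ 1]) (auto simp: indicator_def)

lemma bounded_borel_add [intro]:
  "bounded_borel f \<Longrightarrow> bounded_borel g \<Longrightarrow> bounded_borel (\<lambda>l. f l + g l)"
  unfolding bounded_borel_def by (auto intro: bounded_plus_comp)

lemma bounded_borel_mult [intro]:
  assumes "bounded_borel f" "bounded_borel g"
  shows "bounded_borel (\<lambda>l. f l * g l)"
proof -
  obtain M N where "M > 0" "\<And>l. cmod (f l) \<le> M" "N > 0" "\<And>l. cmod (g l) \<le> N"
    using assms by (metis bounded_borelE)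
  then have "cmod (f l * g l) \<le> M * N" for l
    by (simp add: norm_mult mult_mono less_imp_le)
  with assms show ?thesis
    by (intro bounded_borelI[of _ "M * N"]) (auto simp: bounded_borel_def)
qed

lemma bounded_borel_const [simp]: "bounded_borel (\<lambda>l. c)"
  by (rule bounded_borelI[of _ "cmod c"]) auto

lemma bounded_borel_cnj [intro]:
  assumes "bounded_borel f"
  shows "bounded_borel (\<lambda>l. cnj (f l))"
proof -
  obtain M where "\<And>l. cmod (f l) \<le> M"
    using bounded_borelE[OF assms] by metis
  then show ?thesis
    using bounded_borel_measurable[OF assms]
    by (intro bounded_borelI[of _ M] borel_measurable_continuous_on[of cnj]) (auto intro: continuous_intros)
qed

lemma bounded_borel_diff [intro]:
  assumes "bounded_borel f" "bounded_borel g"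
  shows "bounded_borel (\<lambda>l. f l - g l)"
  using bounded_borel_add[OF assms(1) bounded_borel_mult[OF bounded_borel_const assms(2), of "- 1"]]
  by simp

text \<open>The approximants are \<open>\<lfloor>n Re f\<rfloor> / n\<close> and \<open>\<lfloor>n Im f\<rfloor> / n\<close>.\<close>

lemma bounded_borel_induct [consumes 1, case_names indicator add cmult lim]:
  assumes f: "bounded_borel f"
    and ind: "\<And>B. B \<in> sets borel \<Longrightarrow> P (indicator B)"
    and add: "\<And>f g. bounded_borel f \<Longrightarrow> bounded_borel g \<Longrightarrow> P f \<Longrightarrow> P g \<Longrightarrow> P (\<lambda>l. f l + g l)"
    and cmult: "\<And>c f. bounded_borel f \<Longrightarrow> P f \<Longrightarrow> P (\<lambda>l. c * f l)"
    and lim: "\<And>F f. (\<And>n. bounded_borel (F n)) \<Longrightarrow> bounded_borel f \<Longrightarrow> (\<And>n. P (F n)) \<Longrightarrow>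
      (\<And>n l. cmod (F n l - f l) \<le> 1 / real (Suc n)) \<Longrightarrow> P f"
  shows "P f"
proof -
  have zero: "P (\<lambda>l. 0)"
    using cmult[OF _ ind[of "{}"], of 0] by simp
  have sum: "bounded_borel (\<lambda>l. \<Sum>k\<in>K. c k * indicator (B k) l) \<and> P (\<lambda>l. \<Sum>k\<in>K. c k * indicator (B k) l)"
    if "finite K" "\<And>k. B k \<in> sets borel" for K :: "int set" and B :: "int \<Rightarrow> real set" and c
    using that(1)
    by induction (auto simp: zero that simp del: sum_mult_indicator
        intro!: add cmult ind bounded_borel_add bounded_borel_mult)
  have re: "P (\<lambda>l. complex_of_real (g l))" if bg: "bounded_borel (\<lambda>l. complex_of_real (g l))" for g
  proof (rule lim[OF _ bg])
    fix n
    obtain M where "M > 0" and M: "\<And>l. cmod (complex_of_real (g l)) \<le> M"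
      using bounded_borelE[OF bg] by metis
    have g: "g \<in> borel_measurable borel"
      using bounded_borel_measurable[OF bg] by (simp add: borel_measurable_complex_iff)
    \<comment> \<open>As \<open>g\<close> is bounded, \<open>q\<close> takes only the finitely many
      values in [-N, N], so \<open>?F\<close> is a finite combination of indicators.\<close>
    define N where "N = \<lceil>real (Suc n) * M\<rceil> + 1"
    define q where "q l = \<lfloor>real (Suc n) * g l\<rfloor>" for l
    have q: "q l \<in> {-N..N}" for l
    proof -
      have "\<bar>real (Suc n) * g l\<bar> \<le> real (Suc n) * M"
        using M[of l] by (simp add: abs_mult mult_left_mono)
      then show ?thesis
        unfolding N_def q_def atLeastAtMost_iff by linarith
    qed
    let ?F = "\<lambda>l. \<Sum>k\<in>{-N..N}. complex_of_real (k / Suc n) * indicator {l. q l = k} l"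
    have F: "?F l = complex_of_real (q l / Suc n)" for l
    proof -
      have "?F l = (\<Sum>k\<in>{-N..N}. if k = q l then complex_of_real (k / Suc n) else 0)"
        by (rule sum.cong) (auto simp: indicator_def)
      then show ?thesis
        using q[of l] by (simp add: sum.delta)
    qed
    have "{l. q l = k} \<in> sets borel" for k
      unfolding q_def using g by measurable
    then have FP: "bounded_borel ?F \<and> P ?F"
      using sum[of "{-N..N}" "\<lambda>k. {l. q l = k}" "\<lambda>k. complex_of_real (k / Suc n)"] by simp
    show "bounded_borel (\<lambda>l. complex_of_real (\<lfloor>real (Suc n) * g l\<rfloor> / Suc n))"
      and "P (\<lambda>l. complex_of_real (\<lfloor>real (Suc n) * g l\<rfloor> / Suc n))"
      using FP unfolding F by (simp_all only: q_def)
    fix l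
    have "\<bar>\<lfloor>real (Suc n) * g l\<rfloor> - real (Suc n) * g l\<bar> \<le> 1"
      by linarith
    then have "\<bar>\<lfloor>real (Suc n) * g l\<rfloor> / real (Suc n) - g l\<bar> \<le> 1 / real (Suc n)"
      by (simp add: divide_simps abs_if mult_ac split: if_splits)
    then show "cmod (complex_of_real (\<lfloor>real (Suc n) * g l\<rfloor> / Suc n) - complex_of_real (g l))
        \<le> 1 / real (Suc n)"
      by (simp only: of_real_diff[symmetric] norm_of_real)
  qed
  have *: "bounded_borel (\<lambda>l. complex_of_real (Re (f l)))"
    "bounded_borel (\<lambda>l. complex_of_real (Im (f l)))"
    using f by (auto simp: bounded_borel_def bounded_pos intro: order_trans[OF abs_Re_le_cmod]
        order_trans[OF abs_Im_le_cmod])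
  have "P (\<lambda>l. complex_of_real (Re (f l)) + \<i> * complex_of_real (Im (f l)))"
    by (intro add cmult re * bounded_borel_mult bounded_borel_const)
  then show ?thesis
    by (simp add: complex_eq[symmetric] mult.commute)
qed

section \<open>Projection-valued measures and their scalar spectral measures\<close>

locale pvm =
  fixes E :: "real set \<Rightarrow> 'h::chilbert_space \<Rightarrow> 'h"
  assumes pvm: "projection_valued_measure E"
begin

lemma E_add: "B \<in> sets borel \<Longrightarrow> E B (x + y) = E B x + E B y"
  and E_scaleC: "B \<in> sets borel \<Longrightarrow> E B (c *\<^sub>C x) = c *\<^sub>C E B x"
  and E_idem: "B \<in> sets borel \<Longrightarrow> E B (E B x) = E B x"
  and E_cinner: "B \<in> sets borel \<Longrightarrow> cinner (E B x) y = cinner x (E B y)"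
  and E_UNIV [simp]: "E UNIV x = x"
  using pvm unfolding projection_valued_measure_def orthogonal_projection_def
  by (auto dest!: bspec simp: Vector_Spaces.linear_iff)

lemma E_sums:
  "range B \<subseteq> sets borel \<Longrightarrow> disjoint_family B \<Longrightarrow> (\<lambda>n::nat. E (B n) x) sums E (\<Union>n. B n) x"
  using pvm unfolding projection_valued_measure_def by blast

text \<open>Countable additivity on the constant family of empty sets gives a convergent series with
  constant terms, which forces the term to vanish.\<close>

lemma E_empty [simp]: "E {} x = 0"
proof -
  have "(\<lambda>n::nat. E {} x) sums E {} x"
    using E_sums[of "\<lambda>_. {}" x] by (simp add: disjoint_family_on_def)
  then have "summable (\<lambda>n::nat. E {} x)"
    by (rule sums_summable)
  then show ?thesis
    by (simp add: summable_const_iff)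
qed

lemma E_Un:
  assumes "B \<in> sets borel" "C \<in> sets borel" "B \<inter> C = {}"
  shows "E (B \<union> C) x = E B x + E C x"
proof -
  define D where "D = (\<lambda>n::nat. if n = 0 then B else if n = 1 then C else {})"
  have D: "range D \<subseteq> sets borel" "disjoint_family D" "(\<Union>n. D n) = B \<union> C"
    using assms by (auto simp: D_def disjoint_family_on_def split: if_splits)
  have "(\<lambda>n. E (D n) x) sums (\<Sum>n\<in>{0, 1}. E (D n) x)"
    by (rule sums_finite) (auto simp: D_def)
  with E_sums[OF D(1,2), of x] have "E (B \<union> C) x = (\<Sum>n\<in>{0, 1}. E (D n) x)"
    unfolding D(3) by (rule sums_unique2)
  then show ?thesis
    by (simp add: D_def)
qed

lemma norm_E_sq: "B \<in> sets borel \<Longrightarrow> complex_of_real ((norm (E B x))\<^sup>2) = cinner x (E B x)"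
  using cinner_self[of "E B x"] by (simp add: E_cinner E_idem)

text \<open>For y = E C x additivity gives E (B \<union> C) y = E B y + y. Its squared norm,
  computed once by the projection property and once by expanding, differs by twice the squared norm
  of E B y.\<close>

lemma E_disjoint:
  assumes "B \<in> sets borel" "C \<in> sets borel" "B \<inter> C = {}"
  shows "E B (E C x) = 0"
proof -
  let ?y = "E C x"
  have "complex_of_real ((norm (E B ?y + ?y))\<^sup>2) = cinner ?y (E B ?y + ?y)"
    using norm_E_sq[of "B \<union> C" ?y] E_Un[OF assms, of ?y] assms by (simp add: E_idem)
  moreover have "complex_of_real ((norm (E B ?y + ?y))\<^sup>2)
      = cinner (E B ?y) (E B ?y) + 2 * cinner ?y (E B ?y) + cinner ?y ?y"
    unfolding cinner_self[symmetric]
    using assms by (simp add: cinner_add_left cinner_add_right E_cinner)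
  ultimately have "2 * complex_of_real ((norm (E B ?y))\<^sup>2) = 0"
    using norm_E_sq[OF assms(1), of ?y] cinner_self[of "E B ?y"]
    by (simp add: cinner_add_right)
  then show ?thesis
    by simp
qed

text \<open>Splitting \<open>C\<close> and \<open>B\<close> along their intersection leaves products
  over disjoint sets, which vanish, and one idempotent.\<close>

lemma E_Int:
  assumes "B \<in> sets borel" "C \<in> sets borel"
  shows "E B (E C x) = E (B \<inter> C) x"
proof -
  have 1: "E C x = E (B \<inter> C) x + E (C - B) x"
    using E_Un[of "C \<inter> B" "C - B" x] assms
    by (simp add: Int_Diff_Un Int_Diff_disjoint) (simp add: Int_commute)
  have 2: "E B y = E (B \<inter> C) y + E (B - C) y" for y
    using E_Un[of "B \<inter> C" "B - C" y] assms by (simp add: Int_Diff_Un Int_Diff_disjoint)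
  have "E B (E C x) = E B (E (B \<inter> C) x)"
    unfolding 1 using assms E_disjoint[of B "C - B" x] by (simp add: E_add)
  also have "\<dots> = E (B \<inter> C) x"
    unfolding 2 using assms E_disjoint[of "B - C" "B \<inter> C" x] by (auto simp: E_idem)
  finally show ?thesis .
qed

lemma norm_E_le: "B \<in> sets borel \<Longrightarrow> norm (E B x) \<le> norm x"
proof -
  assume B: "B \<in> sets borel"
  have "complex_of_real ((norm (E B x))\<^sup>2) = cinner x (E B x)"
    by (rule norm_E_sq[OF B])
  then have "(norm (E B x))\<^sup>2 = cmod (cinner x (E B x))"
    by (metis norm_of_real abs_power2 abs_norm_cancel power_abs)
  also have "\<dots> \<le> norm x * norm (E B x)"
    by (rule norm_cinner_le)
  finally show ?thesis
    by (cases "norm (E B x) = 0") (auto simp: power2_eq_square)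
qed

lemma bounded_linear_E: "B \<in> sets borel \<Longrightarrow> bounded_linear (E B)"
  by (rule bounded_linear_intro[of _ 1])
    (auto simp: E_add scaleR_scaleC E_scaleC norm_E_le)

lemma space_diag [simp]: "space (diag_measure E x) = UNIV"
  and sets_diag [simp, measurable_cong]: "sets (diag_measure E x) = sets borel"
  unfolding diag_measure_def
  by (simp_all add: space_measure_of sets.sigma_sets_eq[of borel, simplified])

text \<open>The value prescribed in \<open>measure_of\<close> is attained only for a countably
  additive set function; additivity is inherited from the norm-convergent series for
  \<open>E\<close>. The value is a squared norm since \<open>E B\<close> is a self-adjoint
  idempotent.\<close>

lemma emeasure_diag:
  assumes "B \<in> sets borel"
  shows "emeasure (diag_measure E x) B = ennreal ((norm (E B x))\<^sup>2)"
proof -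
  have Re: "Re (cinner x (E B x)) = (norm (E B x))\<^sup>2" if "B \<in> sets borel" for B
    using norm_E_sq[OF that, of x] by (metis Re_complex_of_real)
  have "emeasure (diag_measure E x) B = ennreal (Re (cinner x (E B x)))"
  proof (rule emeasure_measure_of[OF diag_measure_def])
    show "positive (sets (diag_measure E x)) (\<lambda>B. ennreal (Re (cinner x (E B x))))"
      by (simp add: positive_def cinner.zero_right)
    show "countably_additive (sets (diag_measure E x)) (\<lambda>B. ennreal (Re (cinner x (E B x))))"
    proof (rule countably_additiveI)
      fix B :: "nat \<Rightarrow> real set"
      assume B: "range B \<subseteq> sets (diag_measure E x)" "disjoint_family B"
      have "(\<lambda>n. inner x (E (B n) x)) sums inner x (E (\<Union>n. B n) x)"
        using B by (intro bounded_linear.sums[OF bounded_linear_inner_right] E_sums) auto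
      then have "(\<lambda>n. ennreal (Re (cinner x (E (B n) x)))) sums ennreal (Re (cinner x (E (\<Union>n. B n) x)))"
        using B Re by (auto simp: inner_eq_Re_cinner range_subsetD intro!: sums_ennreal[THEN iffD2])
      then show "(\<Sum>n. ennreal (Re (cinner x (E (B n) x)))) = ennreal (Re (cinner x (E (\<Union>n. B n) x)))"
        by (simp add: sums_iff)
    qed
  qed (use assms in auto)
  then show ?thesis
    using Re assms by simp
qed

lemma measure_diag: "B \<in> sets borel \<Longrightarrow> measure (diag_measure E x) B = (norm (E B x))\<^sup>2"
  by (simp add: measure_def emeasure_diag)

lemma finite_measure_diag: "finite_measure (diag_measure E x)"
  by (rule finite_measureI) (simp add: emeasure_diag)

lemma integrable_diag: "bounded_borel f \<Longrightarrow> integrable (diag_measure E x) f"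
proof -
  assume f: "bounded_borel f"
  obtain M where "\<And>l. cmod (f l) \<le> M"
    using bounded_borelE[OF f] by metis
  with f show ?thesis
    by (intro finite_measure.integrable_const_bound[OF finite_measure_diag, of _ M])
      (auto simp: bounded_borel_def)
qed

lemma spectral_form_add:
  assumes "bounded_borel f" "bounded_borel g"
  shows "spectral_form E (\<lambda>l. f l + g l) u x = spectral_form E f u x + spectral_form E g u x"
  using assms unfolding spectral_form_def
  by (simp add: Bochner_Integration.integral_add integrable_diag algebra_simps sum.distrib add_divide_distrib)

lemma spectral_form_cmult: "spectral_form E (\<lambda>l. c * f l) u x = c * spectral_form E f u x"
  unfolding spectral_form_def by (simp add: algebra_simps sum_distrib_left)

lemma spectral_form_diff:
  assumes "bounded_borel f" "bounded_borel g"
  shows "spectral_form E (\<lambda>l. f l - g l) u x = spectral_form E f u x - spectral_form E g u x"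
  using spectral_form_add[OF assms(1) bounded_borel_mult[OF bounded_borel_const assms(2), of "- 1"]]
    spectral_form_cmult[of "-1" g] by simp

text \<open>For an indicator the four integrals are values of the quadratic form of
  \<open>E B\<close>, and the weights i^k extract its sesquilinear form: this is the polarization
  identity.\<close>

lemma spectral_form_indicator:
  assumes "B \<in> sets borel"
  shows "spectral_form E (indicator B) u x = cinner u (E B x)"
proof -
  have "(LINT l|diag_measure E v. indicator B l) = cinner v (E B v)" for v
  proof -
    have "(LINT l|diag_measure E v. indicator B l) = complex_of_real (LINT l|diag_measure E v. indicator B l)"
      unfolding integral_complex_of_real[symmetric]
      by (rule Bochner_Integration.integral_cong) (auto simp: indicator_def)
    then show ?thesis
      using assms by (simp add: measure_diag norm_E_sq[symmetric])
  qed
  then show ?thesis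
    using assms unfolding spectral_form_def
    by (simp add: numeral_eq_Suc E_add E_scaleC cinner_add_left cinner_add_right cinner_scaleC_left
        cinner_scaleC_right algebra_simps)
qed

lemma spectral_form_bound:
  assumes "bounded_borel f" and M: "\<And>l. cmod (f l) \<le> M"
  shows "cmod (spectral_form E f u x) \<le> M * (norm u + norm x)\<^sup>2"
proof -
  have "0 \<le> M"
    using M[of 0] norm_ge_zero order_trans by blast
  have *: "cmod (\<i> ^ k * (LINT l|diag_measure E ((\<i> ^ k) *\<^sub>C u + x). f l))
      \<le> M * (norm u + norm x)\<^sup>2" for k
  proof -
    let ?v = "(\<i> ^ k) *\<^sub>C u + x"
    have "cmod (LINT l|diag_measure E ?v. f l) \<le> (LINT l|diag_measure E ?v. cmod (f l))"
      by (rule integral_norm_bound)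
    also have "\<dots> \<le> (LINT l|diag_measure E ?v. M)"
      using M finite_measure.emeasure_finite[OF finite_measure_diag, of ?v]
      by (intro Bochner_Integration.integral_mono integrable_norm integrable_diag assms) 
        (auto simp: less_top finite_measure.integrable_const[OF finite_measure_diag])
    also have "\<dots> = M * (norm ?v)\<^sup>2"
      by (simp add: measure_diag mult.commute)
    also have "\<dots> \<le> M * (norm u + norm x)\<^sup>2"
      using \<open>0 \<le> M\<close> norm_triangle_ineq[of "(\<i> ^ k) *\<^sub>C u" x]
      by (intro mult_left_mono power_mono) (auto simp: norm_scaleC norm_power)
    finally show ?thesis
      by (simp add: norm_mult norm_power)
  qed
  have "cmod (\<Sum>k<4. \<i> ^ k * (LINT l|diag_measure E ((\<i> ^ k) *\<^sub>C u + x). f l))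
      \<le> of_nat (card {..<4::nat}) * (M * (norm u + norm x)\<^sup>2)"
    by (rule order_trans[OF norm_sum sum_bounded_above]) (rule *)
  then show ?thesis
    unfolding spectral_form_def by (simp add: norm_divide)
qed

text \<open>Testing with \<open>u\<close> parallel to \<open>y\<close> and of the same norm as
  \<open>x\<close> turns the bound on the form into a bound on the vector. The factor 4 stems from
  (norm u + norm x)^2 and is not sharp; it suffices for Cauchy sequences and is removed in
  \<open>norm_opf_le\<close>.\<close>

lemma norm_le_of_spectral_form:
  assumes f: "bounded_borel f" "\<And>l. cmod (f l) \<le> M"
    and y: "\<And>u. cinner u y = spectral_form E f u x"
  shows "norm y \<le> 4 * M * norm x"
proof (cases "y = 0")
  case True
  have "0 \<le> M"
    using f(2)[of 0] norm_ge_zero order_trans by blast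
  with True show ?thesis by simp
next
  case False
  define u where "u = (norm x / norm y) *\<^sub>R y"
  have u: "norm u = norm x"
    using False by (simp add: u_def)
  have "cinner u y = complex_of_real (norm x * norm y)"
    using False cinner_self[of y]
    by (simp add: u_def cinner.scaleR_left scaleR_conv_of_real power2_eq_square)
  then have "cmod (cinner u y) = norm x * norm y"
    by (simp only: norm_of_real) simp
  moreover have "cmod (cinner u y) \<le> M * (norm u + norm x)\<^sup>2"
    unfolding y by (rule spectral_form_bound[OF f])
  ultimately have le: "norm x * norm y \<le> norm x * (4 * M * norm x)"
    by (simp add: u power2_eq_square algebra_simps)
  show ?thesis
  \<comment> \<open>For \<open>x\<close> = 0 the vector \<open>u\<close> above vanishes, so t y is
    tested instead: the inner product is linear in t and the bound quadratic, and a small t gives a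
    contradiction.\<close>
  proof (cases "x = 0")
    case True
    have "cinner ((t::real) *\<^sub>R y) y = complex_of_real (t * (norm y)\<^sup>2)" for t
      using cinner_self[of y] by (simp add: cinner.scaleR_left scaleR_conv_of_real)
    then have "t * (norm y)\<^sup>2 \<le> M * (t * norm y)\<^sup>2" if "t > 0" for t :: real
      using spectral_form_bound[OF f, of "t *\<^sub>R y" x] that True
      unfolding y[symmetric] by (simp add: norm_mult norm_power)
    then have "1 \<le> M * t" if "t > 0" for t :: real
      using that False by (fastforce simp: power2_eq_square)
    from this[of "1 / (2 * (\<bar>M\<bar> + 1))"] have "1 \<le> M * (1 / (2 * (\<bar>M\<bar> + 1)))"
      by simp
    moreover have "M * (1 / (2 * (\<bar>M\<bar> + 1))) < 1"
      by (simp add: field_simps)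
    ultimately show ?thesis
      by linarith
  next
    case False
    then show ?thesis
      using le by simp
  qed
qed

text \<open>The operator is built by induction over functions: indicators give the projections, and
  a uniform limit of functions gives a pointwise Cauchy sequence of operators, by
  \<open>norm_le_of_spectral_form\<close> applied to differences.\<close>

lemma functional_calculus_exists:
  assumes "bounded_borel f"
  shows "\<exists>T. bounded_linear T \<and> (\<forall>c x. T (c *\<^sub>C x) = c *\<^sub>C T x) \<and>
    (\<forall>u x. cinner u (T x) = spectral_form E f u x)"
  using assms
proof (induction rule: bounded_borel_induct)
  case (indicator B)
  then show ?case
    by (intro exI[of _ "E B"]) (auto simp: bounded_linear_E E_scaleC spectral_form_indicator)
next
  case (add f g)
  then obtain S T where
    "bounded_linear S" "\<And>c x. S (c *\<^sub>C x) = c *\<^sub>C S x" "\<And>u x. cinner u (S x) = spectral_form E f u x"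
    "bounded_linear T" "\<And>c x. T (c *\<^sub>C x) = c *\<^sub>C T x" "\<And>u x. cinner u (T x) = spectral_form E g u x"
    by auto
  with add show ?case
    by (intro exI[of _ "\<lambda>x. S x + T x"])
      (auto intro: bounded_linear_add simp: scaleC_add_right cinner_add_right spectral_form_add)
next
  case (cmult c f)
  then obtain T where
    "bounded_linear T" "\<And>c x. T (c *\<^sub>C x) = c *\<^sub>C T x" "\<And>u x. cinner u (T x) = spectral_form E f u x"
    by auto
  then show ?case
    by (intro exI[of _ "\<lambda>x. c *\<^sub>C T x"])
      (auto intro: bounded_linear_compose[OF scaleC.bounded_linear_right]
        simp: scaleC_scaleC mult.commute cinner_scaleC_right spectral_form_cmult)
next
  case (lim F f)
  then obtain T where
    T: "\<And>n. bounded_linear (T n)" "\<And>n c x. T n (c *\<^sub>C x) = c *\<^sub>C T n x"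
      "\<And>n u x. cinner u (T n x) = spectral_form E (F n) u x"
    by metis
  have "Cauchy (\<lambda>n. T n x)" for x
  proof (rule metric_CauchyI)
    fix e :: real assume "e > 0"
    have "(\<lambda>n. 4 * (2 * (1 / real (Suc n))) * norm x) \<longlonglongrightarrow> 4 * (2 * 0) * norm x"
      by (intro tendsto_intros LIMSEQ_Suc lim_1_over_n)
    then obtain N where N: "4 * (2 * (1 / real (Suc N))) * norm x < e"
      using order_tendstoD(2)[of _ _ _ e] \<open>e > 0\<close> by (force simp: eventually_sequentially)
    show "\<exists>N. \<forall>m\<ge>N. \<forall>n\<ge>N. dist (T m x) (T n x) < e"
    proof (intro exI[of _ N] allI impI)
      fix m n assume mn: "N \<le> m" "N \<le> n"
      have "norm (T m x - T n x) \<le> 4 * (2 * (1 / real (Suc N))) * norm x"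
      proof (rule norm_le_of_spectral_form)
        show "bounded_borel (\<lambda>l. F m l - F n l)"
          using lim by auto
        show "cinner u (T m x - T n x) = spectral_form E (\<lambda>l. F m l - F n l) u x" for u
          using lim by (simp add: cinner.diff_right T spectral_form_diff)
        fix l
        have "cmod (F m l - F n l) \<le> cmod (F m l - f l) + cmod (F n l - f l)"
          by (metis norm_minus_commute norm_triangle_ineq4 add_diff_cancel_right diff_add_cancel diff_diff_eq2)
        also have "\<dots> \<le> 1 / real (Suc m) + 1 / real (Suc n)"
          using lim by (intro add_mono) auto
        also have "\<dots> \<le> 1 / real (Suc N) + 1 / real (Suc N)"
          using mn by (intro add_mono divide_left_mono) auto
        finally show "cmod (F m l - F n l) \<le> 2 * (1 / real (Suc N))"
          by simp
      qed
      with N show "dist (T m x) (T n x) < e"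
        by (simp add: dist_norm)
    qed
  qed
  then have "\<exists>L. (\<lambda>n. T n x) \<longlonglongrightarrow> L" for x
    using Cauchy_convergent unfolding convergent_def by blast
  then obtain S where S: "\<And>x. (\<lambda>n. T n x) \<longlonglongrightarrow> S x"
    by metis
  have "(\<lambda>n. spectral_form E (F n) u x) \<longlonglongrightarrow> spectral_form E f u x" for u x
  proof (rule LIM_zero_cancel, rule Lim_null_comparison)
    show "\<forall>\<^sub>F n in sequentially. cmod (spectral_form E (F n) u x - spectral_form E f u x)
        \<le> 1 / real (Suc n) * (norm u + norm x)\<^sup>2"
    proof (intro always_eventually allI)
      fix n
      show "cmod (spectral_form E (F n) u x - spectral_form E f u x)
          \<le> 1 / real (Suc n) * (norm u + norm x)\<^sup>2"
        using lim spectral_form_bound[of "\<lambda>l. F n l - f l" "1 / real (Suc n)" u x]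
        by (simp add: spectral_form_diff bounded_borel_diff)
    qed
    have "(\<lambda>n. 1 / real (Suc n) * (norm u + norm x)\<^sup>2) \<longlonglongrightarrow> 0 * (norm u + norm x)\<^sup>2"
      by (intro tendsto_intros LIMSEQ_Suc lim_1_over_n)
    then show "(\<lambda>n. 1 / real (Suc n) * (norm u + norm x)\<^sup>2) \<longlonglongrightarrow> 0"
      by simp
  qed
  moreover have "(\<lambda>n. spectral_form E (F n) u x) \<longlonglongrightarrow> cinner u (S x)" for u x
    unfolding T(3)[symmetric] by (intro cinner.tendsto tendsto_const S)
  ultimately have form: "cinner u (S x) = spectral_form E f u x" for u x
    using LIMSEQ_unique by blast
  have scaleC: "S (c *\<^sub>C x) = c *\<^sub>C S x" for c x
    using S[of "c *\<^sub>C x"] scaleC.tendsto[OF tendsto_const S[of x], of c]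
    unfolding T(2) using LIMSEQ_unique by blast
  have add: "S (x + y) = S x + S y" for x y
    using S[of "x + y"] tendsto_add[OF S[of x] S[of y]]
    unfolding bounded_linear.linear[OF T(1), THEN linear_add] using LIMSEQ_unique by blast
  obtain M where M: "\<And>l. cmod (f l) \<le> M"
    using bounded_borelE[OF \<open>bounded_borel f\<close>] by metis
  have "bounded_linear S"
    by (rule bounded_linear_intro[of _ "4 * M"])
      (auto simp: add scaleR_scaleC scaleC mult_ac
        intro!: norm_le_of_spectral_form[OF \<open>bounded_borel f\<close> M form, simplified mult_ac])
  with form scaleC show ?case
    by blast
qed

text \<open>The choice is harmless: for a bounded Borel function the form determines the
  operator.\<close>

definition opf :: "(real \<Rightarrow> complex) \<Rightarrow> 'h \<Rightarrow>\<^sub>L 'h"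
  where "opf f = Blinfun (SOME T. bounded_linear T \<and> (\<forall>c x. T (c *\<^sub>C x) = c *\<^sub>C T x) \<and>
    (\<forall>u x. cinner u (T x) = spectral_form E f u x))"

lemma
  assumes "bounded_borel f"
  shows cinner_opf: "cinner u (opf f x) = spectral_form E f u x"
    and opf_scaleC: "opf f (c *\<^sub>C x) = c *\<^sub>C opf f x"
  using someI_ex[OF functional_calculus_exists[OF assms]]
  unfolding opf_def by (simp_all add: bounded_linear_Blinfun_apply)

lemma opf_eqI: "bounded_borel f \<Longrightarrow> (\<And>u. cinner u y = spectral_form E f u x) \<Longrightarrow> opf f x = y"
  by (rule cinner_eqI) (simp add: cinner_opf)

lemma opf_add:
  "bounded_borel f \<Longrightarrow> bounded_borel g \<Longrightarrow> opf (\<lambda>l. f l + g l) x = opf f x + opf g x"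
  by (rule opf_eqI) (auto simp: cinner_add_right cinner_opf spectral_form_add)

lemma opf_diff:
  "bounded_borel f \<Longrightarrow> bounded_borel g \<Longrightarrow> opf (\<lambda>l. f l - g l) x = opf f x - opf g x"
  by (rule opf_eqI) (auto simp: cinner.diff_right cinner_opf spectral_form_diff)

lemma opf_cmult: "bounded_borel f \<Longrightarrow> opf (\<lambda>l. c * f l) x = c *\<^sub>C opf f x"
  by (rule opf_eqI) (auto simp: cinner_scaleC_right cinner_opf spectral_form_cmult)

lemma opf_indicator: "B \<in> sets borel \<Longrightarrow> opf (indicator B) x = E B x"
  by (rule opf_eqI) (auto simp: spectral_form_indicator)

lemma opf_tendsto:
  assumes "\<And>n. bounded_borel (F n)" "bounded_borel f" "\<And>n l. cmod (F n l - f l) \<le> e n" "e \<longlonglongrightarrow> 0"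
  shows "(\<lambda>n. opf (F n) x) \<longlonglongrightarrow> opf f x"
proof (rule LIM_zero_cancel, rule Lim_null_comparison)
  show "\<forall>\<^sub>F n in sequentially. norm (opf (F n) x - opf f x) \<le> 4 * e n * norm x"
  proof (intro always_eventually allI)
    fix n
    show "norm (opf (F n) x - opf f x) \<le> 4 * e n * norm x"
      using assms
      by (intro norm_le_of_spectral_form[of "\<lambda>l. F n l - f l"])
        (auto simp: cinner.diff_right cinner_opf spectral_form_diff)
  qed
  show "(\<lambda>n. 4 * e n * norm x) \<longlonglongrightarrow> 0"
    using tendsto_mult[OF tendsto_mult[OF tendsto_const assms(4)] tendsto_const, of 4 "norm x"] by simp
qed

text \<open>Two inductions: first over \<open>g\<close> with an indicator as left factor, where
  \<open>E_Int\<close> is the base case, then over \<open>f\<close>. Multiplication by a bounded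
  function preserves uniform convergence, so \<open>opf_tendsto\<close> handles both limits.\<close>

lemma opf_mult:
  assumes "bounded_borel f" "bounded_borel g"
  shows "opf (\<lambda>l. f l * g l) x = opf f (opf g x)"
proof -
  have inv0: "(\<lambda>n. c * (1 / real (Suc n))) \<longlonglongrightarrow> 0" for c
    using tendsto_mult[OF tendsto_const LIMSEQ_Suc[OF lim_1_over_n], of c] by simp
  have ind: "opf (\<lambda>l. indicator B l * g l) x = E B (opf g x)"
    if B: "B \<in> sets borel" and "bounded_borel g" for B g x
    using that(2)
  proof (induction rule: bounded_borel_induct)
    case (indicator C)
    have "(\<lambda>l. indicator B l * indicator C l :: complex) = indicator (B \<inter> C)"
      by (auto simp: indicator_def)
    with indicator B show ?case
      by (simp add: opf_indicator E_Int)
  next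
    case (add f g)
    with B show ?case
      by (simp add: distrib_left opf_add bounded_borel_mult E_add)
  next
    case (cmult c f)
    with B show ?case
      by (simp add: mult.left_commute opf_cmult bounded_borel_mult E_scaleC)
  next
    case (lim F f)
    have "(\<lambda>n. opf (\<lambda>l. indicator B l * F n l) x) \<longlonglongrightarrow> opf (\<lambda>l. indicator B l * f l) x"
    proof (rule opf_tendsto[OF _ _ _ inv0[of 1]])
      show "cmod (indicator B l * F n l - indicator B l * f l) \<le> 1 * (1 / real (Suc n))" for n l
        using lim.hyps(3)[of n l] by (cases "l \<in> B") auto
    qed (use lim B in \<open>auto intro!: bounded_borel_mult bounded_borel_indicator\<close>)
    moreover have "(\<lambda>n. E B (opf (F n) x)) \<longlonglongrightarrow> E B (opf f x)"
      using lim inv0[of 1]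
      by (intro bounded_linear.tendsto[OF bounded_linear_E[OF B]] opf_tendsto[of _ _ "\<lambda>n. 1 / real (Suc n)"])
        auto
    ultimately show ?case
      unfolding lim.IH using LIMSEQ_unique by blast
  qed
  show ?thesis
    using assms(1)
  proof (induction rule: bounded_borel_induct)
    case (indicator B)
    with assms(2) show ?case
      by (simp add: ind opf_indicator)
  next
    case (add f h)
    with assms(2) show ?case
      by (simp add: distrib_right opf_add bounded_borel_mult)
  next
    case (cmult c f)
    with assms(2) show ?case
      by (simp add: mult.assoc opf_cmult bounded_borel_mult)
  next
    case (lim F f)
    obtain M where M: "M > 0" "\<And>l. cmod (g l) \<le> M"
      using bounded_borelE[OF assms(2)] by metis
    have "(\<lambda>n. opf (\<lambda>l. F n l * g l) x) \<longlonglongrightarrow> opf (\<lambda>l. f l * g l) x"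
    proof (rule opf_tendsto[OF _ _ _ inv0[of M]])
      fix n l
      have "cmod ((F n l - f l) * g l) \<le> 1 / real (Suc n) * M"
        unfolding norm_mult using lim M by (intro mult_mono) auto
      then show "cmod (F n l * g l - f l * g l) \<le> M * (1 / real (Suc n))"
        by (metis left_diff_distrib mult.commute)
    qed (use lim assms(2) in auto)
    moreover have "(\<lambda>n. opf (F n) (opf g x)) \<longlonglongrightarrow> opf f (opf g x)"
      using lim inv0[of 1] by (intro opf_tendsto[of _ _ "\<lambda>n. 1 / real (Suc n)"]) auto
    ultimately show ?case
      unfolding lim.IH using LIMSEQ_unique by blast
  qed
qed

lemma opf_adjoint:
  assumes "bounded_borel f"
  shows "cinner (opf f u) x = cinner u (opf (\<lambda>l. cnj (f l)) x)"
  using assms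
proof (induction rule: bounded_borel_induct)
  case (indicator B)
  have "(\<lambda>l. cnj (indicator B l)) = indicator B"
    by (auto simp: indicator_def)
  with indicator show ?case
    by (simp add: opf_indicator E_cinner)
next
  case (add f g)
  then show ?case
    by (simp add: opf_add bounded_borel_cnj cinner_add_left cinner_add_right)
next
  case (cmult c f)
  then show ?case
    by (simp add: opf_cmult bounded_borel_cnj cinner_scaleC_left cinner_scaleC_right)
next
  case (lim F f)
  have inv0: "(\<lambda>n. 1 / real (Suc n)) \<longlonglongrightarrow> 0"
    by (rule LIMSEQ_Suc[OF lim_1_over_n])
  have "(\<lambda>n. cinner (opf (F n) u) x) \<longlonglongrightarrow> cinner (opf f u) x"
    using lim inv0 by (intro cinner.tendsto tendsto_const opf_tendsto[of _ _ "\<lambda>n. 1 / real (Suc n)"]) auto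
  moreover have "(\<lambda>n. cinner u (opf (\<lambda>l. cnj (F n l)) x)) \<longlonglongrightarrow> cinner u (opf (\<lambda>l. cnj (f l)) x)"
    using lim inv0
    by (intro cinner.tendsto tendsto_const opf_tendsto[of _ _ "\<lambda>n. 1 / real (Suc n)"])
      (auto simp: complex_cnj_diff[symmetric] simp del: complex_cnj_diff)
  ultimately show ?case
    unfolding lim.IH using LIMSEQ_unique by blast
qed

text \<open>\<open>\<parallel>f(H) x\<parallel>\<^sup>2 + \<parallel>g(H) x\<parallel>\<^sup>2 = M\<^sup>2 \<parallel>x\<parallel>\<^sup>2\<close> for \<open>g = (M\<^sup>2 - \<bar>f\<bar>\<^sup>2)\<^bsup>1/2\<^esup>\<close>.\<close>

lemma norm_opf_le:
  assumes f: "bounded_borel f" and M: "\<And>l. cmod (f l) \<le> M"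
  shows "norm (opf f x) \<le> M * norm x"
proof -
  have M0: "0 \<le> M"
    using M[of 0] norm_ge_zero order_trans by blast
  have le: "(cmod (f l))\<^sup>2 \<le> M\<^sup>2" for l
    using M by (simp add: power_mono)
  define g where "g l = complex_of_real (sqrt (M\<^sup>2 - (cmod (f l))\<^sup>2))" for l
  have g: "bounded_borel g"
  proof (rule bounded_borelI)
    show "g \<in> borel_measurable borel"
      unfolding g_def using bounded_borel_measurable[OF f] by measurable
    show "cmod (g l) \<le> M" for l
      using M0 le by (simp add: g_def real_sqrt_le_iff' )
  qed
  have sq: "cinner (opf h x) (opf h x) = cinner x (opf (\<lambda>l. cnj (h l) * h l) x)"
    if "bounded_borel h" for h
    using that by (simp add: opf_adjoint opf_mult bounded_borel_cnj)
  have gf: "cnj (g l) * g l = complex_of_real (M\<^sup>2) - cnj (f l) * f l" for l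
    using le[of l] complex_norm_square[of "f l"]
    by (simp add: g_def of_real_mult[symmetric] mult.commute del: of_real_mult)
  have "cinner (opf g x) (opf g x) = complex_of_real (M\<^sup>2) * cinner x x - cinner (opf f x) (opf f x)"
    unfolding sq[OF g] sq[OF f] gf
    using f opf_cmult[of "\<lambda>l. 1" "complex_of_real (M\<^sup>2)" x] opf_indicator[of UNIV x]
    by (simp add: opf_diff bounded_borel_mult bounded_borel_cnj cinner.diff_right cinner_scaleC_right
        indicator_def)
  then have "complex_of_real ((norm (opf g x))\<^sup>2) = complex_of_real (M\<^sup>2 * (norm x)\<^sup>2 - (norm (opf f x))\<^sup>2)"
    by (simp add: cinner_self)
  then have "(norm (opf g x))\<^sup>2 = M\<^sup>2 * (norm x)\<^sup>2 - (norm (opf f x))\<^sup>2"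
    using of_real_eq_iff by blast
  then have "(norm (opf f x))\<^sup>2 \<le> (M * norm x)\<^sup>2"
    by (simp add: power_mult_distrib) (metis diff_ge_0_iff_ge zero_le_power2)
  then show ?thesis
    by (rule power2_le_imp_le) (simp add: M0)
qed

end

section \<open>Unbounded functions of the Hamiltonian\<close>

context pvm
begin

text \<open>Projecting a vector restricts its spectral measure, because E B (E C v) = E (B \<inter>
  C) v.\<close>

lemma diag_E:
  assumes C: "C \<in> sets borel"
  shows "diag_measure E (E C v) = density (diag_measure E v) (\<lambda>l. ennreal (indicator C l))"
proof (rule measure_eqI)
  fix B assume "B \<in> sets (diag_measure E (E C v))"
  then have B: "B \<in> sets borel" by simp
  have "emeasure (density (diag_measure E v) (\<lambda>l. ennreal (indicator C l))) B =
    (\<integral>\<^sup>+l. indicator (B \<inter> C) l \<partial>diag_measure E v)"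
    using B C by (subst emeasure_density) (auto intro!: nn_integral_cong simp: indicator_def simp del: nn_integral_indicator)
  also have "\<dots> = emeasure (diag_measure E v) (B \<inter> C)"
    using B C by (intro nn_integral_indicator) auto
  finally show "emeasure (diag_measure E (E C v)) B =
      emeasure (density (diag_measure E v) (\<lambda>l. ennreal (indicator C l))) B"
    using B C by (simp add: emeasure_diag E_Int)
qed simp

lemma diag_scaleC: "cmod c = 1 \<Longrightarrow> diag_measure E (c *\<^sub>C v) = diag_measure E v"
  by (rule measure_eqI) (auto simp: emeasure_diag E_scaleC norm_scaleC)

lemma
  fixes f :: "real \<Rightarrow> 'b::{banach, second_countable_topology}"
  assumes "C \<in> sets borel" "f \<in> borel_measurable borel"
  shows integrable_diag_E:
      "integrable (diag_measure E (E C v)) f \<longleftrightarrow> integrable (diag_measure E v) (\<lambda>l. indicator C l *\<^sub>R f l)"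
    and integral_diag_E:
      "integral\<^sup>L (diag_measure E (E C v)) f = (LINT l|diag_measure E v. indicator C l *\<^sub>R f l)"
  using assms by (auto simp: diag_E integrable_density integral_density)

text \<open>The spectral measures are finite, and the modulus of \<open>f\<close> is at most 1 plus
  its square.\<close>

lemma integrable_spectral_domain:
  assumes f: "f \<in> borel_measurable borel" and p: "p \<in> spectral_domain E f"
  shows "integrable (diag_measure E p) f"
proof (rule Bochner_Integration.integrable_bound)
  show "integrable (diag_measure E p) (\<lambda>l. 1 + (cmod (f l))\<^sup>2)"
    using p finite_measure.integrable_const[OF finite_measure_diag, of p "1::real"]
    by (simp add: spectral_domain_def)
  show "AE l in diag_measure E p. norm (f l) \<le> norm (1 + (cmod (f l))\<^sup>2)"
  proof (rule AE_I2)
    fix l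
    have "0 \<le> (1 - cmod (f l))\<^sup>2"
      by simp
    then have "2 * cmod (f l) \<le> 1 + (cmod (f l))\<^sup>2"
      by (simp add: power2_diff)
    then have "cmod (f l) \<le> 1 + (cmod (f l))\<^sup>2"
      using norm_ge_zero[of "f l"] by linarith
    then show "norm (f l) \<le> norm (1 + (cmod (f l))\<^sup>2)"
      by simp
  qed
qed (use f in measurable)

text \<open>The spectral measure of \<open>w\<close> is concentrated on \<open>B\<close>, where
  \<open>f\<close> is bounded.\<close>

lemma spectral_domain_range:
  assumes f: "f \<in> borel_measurable borel" "bounded_borel (\<lambda>l. indicator B l * f l)"
    and B: "B \<in> sets borel" and w: "E B w = w"
  shows "w \<in> spectral_domain E f"
proof -
  have "integrable (diag_measure E w) (\<lambda>l. indicator B l *\<^sub>R (cmod (f l))\<^sup>2)"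
  proof -
    obtain M where M: "\<And>l. cmod (indicator B l * f l) \<le> M"
      using bounded_borelE[OF f(2)] by metis
    have "norm (indicator B l *\<^sub>R (cmod (f l))\<^sup>2) \<le> M\<^sup>2" for l
      using M[of l] power_mono[OF M[of l], of 2] by (auto simp: indicator_def)
    then show ?thesis
      using f B by (intro finite_measure.integrable_const_bound[OF finite_measure_diag, of _ "M\<^sup>2"]) auto
  qed
  then have "integrable (diag_measure E (E B w)) (\<lambda>l. (cmod (f l))\<^sup>2)"
    using f B by (subst integrable_diag_E) auto
  then show ?thesis
    by (simp add: spectral_domain_def w)
qed

text \<open>Outside \<open>B\<close> the four measures of the polarization formula coincide, and
  \<open>\<i>\<^sup>0 + \<i>\<^sup>1 + \<i>\<^sup>2 + \<i>\<^sup>3 = 0\<close>.\<close>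

lemma spectral_form_truncate:
  assumes f: "f \<in> borel_measurable borel" "bounded_borel (\<lambda>l. indicator B l * f l)"
    and B: "B \<in> sets borel" and p: "p \<in> spectral_domain E f"
    and eq: "\<And>k. diag_measure E (E (- B) ((\<i> ^ k) *\<^sub>C u + x)) = diag_measure E (E (- B) p)"
  shows "spectral_form E f u x = spectral_form E (\<lambda>l. indicator B l * f l) u x"
proof -
  have B': "- B \<in> sets borel"
    using B by (rule borel_comp)
  let ?c = "LINT l|diag_measure E (E (- B) p). f l"
  have "integrable (diag_measure E p) (\<lambda>l. indicator (- B) l *\<^sub>R f l)"
    using integrable_spectral_domain[OF f(1) p] f(1) B'
    by (intro integrable_mult_indicator) auto
  then have nu: "integrable (diag_measure E (E (- B) p)) f"
    using integrable_diag_E[OF B' f(1)] by simp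
  have "(LINT l|diag_measure E ((\<i> ^ k) *\<^sub>C u + x). f l) =
      (LINT l|diag_measure E ((\<i> ^ k) *\<^sub>C u + x). indicator B l * f l) + ?c" for k
  proof -
    let ?v = "(\<i> ^ k) *\<^sub>C u + x"
    have "integrable (diag_measure E (E (- B) ?v)) f"
      unfolding eq by (rule nu)
    then have i: "integrable (diag_measure E ?v) (\<lambda>l. indicator (- B) l *\<^sub>R f l)"
      using integrable_diag_E[OF B' f(1)] by simp
    have "(LINT l|diag_measure E ?v. f l) =
        (LINT l|diag_measure E ?v. indicator B l * f l + indicator (- B) l *\<^sub>R f l)"
      by (rule Bochner_Integration.integral_cong) (auto simp: indicator_def)
    also have "\<dots> = (LINT l|diag_measure E ?v. indicator B l * f l) +
        (LINT l|diag_measure E ?v. indicator (- B) l *\<^sub>R f l)"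
      by (rule Bochner_Integration.integral_add[OF integrable_diag[OF f(2)] i])
    also have "(LINT l|diag_measure E ?v. indicator (- B) l *\<^sub>R f l) = ?c"
      using integral_diag_E[OF B' f(1), of ?v] eq by simp
    finally show ?thesis .
  qed
  then show ?thesis
    unfolding spectral_form_def by (simp add: numeral_eq_Suc algebra_simps)
qed

lemma E_Compl: "B \<in> sets borel \<Longrightarrow> E B w = w \<Longrightarrow> E (- B) w = 0"
  using E_disjoint[OF borel_comp, of B B w] by simp

text \<open>Off \<open>B\<close> only the part i^k \<open>p\<close> of the polarization vectors
  survives, and a unimodular factor does not change the spectral measure. In the left-handed version
  below the surviving part does not involve k at all.\<close>

lemma spectral_form_truncate_right:
  assumes "f \<in> borel_measurable borel" "bounded_borel (\<lambda>l. indicator B l * f l)"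
    "B \<in> sets borel" "p \<in> spectral_domain E f" "E B x = x"
  shows "spectral_form E f p x = spectral_form E (\<lambda>l. indicator B l * f l) p x"
  using assms
  by (intro spectral_form_truncate)
    (auto simp: E_add E_scaleC E_Compl diag_scaleC norm_power borel_comp)

lemma spectral_form_truncate_left:
  assumes "f \<in> borel_measurable borel" "bounded_borel (\<lambda>l. indicator B l * f l)"
    "B \<in> sets borel" "p \<in> spectral_domain E f" "E B u = u"
  shows "spectral_form E f u p = spectral_form E (\<lambda>l. indicator B l * f l) u p"
  using assms
  by (intro spectral_form_truncate)
    (auto simp: E_add E_scaleC E_Compl borel_comp)

lemma spectral_integral_range:
  assumes "f \<in> borel_measurable borel" "bounded_borel (\<lambda>l. indicator B l * f l)"
    "B \<in> sets borel" "E B x = x"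
  shows "(x, opf (\<lambda>l. indicator B l * f l) x) \<in> spectral_integral E f"
  using assms
  by (auto simp: spectral_integral_def spectral_domain_range cinner_opf spectral_form_truncate_right)

text \<open>Tested against a vector from a range on which \<open>f\<close> is bounded, the possibly
  unbounded operator acts like a bounded one, whatever \<open>p\<close> in its domain. This gives
  access to arbitrary elements of the graph of an evolved operator.\<close>

lemma cinner_spectral_integral:
  assumes "(p, q) \<in> spectral_integral E f"
    and f: "f \<in> borel_measurable borel" "bounded_borel (\<lambda>l. indicator B l * f l)"
      "B \<in> sets borel" and w: "E B w = w"
  shows "cinner w q = cinner w (opf (\<lambda>l. indicator B l * f l) p)"
  using assms
  by (auto simp: spectral_integral_def spectral_domain_range[OF f w] cinner_opf
      spectral_form_truncate_left)

text \<open>On the range of \<open>E B\<close> for \<open>B = [-n, -1/(n+1)]\<close> the quadratic form of the operator is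
  \<open>-\<parallel>(-H)\<^bsup>1/2\<^esup> x\<parallel>\<^sup>2\<close>.\<close>

lemma E_negative:
  assumes "nonnegative_op (spectral_integral E complex_of_real)"
  shows "E {..<0} y = 0"
proof -
  have zero: "E {- real n..- 1 / real (Suc n)} y = 0" for n
  proof -
    \<comment> \<open>The cut at -n keeps the multiplier \<open>?f\<close> bounded; the cut at
      -1/(n+1), away from 0, keeps the reciprocal square root \<open>?s\<close> bounded.\<close>
    define B where "B = {- real n..- 1 / real (Suc n)}"
    have B: "B \<in> sets borel"
      by (simp add: B_def)
    have neg: "l < 0" if "l \<in> B" for l
      using that unfolding B_def atLeastAtMost_iff
      by (rule conjE) (erule order.strict_trans1, simp)
    have bnd: "\<bar>l\<bar> \<le> real n" "1 / real (Suc n) \<le> - l" if "l \<in> B" for l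
      using that neg[OF that] by (auto simp: B_def)
    let ?f = "\<lambda>l. indicator B l * complex_of_real l"
    let ?r = "\<lambda>l. indicator B l * complex_of_real (sqrt (- l))"
    let ?s = "\<lambda>l. indicator B l * complex_of_real (1 / sqrt (- l))"
    have f: "bounded_borel ?f"
      using bnd B by (intro bounded_borelI[of _ "real n"]) (auto simp: indicator_def)
    have r: "bounded_borel ?r"
    proof (rule bounded_borelI)
      show "cmod (?r l) \<le> sqrt (real n)" for l
        using bnd[of l] neg[of l] by (auto simp: indicator_def)
    qed (use B in measurable)
    have s: "bounded_borel ?s"
    proof (rule bounded_borelI)
      show "cmod (?s l) \<le> sqrt (real (Suc n))" for l
      proof (cases "l \<in> B")
        case True
        then have "1 / - l \<le> real (Suc n)"
          using bnd(2)[OF True] neg[OF True] by (simp add: field_simps)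
        then have "sqrt (1 / - l) \<le> sqrt (real (Suc n))"
          by (rule real_sqrt_le_mono)
        moreover have "sqrt (1 / - l) = 1 / sqrt (- l)"
          by (simp only: real_sqrt_divide real_sqrt_one)
        moreover have "cmod (?s l) = 1 / sqrt (- l)"
          using True neg[OF True] by (simp add: norm_divide)
        ultimately show ?thesis
          by linarith
      qed simp
    qed (use B in measurable)
    define x where "x = E B y"
    have x: "E B x = x"
      using B by (simp add: x_def E_idem)
    have "(x, opf ?f x) \<in> spectral_integral E complex_of_real"
      using f B x by (intro spectral_integral_range) auto
    then have nonneg: "0 \<le> Re (cinner x (opf ?f x))"
      using assms by (auto simp: nonnegative_op_def)
    have eq: "?f = (\<lambda>l. (- 1) * (cnj (?r l) * ?r l))"
      by (auto simp: fun_eq_iff indicator_def neg less_imp_le of_real_mult[symmetric] simp del: of_real_mult)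
    have "opf ?f x = (- 1) *\<^sub>C opf (\<lambda>l. cnj (?r l) * ?r l) x"
      by (subst eq, rule opf_cmult) (intro bounded_borel_mult bounded_borel_cnj r)
    also have "opf (\<lambda>l. cnj (?r l) * ?r l) x = opf (\<lambda>l. cnj (?r l)) (opf ?r x)"
      by (rule opf_mult[OF bounded_borel_cnj[OF r] r])
    finally have "opf ?f x = (- 1) *\<^sub>C opf (\<lambda>l. cnj (?r l)) (opf ?r x)" .
    then have "cinner x (opf ?f x) = - complex_of_real ((norm (opf ?r x))\<^sup>2)"
      using opf_adjoint[OF r, of x "opf ?r x"]
      by (simp only: cinner_scaleC_right cinner_self) simp
    then have "opf ?r x = 0"
      using nonneg by simp
    \<comment> \<open>On \<open>B\<close> the bounded multiplier \<open>?s\<close> inverts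
      \<open>?r\<close>, so \<open>x\<close> is recovered from opf ?r x = 0.\<close>
    have "x = opf (indicator B) x"
      using B x by (simp add: opf_indicator)
    also have "indicator B = (\<lambda>l. ?s l * ?r l)"
      using neg by (auto simp: fun_eq_iff indicator_def of_real_mult[symmetric] simp del: of_real_mult)
    also have "opf \<dots> x = opf ?s (opf ?r x)"
      by (rule opf_mult[OF s r])
    finally show ?thesis
      using \<open>opf ?r x = 0\<close> by (simp add: x_def B_def blinfun.zero_right)
  qed
  have "{..<0::real} = (\<Union>n. {- real n..- 1 / real (Suc n)})"
  proof (intro set_eqI iffI)
    fix l :: real assume "l \<in> {..<0}"
    then have "0 < - l" by simp
    then obtain n where n: "1 / real (Suc n) < - l"
      using nat_approx_posE by metis
    obtain m where m: "- l \<le> real m"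
      using real_arch_simple by metis
    have "1 / real (Suc (max m n)) \<le> 1 / real (Suc n)"
      by (intro divide_left_mono) auto
    with n m have "l \<in> {- real (max m n)..- 1 / real (Suc (max m n))}"
      by auto
    then show "l \<in> (\<Union>n. {- real n..- 1 / real (Suc n)})"
      by blast
  next
    fix l :: real assume "l \<in> (\<Union>n. {- real n..- 1 / real (Suc n)})"
    then obtain n where "l \<le> - 1 / real (Suc n)" by auto
    moreover have "- 1 / real (Suc n) < 0" by simp
    ultimately show "l \<in> {..<0}" by (simp only: lessThan_iff)
  qed
  moreover have "emeasure (diag_measure E y) (\<Union>n. {- real n..- 1 / real (Suc n)}) = 0"
  proof (rule emeasure_UN_eq_0)
    show "emeasure (diag_measure E y) {- real n..- 1 / real (Suc n)} = 0" for n
      unfolding emeasure_diag[OF atLeastAtMost_borel] zero by simp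
  qed auto
  ultimately show ?thesis
    by (simp add: emeasure_diag)
qed

end

section \<open>The complex time evolution on spectral subspaces\<close>

text \<open>Complex differentiability for Hilbert-space values: the real derivative has to be
  complex linear, hence multiplication of a fixed vector by the increment.\<close>

definition entire :: "(complex \<Rightarrow> 'a::chilbert_space) \<Rightarrow> bool"
  where "entire f \<longleftrightarrow> (\<forall>\<zeta>. \<exists>D. (f has_derivative (\<lambda>h. h *\<^sub>C D)) (at \<zeta>))"

locale pvm_nonneg = pvm E for E :: "real set \<Rightarrow> 'h::chilbert_space \<Rightarrow> 'h" +
  assumes E_negative_zero: "E {..<0} y = 0"
begin

lemma spec_subspace_iff: "x \<in> spec_subspace E e \<longleftrightarrow> E {0..e} x = x"
  unfolding spec_subspace_def by (metis E_idem atLeastAtMost_borel rangeE rangeI)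

text \<open>Testing with E {0..n} y shows that this projection of y vanishes for every n. The real
  line is a countable union of these intervals and the null set {..<0}, so the spectral measure of y
  is zero. This stands in for the density of \<open>D_fin\<close> in all uniqueness
  arguments.\<close>

lemma D_fin_separates:
  assumes "\<And>v. v \<in> D_fin E \<Longrightarrow> cinner v y = 0"
  shows "y = 0"
proof -
  have zero: "E {0..real n} y = 0" for n
  proof -
    have "E {0..real n} y \<in> D_fin E"
      unfolding D_fin_def spec_subspace_def by (intro UN_I[of "real n"]) auto
    then have "cinner (E {0..real n} y) y = 0"
      by (rule assms)
    then show ?thesis
      using norm_E_sq[of "{0..real n}" y] by (simp add: E_cinner)
  qed
  have UN: "(UNIV :: real set) = {..<0} \<union> (\<Union>n. {0..real n})"
    using real_arch_simple[where 'a=real] by (auto simp: not_less)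
  have "emeasure (diag_measure E y) (\<Union>n. {0..real n}) = 0"
    by (rule emeasure_UN_eq_0) (auto simp: emeasure_diag zero)
  then have "emeasure (diag_measure E y) ({..<0} \<union> (\<Union>n. {0..real n})) = 0"
    by (subst emeasure_Un_null_set) (auto simp: null_sets_def emeasure_diag E_negative_zero)
  then show ?thesis
    unfolding UN[symmetric] by (simp add: emeasure_diag)
qed

lemma D_finI: "0 \<le> e \<Longrightarrow> x \<in> spec_subspace E e \<Longrightarrow> x \<in> D_fin E"
  unfolding D_fin_def by auto

lemma spec_subspace_scaleC: "x \<in> spec_subspace E e \<Longrightarrow> c *\<^sub>C x \<in> spec_subspace E e"
  by (simp add: spec_subspace_iff E_scaleC)

text \<open>The free evolution exp(i \<zeta> H0) cut off to energies in [0, e]; the cut-off makes it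
  bounded for every complex time.\<close>

definition G :: "real \<Rightarrow> complex \<Rightarrow> 'h \<Rightarrow>\<^sub>L 'h"
  where "G e \<zeta> = opf (\<lambda>l. indicator {0..e} l * exp (\<i> * \<zeta> * complex_of_real l))"

lemma norm_exp_il_le: "l \<in> {0..e} \<Longrightarrow> cmod (exp (\<i> * \<zeta> * complex_of_real l)) \<le> exp (cmod \<zeta> * e)"
proof -
  assume l: "l \<in> {0..e}"
  have "cmod (exp (\<i> * \<zeta> * complex_of_real l)) \<le> exp (cmod (\<i> * \<zeta> * complex_of_real l))"
    by (rule norm_exp)
  also have "\<dots> \<le> exp (cmod \<zeta> * e)"
    using l by (simp add: norm_mult mult_left_mono)
  finally show ?thesis .
qed

lemma bounded_borel_exp: "bounded_borel (\<lambda>l. indicator {0..e} l * exp (\<i> * \<zeta> * complex_of_real l))"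
  by (rule bounded_borelI[of _ "exp (cmod \<zeta> * e)"])
    (use norm_exp_il_le in \<open>auto simp: indicator_def simp del: norm_exp_eq_Re\<close>)

lemma norm_G_le: "norm (G e \<zeta> x) \<le> exp (cmod \<zeta> * e) * norm x"
  unfolding G_def
  by (rule norm_opf_le[OF bounded_borel_exp])
    (use norm_exp_il_le in \<open>auto simp: indicator_def simp del: norm_exp_eq_Re\<close>)

lemma G_scaleC: "G e \<zeta> (c *\<^sub>C x) = c *\<^sub>C G e \<zeta> x"
  unfolding G_def by (rule opf_scaleC[OF bounded_borel_exp])

lemma G_mult: "G e \<zeta> (G e' \<eta> x) = G (min e e') (\<zeta> + \<eta>) x"
proof -
  have *: "(\<lambda>l. (indicator {0..e} l * exp (\<i> * \<zeta> * complex_of_real l)) *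
      (indicator {0..e'} l * exp (\<i> * \<eta> * complex_of_real l))) =
      (\<lambda>l. indicator {0..min e e'} l * exp (\<i> * (\<zeta> + \<eta>) * complex_of_real l))"
    by (auto simp: fun_eq_iff indicator_def exp_add[symmetric] algebra_simps)
  show ?thesis
    unfolding G_def opf_mult[OF bounded_borel_exp bounded_borel_exp, symmetric] * ..
qed

lemma G_zero: "G e 0 x = E {0..e} x"
  unfolding G_def by (simp add: opf_indicator)

lemma G_in: "G e \<zeta> x \<in> spec_subspace E e"
  unfolding spec_subspace_iff G_zero[symmetric] by (simp add: G_mult)

lemma G_group: "G e \<zeta> (G e \<eta> x) = G e (\<zeta> + \<eta>) x"
  by (simp add: G_mult)

lemma G_inverse: "x \<in> spec_subspace E e \<Longrightarrow> G e \<zeta> (G e (- \<zeta>) x) = x"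
  by (simp add: G_group G_zero spec_subspace_iff)

text \<open>Conjugating the multiplier turns i \<zeta> into -i times the conjugate of \<zeta>; this
  is the origin of the conjugated times in the adjoint relation.\<close>

lemma G_adjoint: "cinner (G e \<zeta> u) x = cinner u (G e (- cnj \<zeta>) x)"
proof -
  have *: "(\<lambda>l. cnj (indicator {0..e} l * exp (\<i> * \<zeta> * complex_of_real l))) =
      (\<lambda>l. indicator {0..e} l * exp (\<i> * (- cnj \<zeta>) * complex_of_real l))"
    by (auto simp: fun_eq_iff indicator_def exp_cnj)
  show ?thesis
    unfolding G_def opf_adjoint[OF bounded_borel_exp] * ..
qed

text \<open>Differentiability holds in operator norm: the remainder of the multiplier is exp(i
  \<zeta> l) times exp w - 1 - w with w = i h l, which is of order h^2 uniformly for l in [0, e],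
  and the functional calculus is bounded by the supremum of the multiplier.\<close>

lemma G_has_derivative:
  assumes e: "0 \<le> e"
  shows "(G e has_derivative
    (\<lambda>h. opf (\<lambda>l. h * (indicator {0..e} l * (\<i> * complex_of_real l * exp (\<i> * \<zeta> * complex_of_real l))))))
    (at \<zeta>)"
proof -
  let ?d = "\<lambda>l. indicator {0..e} l * (\<i> * complex_of_real l * exp (\<i> * \<zeta> * complex_of_real l))"
  let ?K = "exp (cmod \<zeta> * e)"
  have d_le: "cmod (?d l) \<le> e * ?K" for l
    using e norm_exp_il_le[of l e \<zeta>]
    by (auto simp: indicator_def norm_mult simp del: norm_exp_eq_Re intro!: mult_mono)
  have d: "bounded_borel ?d"
    by (rule bounded_borelI[OF _ d_le]) auto
  have hd: "bounded_borel (\<lambda>l. h * ?d l)" for h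
    by (intro bounded_borel_mult d) simp
  have lin: "bounded_linear (\<lambda>h. opf (\<lambda>l. h * ?d l))"
  proof (rule bounded_linear_intro[of _ "e * ?K"])
    show "opf (\<lambda>l. (h + h') * ?d l) = opf (\<lambda>l. h * ?d l) + opf (\<lambda>l. h' * ?d l)" for h h'
      by (rule blinfun_eqI) (simp add: distrib_right opf_add hd blinfun.add_left)
    show "opf (\<lambda>l. (r *\<^sub>R h) * ?d l) = r *\<^sub>R opf (\<lambda>l. h * ?d l)" for r h
      using opf_cmult[OF hd, of "complex_of_real r" h]
      by (intro blinfun_eqI) (simp add: scaleR_conv_of_real mult.assoc blinfun.scaleR_left scaleR_scaleC)
    show "norm (opf (\<lambda>l. h * ?d l)) \<le> norm h * (e * ?K)" for h
    proof (rule norm_blinfun_bound)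
      show "norm (opf (\<lambda>l. h * ?d l) x) \<le> norm h * (e * ?K) * norm x" for x
        by (rule norm_opf_le[OF hd]) (simp only: norm_mult[of h] mult_left_mono[OF d_le] norm_ge_zero)
    qed (use e in simp)
  qed
  let ?H = "\<lambda>\<eta>. ?K * (e\<^sup>2 * cmod (\<eta> - \<zeta>) * exp e)"
  show ?thesis
  proof (rule has_derivativeI_sandwich[of 1])
    fix \<eta> assume "\<eta> \<noteq> \<zeta>" "dist \<eta> \<zeta> < 1"
    define h where "h = \<eta> - \<zeta>"
    have h: "h \<noteq> 0" "cmod h < 1"
      using \<open>\<eta> \<noteq> \<zeta>\<close> \<open>dist \<eta> \<zeta> < 1\<close> by (auto simp: h_def dist_norm)
    let ?r = "\<lambda>l. indicator {0..e} l * exp (\<i> * \<eta> * complex_of_real l) -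
      indicator {0..e} l * exp (\<i> * \<zeta> * complex_of_real l) - h * ?d l"
    have "cmod (?r l) \<le> ?K * (e\<^sup>2 * (cmod h)\<^sup>2 * exp e)" for l
    proof (cases "l \<in> {0..e}")
      case True
      define w where "w = \<i> * h * complex_of_real l"
      have w: "cmod w \<le> cmod h * e"
        using True by (simp add: w_def norm_mult mult_left_mono)
      have "exp (\<i> * \<eta> * complex_of_real l) = exp (\<i> * \<zeta> * complex_of_real l) * exp w"
        by (simp add: w_def h_def exp_add[symmetric] algebra_simps)
      then have "?r l = exp (\<i> * \<zeta> * complex_of_real l) * (exp w - (1 + w))"
        using True by (simp add: w_def algebra_simps)
      then have "cmod (?r l) = cmod (exp (\<i> * \<zeta> * complex_of_real l)) * cmod (exp w - (1 + w))"
        by (simp only: norm_mult)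
      also have "\<dots> \<le> ?K * (exp \<bar>Re w\<bar> * (cmod w)\<^sup>2)"
        using norm_exp_il_le[OF True, of \<zeta>] Taylor_exp[of w 1]
        by (intro mult_mono) (auto simp: numeral_2_eq_2)
      also have "\<dots> \<le> ?K * (exp e * (cmod h * e)\<^sup>2)"
      proof -
        have "\<bar>Re w\<bar> \<le> cmod h * e"
          using abs_Re_le_cmod w by (rule order_trans)
        also have "\<dots> \<le> 1 * e"
          using h e by (intro mult_right_mono) auto
        finally show ?thesis
          using w by (intro mult_left_mono mult_mono power_mono) auto
      qed
      finally show ?thesis
        by (simp add: power_mult_distrib mult_ac)
    qed (auto simp: indicator_def)
    then have "norm (opf ?r x) \<le> ?K * (e\<^sup>2 * (cmod h)\<^sup>2 * exp e) * norm x" for x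
      by (intro norm_opf_le bounded_borel_diff bounded_borel_exp hd)
    moreover have "(G e \<eta> - G e \<zeta> - opf (\<lambda>l. h * ?d l)) x = opf ?r x" for x
      by (simp only: G_def blinfun.diff_left opf_diff bounded_borel_exp hd bounded_borel_diff)
    ultimately have "norm (G e \<eta> - G e \<zeta> - opf (\<lambda>l. h * ?d l)) \<le> ?K * (e\<^sup>2 * (cmod h)\<^sup>2 * exp e)"
      by (intro norm_blinfun_bound) auto
    then have "norm (G e \<eta> - G e \<zeta> - opf (\<lambda>l. h * ?d l)) / cmod h \<le> ?K * (e\<^sup>2 * (cmod h)\<^sup>2 * exp e) / cmod h"
      by (rule divide_right_mono) simp
    also have "\<dots> = ?H \<eta>"
      using h by (simp add: power2_eq_square h_def)
    finally show "norm (G e \<eta> - G e \<zeta> - opf (\<lambda>l. (\<eta> - \<zeta>) * ?d l)) / norm (\<eta> - \<zeta>) \<le> ?H \<eta>"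
      by (simp only: h_def)
  next
    have "(?H \<longlongrightarrow> ?K * (e\<^sup>2 * cmod (\<zeta> - \<zeta>) * exp e)) (at \<zeta>)"
      by (intro tendsto_intros)
    then show "(?H \<longlongrightarrow> 0) (at \<zeta>)"
      by simp
  qed (use lin in simp_all)
qed

lemma entire_G:
  assumes e: "0 \<le> e" and y: "entire y"
  shows "entire (\<lambda>\<zeta>. G e \<zeta> (y \<zeta>))" "entire (\<lambda>\<zeta>. G e (- \<zeta>) (y \<zeta>))"
proof -
  let ?d = "\<lambda>\<zeta> l. indicator {0..e} l * (\<i> * complex_of_real l * exp (\<i> * \<zeta> * complex_of_real l))"
  have "bounded_borel (?d \<zeta>)" for \<zeta>
  proof -
    have *: "bounded_borel (\<lambda>l. indicator {0..e} l * (\<i> * complex_of_real l))"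
      by (rule bounded_borelI[of _ e]) (auto simp: indicator_def norm_mult e)
    have eq: "?d \<zeta> = (\<lambda>l. (indicator {0..e} l * (\<i> * complex_of_real l)) *
        (indicator {0..e} l * exp (\<i> * \<zeta> * complex_of_real l)))"
      by (auto simp: fun_eq_iff indicator_def)
    show ?thesis
      unfolding eq by (rule bounded_borel_mult[OF * bounded_borel_exp])
  qed
  then have d: "opf (\<lambda>l. h * ?d \<zeta> l) x = h *\<^sub>C opf (?d \<zeta>) x" for h \<zeta> x
    by (rule opf_cmult)
  show "entire (\<lambda>\<zeta>. G e \<zeta> (y \<zeta>))"
    unfolding entire_def
  proof
    fix \<zeta>
    obtain D where D: "(y has_derivative (\<lambda>h. h *\<^sub>C D)) (at \<zeta>)"
      using y by (auto simp: entire_def)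
    have "((\<lambda>\<zeta>. G e \<zeta> (y \<zeta>)) has_derivative
        (\<lambda>h. G e \<zeta> (h *\<^sub>C D) + opf (\<lambda>l. h * ?d \<zeta> l) (y \<zeta>))) (at \<zeta>)"
      by (rule bounded_bilinear.FDERIV[OF bounded_bilinear_blinfun_apply G_has_derivative[OF e] D])
    then show "\<exists>D. ((\<lambda>\<zeta>. G e \<zeta> (y \<zeta>)) has_derivative (\<lambda>h. h *\<^sub>C D)) (at \<zeta>)"
      by (auto simp: G_scaleC d scaleC_add_right[symmetric])
  qed
  show "entire (\<lambda>\<zeta>. G e (- \<zeta>) (y \<zeta>))"
    unfolding entire_def
  proof
    fix \<zeta>
    obtain D where D: "(y has_derivative (\<lambda>h. h *\<^sub>C D)) (at \<zeta>)"
      using y by (auto simp: entire_def)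
    have "((\<lambda>\<zeta>. G e (- \<zeta>)) has_derivative (\<lambda>h. opf (\<lambda>l. (- h) * ?d (- \<zeta>) l))) (at \<zeta>)"
      by (rule has_derivative_compose[OF _ G_has_derivative[OF e]]) (auto intro!: derivative_eq_intros)
    then have "((\<lambda>\<zeta>. G e (- \<zeta>) (y \<zeta>)) has_derivative
        (\<lambda>h. G e (- \<zeta>) (h *\<^sub>C D) + opf (\<lambda>l. (- h) * ?d (- \<zeta>) l) (y \<zeta>))) (at \<zeta>)"
      by (rule bounded_bilinear.FDERIV[OF bounded_bilinear_blinfun_apply _ D])
    then have "((\<lambda>\<zeta>. G e (- \<zeta>) (y \<zeta>)) has_derivative
        (\<lambda>h. h *\<^sub>C (G e (- \<zeta>) D - opf (?d (- \<zeta>)) (y \<zeta>)))) (at \<zeta>)"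
      unfolding d G_scaleC scaleC.minus_left scaleC.diff_right by simp
    then show "\<exists>D. ((\<lambda>\<zeta>. G e (- \<zeta>) (y \<zeta>)) has_derivative (\<lambda>h. h *\<^sub>C D)) (at \<zeta>)"
      by blast
  qed
qed

end

section \<open>Iterated integrals\<close>

text \<open>The indefinite integral \<open>F\<close> is Lipschitz on the half-open interval, so it
  extends continuously to the closed one; the fundamental theorem applied to the extension
  \<open>H\<close> gives integrability up to the end point.\<close>

lemma integrable_bounded_continuous_Ico:
  fixes f :: "real \<Rightarrow> 'a::banach"
  assumes cont: "continuous_on {a..<b} f" and M: "\<And>x. x \<in> {a..<b} \<Longrightarrow> norm (f x) \<le> M"
  shows "f integrable_on {a..b}"
proof (cases "a < b")
  case True
  have M0: "0 \<le> M"
    using M[of a] True norm_ge_zero[of "f a"] by (simp del: norm_ge_zero)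
  define F where "F x = integral {a..x} f" for x
  have int: "f integrable_on {x..y}" if "a \<le> x" "y < b" for x y
    using that by (intro integrable_continuous_real continuous_on_subset[OF cont]) auto
  have "M-lipschitz_on {a..<b} F"
  proof (rule lipschitz_onI)
    have le: "norm (F y - F x) \<le> M * (y - x)" if "a \<le> x" "x \<le> y" "y < b" for x y
    proof -
      have "F x + integral {x..y} f = F y"
        unfolding F_def using that int[of a y] by (intro Henstock_Kurzweil_Integration.integral_combine) auto
      then have "F y - F x = integral {x..y} f"
        by (metis add_diff_cancel_left')
      moreover have "norm (integral {x..y} f) \<le> M * (y - x)"
        using has_integral_bound_real[OF M0 finite.emptyI integrable_integral[OF int[of x y]]] that M
        by simp
      ultimately show ?thesis by simp
    qed
    show "dist (F x) (F y) \<le> M * dist x y" if "x \<in> {a..<b}" "y \<in> {a..<b}" for x y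
      using le[of x y] le[of y x] that
      by (cases "x \<le> y") (auto simp: dist_norm abs_if norm_minus_commute)
  qed (rule M0)
  then have "uniformly_continuous_on {a..<b} F"
    by (rule lipschitz_on_uniformly_continuous)
  then obtain H where H: "uniformly_continuous_on (closure {a..<b}) H" "\<And>x. x \<in> {a..<b} \<Longrightarrow> F x = H x"
    using uniformly_continuous_on_extension_on_closure by metis
  have "(f has_integral (H b - H a)) {a..b}"
  proof (rule fundamental_theorem_of_calculus_interior)
    show "continuous_on {a..b} H"
      using H(1) True by (simp add: uniformly_continuous_imp_continuous)
    fix x assume x: "x \<in> {a<..<b}"
    define y where "y = (x + b) / 2"
    have y: "x < y" "y < b" "a < x"
      using x by (auto simp: y_def)
    have "(F has_vector_derivative f x) (at x within {a..y})"
      unfolding F_def using y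
      by (intro integral_has_vector_derivative continuous_on_subset[OF cont]) auto
    then have "(F has_vector_derivative f x) (at x)"
      using y by (simp add: at_within_Icc_at)
    then show "(H has_vector_derivative f x) (at x)"
      by (rule has_vector_derivative_transform_within_open[where S="{a<..<y}"]) (use y H(2) in auto)
  qed (use True in simp)
  then show ?thesis
    by blast
next
  case False
  then show ?thesis
    by (cases "a = b") (auto intro!: integrable_negligible)
qed

lemma integrable_bounded_continuous_interior:
  fixes f :: "real \<Rightarrow> 'a::banach"
  assumes cont: "continuous_on {a<..<b} f" and M: "\<And>x. x \<in> {a<..<b} \<Longrightarrow> norm (f x) \<le> M"
  shows "f integrable_on {a..b}"
proof (cases "a < b")
  case True
  define c where "c = (a + b) / 2"
  have c: "a < c" "c < b"
    using True by (auto simp: c_def)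
  have "f integrable_on {c..b}"
    using c M by (intro integrable_bounded_continuous_Ico[where M=M] continuous_on_subset[OF cont]) auto
  \<comment> \<open>Reflection turns the open left end into an open right end.\<close>
  moreover have "(\<lambda>x. f (- x)) integrable_on {-c..-a}"
    using c M
    by (intro integrable_bounded_continuous_Ico[where M=M] continuous_on_compose2[OF cont] continuous_intros) auto
  then have "f integrable_on {a..c}"
    by simp
  ultimately show ?thesis
    using c by (intro Henstock_Kurzweil_Integration.integrable_combine[of a c b]) auto
next
  case False
  then show ?thesis
    by (cases "a = b") (auto intro!: integrable_negligible)
qed

lemma integrable_bounded_continuous_off_finite:
  fixes f :: "real \<Rightarrow> 'a::banach"
  assumes "finite N" "continuous_on ({a<..<b} - N) f" "\<And>x. x \<in> {a<..<b} - N \<Longrightarrow> norm (f x) \<le> M"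
  shows "f integrable_on {a..b}"
  using assms
proof (induction N arbitrary: a b)
  case empty
  then show ?case
    by (intro integrable_bounded_continuous_interior) auto
next
  case (insert p N)
  show ?case
  proof (cases "p \<in> {a<..<b}")
    case True
    have "f integrable_on {a..p}" "f integrable_on {p..b}"
      using True insert.prems by (auto intro!: insert.IH elim!: continuous_on_subset)
    with True show ?thesis
      by (intro Henstock_Kurzweil_Integration.integrable_combine[of a p b]) auto
  next
    case False
    then have "{a<..<b} - insert p N = {a<..<b} - N"
      by auto
    with insert show ?thesis
      by simp
  qed
qed

definition distinct_points :: "real \<Rightarrow> real \<Rightarrow> nat \<Rightarrow> real set \<Rightarrow> (nat \<Rightarrow> real) set"
  where "distinct_points a b n N = {t. inj_on t {..<n} \<and> t ` {..<n} \<subseteq> {a..b} - N}"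

text \<open>\<open>N\<close> collects the break points of the curve and the times fixed by outer integrations.\<close>

definition cont_off_diagonal ::
    "real \<Rightarrow> real \<Rightarrow> nat \<Rightarrow> real set \<Rightarrow> real \<Rightarrow> ((nat \<Rightarrow> real) \<Rightarrow> 'h::chilbert_space) \<Rightarrow> bool"
  where "cont_off_diagonal a b n N M g \<longleftrightarrow> finite N \<and> 0 \<le> M \<and> (\<forall>t\<in>distinct_points a b n N. norm (g t) \<le> M) \<and>
    continuous_on (distinct_points a b n N) g"

text \<open>Once the outermost time \<open>s\<close> is fixed, the inner times have to avoid it, so
  slicing moves it into the exceptional set. This is what makes inductions over iterated integrals
  work.\<close>

lemma distinct_points_case_nat:
  "case_nat s t \<in> distinct_points a b (Suc n) N \<longleftrightarrow> s \<in> {a..b} - N \<and> t \<in> distinct_points a b n (insert s N)"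
proof -
  have "inj_on (case_nat s t) (Suc ` {..<n}) \<longleftrightarrow> inj_on t {..<n}"
    by (auto simp: inj_on_def)
  moreover have "case_nat s t ` Suc ` {..<n} = t ` {..<n}"
    by force
  ultimately show ?thesis
    by (auto simp: distinct_points_def lessThan_Suc_eq_insert_0 image_iff)
qed

lemma continuous_on_case_nat:
  fixes f :: "'a::topological_space \<Rightarrow> 'b::topological_space"
  assumes "continuous_on S f" "\<And>i. continuous_on S (\<lambda>x. g x i)"
  shows "continuous_on S (\<lambda>x. case_nat (f x) (g x))"
proof (rule continuous_on_coordinatewise_then_product)
  fix i show "continuous_on S (\<lambda>x. case_nat (f x) (g x) i)"
    using assms by (cases i) auto
qed

lemma cont_off_diagonal_slice:
  assumes "cont_off_diagonal a b (Suc n) N M g" "s \<in> {a..b} - N"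
  shows "cont_off_diagonal a b n (insert s N) M (\<lambda>t. g (case_nat s t))"
proof -
  have "continuous_on (distinct_points a b n (insert s N)) (\<lambda>t. case_nat s t :: nat \<Rightarrow> real)"
    by (intro continuous_on_case_nat continuous_on_const
        continuous_on_subset[OF continuous_on_product_coordinates]) auto
  moreover have "case_nat s t \<in> distinct_points a b (Suc n) N" if "t \<in> distinct_points a b n (insert s N)" for t
    using assms(2) that by (simp add: distinct_points_case_nat)
  ultimately show ?thesis
    using assms unfolding cont_off_diagonal_def
    by (auto intro: continuous_on_compose2[of "distinct_points a b (Suc n) N" g])
qed

lemma iterated_integral_cong:
  assumes "finite N" "\<And>t. t \<in> distinct_points a b n N \<Longrightarrow> f t = g t"
  shows "iterated_integral a b n f = iterated_integral a b n g"
  using assms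
proof (induction n arbitrary: f g N)
  case 0
  then show ?case
    by (simp add: distinct_points_def)
next
  case (Suc n)
  have "iterated_integral a b n (\<lambda>t. g (case_nat s t)) = iterated_integral a b n (\<lambda>t. f (case_nat s t))"
    if "s \<in> {a..b} - N" for s
    using Suc that by (intro Suc.IH[of "insert s N"]) (auto simp: distinct_points_case_nat)
  with Suc.prems(1) show ?case
    by (auto intro!: integral_spike[OF negligible_finite])
qed

lemma norm_integral_le_off_finite:
  fixes f :: "real \<Rightarrow> 'a::banach"
  assumes "a \<le> b" "finite N" "0 \<le> M" "\<And>x. x \<in> {a..b} - N \<Longrightarrow> norm (f x) \<le> M"
  shows "norm (integral {a..b} f) \<le> M * (b - a)"
proof (cases "f integrable_on {a..b}")
  case True
  then show ?thesis
    using has_integral_bound_real[OF assms(3,2) integrable_integral[OF True]] assms(1,4) by simp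
next
  case False
  then show ?thesis
    using assms by (simp add: not_integrable_integral)
qed

lemma norm_iterated_integral_le:
  assumes "a \<le> b" "cont_off_diagonal a b n N M g"
  shows "norm (iterated_integral a b n g) \<le> M * (b - a) ^ n"
  using assms(2)
proof (induction n arbitrary: g N)
  case 0
  then show ?case
    by (auto simp: cont_off_diagonal_def distinct_points_def)
next
  case (Suc n)
  have "norm (iterated_integral a b n (\<lambda>t. g (case_nat s t))) \<le> M * (b - a) ^ n" if "s \<in> {a..b} - N" for s
    using Suc.IH[OF cont_off_diagonal_slice[OF Suc.prems that]] .
  with Suc.prems assms(1) have "norm (iterated_integral a b (Suc n) g) \<le> (M * (b - a) ^ n) * (b - a)"
    by (simp only: iterated_integral.simps) (intro norm_integral_le_off_finite, auto simp: cont_off_diagonal_def)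
  then show ?case
    by (simp add: mult_ac)
qed

text \<open>The exceptional sets \<open>NN k\<close> vary because the slice of \<open>g\<close> at a moving point \<open>P k\<close> is
  discontinuous at \<open>P k\<close>; a given point is then exceptional only finitely often.\<close>

definition iterated_dominated_convergence ::
    "real \<Rightarrow> real \<Rightarrow> nat \<Rightarrow> 'h::chilbert_space itself \<Rightarrow> bool"
  where "iterated_dominated_convergence a b n TYPE('h) \<longleftrightarrow>
    (\<forall>(G :: nat \<Rightarrow> (nat \<Rightarrow> real) \<Rightarrow> 'h) g NN N M.
      (\<forall>k. cont_off_diagonal a b n (NN k) M (G k)) \<longrightarrow> cont_off_diagonal a b n N M g \<longrightarrow>
      (\<forall>s\<in>{a..b} - N. \<forall>\<^sub>F k in sequentially. s \<notin> NN k) \<longrightarrow>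
      (\<forall>t\<in>distinct_points a b n N. (\<lambda>k. G k t) \<longlonglongrightarrow> g t) \<longrightarrow>
      (\<lambda>k. iterated_integral a b n (G k)) \<longlonglongrightarrow> iterated_integral a b n g)"

text \<open>Dominated convergence along sequences yields continuity in a parameter. The premise
  \<open>ev\<close> asks that a time regular at the limit be regular along the sequence from some
  index on.\<close>

lemma continuous_on_iterated_integral:
  fixes g :: "'p::{first_countable_topology, t2_space} \<Rightarrow> (nat \<Rightarrow> real) \<Rightarrow> 'h::chilbert_space"
  assumes dc: "iterated_dominated_convergence a b n TYPE('h)"
    and nice: "\<And>p. p \<in> S \<Longrightarrow> cont_off_diagonal a b n (N p) M (g p)"
    and ev: "\<And>P p s. p \<in> S \<Longrightarrow> \<forall>k. P k \<in> S \<Longrightarrow> P \<longlonglongrightarrow> p \<Longrightarrow> s \<in> {a..b} - N p \<Longrightarrow>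
      \<forall>\<^sub>F k in sequentially. s \<notin> N (P k)"
    and lim: "\<And>P p t. p \<in> S \<Longrightarrow> \<forall>k. P k \<in> S \<Longrightarrow> P \<longlonglongrightarrow> p \<Longrightarrow> t \<in> distinct_points a b n (N p) \<Longrightarrow>
      (\<lambda>k. g (P k) t) \<longlonglongrightarrow> g p t"
  shows "continuous_on S (\<lambda>p. iterated_integral a b n (g p))"
proof (rule continuous_on_sequentiallyI)
  fix P p assume "\<forall>k. P k \<in> S" "p \<in> S" "P \<longlonglongrightarrow> p"
  then show "(\<lambda>k. iterated_integral a b n (g (P k))) \<longlonglongrightarrow> iterated_integral a b n (g p)"
    using dc[unfolded iterated_dominated_convergence_def, rule_format,
        of "\<lambda>k. N (P k)" M "\<lambda>k. g (P k)" "N p" "g p"] nice ev lim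
    by blast
qed

lemma eventually_not_insert:
  fixes P :: "nat \<Rightarrow> real"
  assumes "P \<longlonglongrightarrow> p" "s \<noteq> p"
  shows "\<forall>\<^sub>F k in sequentially. P k \<noteq> s"
  by (rule tendsto_imp_eventually_ne[OF assms(1)]) (use assms(2) in auto)

lemma eventually_distinct_points:
  assumes "P \<longlonglongrightarrow> p" "t \<in> distinct_points a b n (insert p N)" "p \<in> {a..b} - N" "\<forall>k. P k \<in> {a..b} - N"
  shows "\<forall>\<^sub>F k in sequentially. case_nat (P k) t \<in> distinct_points a b (Suc n) N"
proof -
  have "\<forall>\<^sub>F k in sequentially. \<forall>i\<in>{..<n}. P k \<noteq> t i"
    using assms by (intro eventually_ball_finite ballI eventually_not_insert) (auto simp: distinct_points_def)
  moreover have "case_nat (P k) t \<in> distinct_points a b (Suc n) N" if "\<forall>i\<in>{..<n}. P k \<noteq> t i" for k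
    unfolding distinct_points_case_nat using that assms by (auto simp: distinct_points_def) (metis lessThan_iff)
  ultimately show ?thesis
    by (rule eventually_mono)
qed

text \<open>The exceptional set moves with the slice position, but along positions converging to p
  every time different from p and outside \<open>N\<close> is eventually avoided.\<close>

lemma continuous_on_slices:
  fixes g :: "(nat \<Rightarrow> real) \<Rightarrow> 'h::chilbert_space"
  assumes dc: "iterated_dominated_convergence a b n TYPE('h)" and g: "cont_off_diagonal a b (Suc n) N M g"
  shows "continuous_on ({a..b} - N) (\<lambda>s. iterated_integral a b n (\<lambda>t. g (case_nat s t)))"
proof (rule continuous_on_iterated_integral[OF dc, where N="\<lambda>s. insert s N" and M=M])
  show "cont_off_diagonal a b n (insert s N) M (\<lambda>t. g (case_nat s t))" if "s \<in> {a..b} - N" for s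
    using cont_off_diagonal_slice[OF g that] .
  fix P :: "nat \<Rightarrow> real" and p assume P: "p \<in> {a..b} - N" "\<forall>k. P k \<in> {a..b} - N" "P \<longlonglongrightarrow> p"
  show "\<forall>\<^sub>F k in sequentially. s \<notin> insert (P k) N" if "s \<in> {a..b} - insert p N" for s
    by (rule eventually_mono[OF eventually_not_insert[OF P(3), of s]]) (use that in auto)
  fix t assume t: "t \<in> distinct_points a b n (insert p N)"
  show "(\<lambda>k. g (case_nat (P k) t)) \<longlonglongrightarrow> g (case_nat p t)"
  proof (rule continuous_on_tendsto_compose[of "distinct_points a b (Suc n) N" g])
    have "continuous_on UNIV (\<lambda>s. case_nat s t)"
      by (intro continuous_on_case_nat continuous_intros)
    then show "(\<lambda>k. case_nat (P k) t) \<longlonglongrightarrow> case_nat p t"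
      by (rule continuous_on_tendsto_compose) (use P in auto)
  qed (use g P t eventually_distinct_points[OF P(3) t P(1,2)] in \<open>auto simp: cont_off_diagonal_def distinct_points_case_nat\<close>)
qed

lemma iterated_integrable_aux:
  fixes g :: "(nat \<Rightarrow> real) \<Rightarrow> 'h::chilbert_space"
  assumes "a \<le> b" "iterated_dominated_convergence a b n TYPE('h)" and g: "cont_off_diagonal a b (Suc n) N M g"
  shows "(\<lambda>s. iterated_integral a b n (\<lambda>t. g (case_nat s t))) integrable_on {a..b}"
proof (rule integrable_bounded_continuous_off_finite)
  show "finite N"
    using g by (simp add: cont_off_diagonal_def)
  show "continuous_on ({a<..<b} - N) (\<lambda>s. iterated_integral a b n (\<lambda>t. g (case_nat s t)))"
    by (rule continuous_on_subset[OF continuous_on_slices[OF assms(2) g]]) auto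
  show "norm (iterated_integral a b n (\<lambda>t. g (case_nat s t))) \<le> M * (b - a) ^ n"
    if "s \<in> {a<..<b} - N" for s
    using that by (intro norm_iterated_integral_le[OF assms(1) cont_off_diagonal_slice[OF g]]) auto
qed

text \<open>Induction on the dimension: the inner integrals converge off \<open>N\<close> by the
  induction hypothesis, and the outer limit follows from scalar dominated convergence applied to the
  norm of their difference.\<close>

lemma iterated_dominated_convergence:
  assumes "a \<le> b"
  shows "iterated_dominated_convergence a b n TYPE('h::chilbert_space)"
proof (induction n)
  case 0
  then show ?case
    by (auto simp: iterated_dominated_convergence_def distinct_points_def)
next
  case (Suc n)
  show ?case
    unfolding iterated_dominated_convergence_def
  proof (intro allI impI)
    fix G :: "nat \<Rightarrow> (nat \<Rightarrow> real) \<Rightarrow> 'h" and g NN N M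
    assume G: "\<forall>k. cont_off_diagonal a b (Suc n) (NN k) M (G k)" and g: "cont_off_diagonal a b (Suc n) N M g"
      and ev: "\<forall>s\<in>{a..b} - N. \<forall>\<^sub>F k in sequentially. s \<notin> NN k"
      and lim: "\<forall>t\<in>distinct_points a b (Suc n) N. (\<lambda>k. G k t) \<longlonglongrightarrow> g t"
    define h where "h s = iterated_integral a b n (\<lambda>t. g (case_nat s t))" for s
    define H where "H k s = iterated_integral a b n (\<lambda>t. G k (case_nat s t))" for k s
    have fin: "finite N" "finite (NN k)" and M: "0 \<le> M" for k
      using G g by (auto simp: cont_off_diagonal_def)
    have h: "h integrable_on {a..b}" and H: "H k integrable_on {a..b}" for k
      unfolding h_def H_def using iterated_integrable_aux[OF assms Suc.IH] G g by blast+
    have hH: "(\<lambda>k. H k s) \<longlonglongrightarrow> h s" if s: "s \<in> {a..b} - N" for s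
    proof -
      obtain K where K: "\<And>k. K \<le> k \<Longrightarrow> s \<notin> NN k"
        using ev[rule_format, OF s] by (auto simp: eventually_sequentially)
      \<comment> \<open>The shift by \<open>K\<close> discards the finitely many indices for which
        \<open>s\<close> is exceptional, so that every remaining slice is regular.\<close>
      have "(\<lambda>k. H (k + K) s) \<longlonglongrightarrow> h s"
        unfolding h_def H_def
      proof (rule Suc.IH[unfolded iterated_dominated_convergence_def, rule_format,
            where NN="\<lambda>k. insert s (NN (k + K))" and N="insert s N"])
        show "cont_off_diagonal a b n (insert s (NN (k + K))) M (\<lambda>t. G (k + K) (case_nat s t))" for k
          using G s K by (intro cont_off_diagonal_slice) auto
        show "cont_off_diagonal a b n (insert s N) M (\<lambda>t. g (case_nat s t))"
          using g s by (rule cont_off_diagonal_slice)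
        show "\<forall>\<^sub>F k in sequentially. s' \<notin> insert s (NN (k + K))" if "s' \<in> {a..b} - insert s N" for s'
          using ev[rule_format, of s'] that by (auto simp: eventually_sequentially) (meson trans_le_add1)
        show "(\<lambda>k. G (k + K) (case_nat s t)) \<longlonglongrightarrow> g (case_nat s t)" if "t \<in> distinct_points a b n (insert s N)" for t
          using lim s that LIMSEQ_ignore_initial_segment[of "\<lambda>k. G k (case_nat s t)" _ K]
          by (auto simp: distinct_points_case_nat)
      qed
      then show ?thesis
        by (rule LIMSEQ_offset)
    qed
    \<comment> \<open>On exceptional points nothing is known about the slices; the value 0 there
      makes the bound hold on the whole interval without changing the integral.\<close>
    define d where "d k s = (if s \<in> N \<union> NN k then 0 else norm (H k s - h s))" for k s
    have bnd: "norm (d k s) \<le> 2 * (M * (b - a) ^ n)" if "s \<in> {a..b}" for k s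
    proof (cases "s \<in> N \<union> NN k")
      case True
      then show ?thesis
        using M assms by (simp add: d_def)
    next
      case False
      then have "norm (H k s) \<le> M * (b - a) ^ n" "norm (h s) \<le> M * (b - a) ^ n"
        using that g G unfolding H_def h_def
        by (auto intro!: norm_iterated_integral_le[OF assms] cont_off_diagonal_slice)
      with False show ?thesis
        using norm_triangle_ineq4[of "H k s" "h s"] by (simp add: d_def)
    qed
    have d: "d k integrable_on {a..b}" for k
    proof (rule integrable_bounded_continuous_off_finite)
      show "finite (N \<union> NN k)"
        using fin by simp
      have "continuous_on ({a..b} - N) h" "continuous_on ({a..b} - NN k) (H k)"
        unfolding h_def H_def using continuous_on_slices[OF Suc.IH] G g by blast+
      then have "continuous_on ({a<..<b} - (N \<union> NN k)) (\<lambda>s. norm (H k s - h s))"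
        by (intro continuous_intros; elim continuous_on_subset) auto
      then show "continuous_on ({a<..<b} - (N \<union> NN k)) (d k)"
        by (rule continuous_on_eq) (auto simp: d_def)
      show "norm (d k s) \<le> 2 * (M * (b - a) ^ n)" if "s \<in> {a<..<b} - (N \<union> NN k)" for s
        using that by (intro bnd) auto
    qed
    have "(\<lambda>k. integral {a..b} (d k)) \<longlonglongrightarrow> integral {a..b} (\<lambda>s. 0::real)"
    proof (rule dominated_convergence(2)[OF d, where h="\<lambda>s. 2 * (M * (b - a) ^ n)"])
      fix s assume s: "s \<in> {a..b}"
      show "(\<lambda>k. d k s) \<longlonglongrightarrow> 0"
      proof (cases "s \<in> N")
        case False
        then have "(\<lambda>k. norm (H k s - h s)) \<longlonglongrightarrow> 0"
          using hH[of s] s by (simp add: tendsto_norm_zero LIM_zero)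
        moreover have "\<forall>\<^sub>F k in sequentially. norm (H k s - h s) = d k s"
          using ev[rule_format, of s] False s by (auto simp: d_def elim: eventually_mono)
        ultimately show ?thesis
          by (rule Lim_transform_eventually)
      qed (simp add: d_def)
    qed (use bnd in auto)
    then have d0: "(\<lambda>k. integral {a..b} (d k)) \<longlonglongrightarrow> 0"
      by simp
    have le: "norm (integral {a..b} (H k) - integral {a..b} h) \<le> integral {a..b} (d k)" for k
    proof -
      have "integral {a..b} (H k) - integral {a..b} h = integral {a..b} (\<lambda>s. H k s - h s)"
        using H h by (simp add: Henstock_Kurzweil_Integration.integral_diff)
      also have "\<dots> = integral {a..b} (\<lambda>s. if s \<in> N \<union> NN k then 0 else H k s - h s)"
        using fin by (intro integral_spike[of "N \<union> NN k"]) auto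
      also have "norm \<dots> \<le> integral {a..b} (d k)"
      proof (rule integral_norm_bound_integral[OF _ d])
        have "(\<lambda>s. H k s - h s) integrable_on {a..b}"
          using H h by (intro integrable_diff)
        then show "(\<lambda>s. if s \<in> N \<union> NN k then 0 else H k s - h s) integrable_on {a..b}"
          by (rule integrable_spike_finite[of "N \<union> NN k", rotated 2]) (use fin in auto)
      qed (auto simp: d_def)
      finally show ?thesis .
    qed
    have "(\<lambda>k. integral {a..b} (H k) - integral {a..b} h) \<longlonglongrightarrow> 0"
      by (rule Lim_null_comparison[OF always_eventually[OF allI[OF le]] d0])
    then show "(\<lambda>k. iterated_integral a b (Suc n) (G k)) \<longlonglongrightarrow> iterated_integral a b (Suc n) g"
      unfolding iterated_integral.simps h_def[symmetric] H_def[symmetric] by (rule LIM_zero_cancel)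
  qed
qed

lemma iterated_integrable:
  assumes "a \<le> b" "cont_off_diagonal a b (Suc n) N M g"
  shows "(\<lambda>s. iterated_integral a b n (\<lambda>t. g (case_nat s t))) integrable_on {a..b}"
  using iterated_integrable_aux[OF assms(1) iterated_dominated_convergence[OF assms(1)] assms(2)] .

lemma iterated_integral_bounded_linear:
  assumes "a \<le> b" "bounded_linear L" "cont_off_diagonal a b n N M g"
  shows "iterated_integral a b n (\<lambda>t. L (g t)) = L (iterated_integral a b n g)"
  using assms(3)
proof (induction n arbitrary: g N)
  case (Suc n)
  have "iterated_integral a b n (\<lambda>t. L (g (case_nat s t))) = L (iterated_integral a b n (\<lambda>t. g (case_nat s t)))"
    if "s \<in> {a..b} - N" for s
    using Suc.IH[OF cont_off_diagonal_slice[OF Suc.prems that]] .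
  moreover have "finite N"
    using Suc.prems by (simp add: cont_off_diagonal_def)
  ultimately have "iterated_integral a b (Suc n) (\<lambda>t. L (g t)) =
      integral {a..b} (\<lambda>s. L (iterated_integral a b n (\<lambda>t. g (case_nat s t))))"
    by (auto intro!: integral_spike[OF negligible_finite, of N])
  then show ?case
    using integral_linear[OF iterated_integrable[OF assms(1) Suc.prems] assms(2)]
    by (simp add: o_def)
qed simp

lemma iterated_integral_sum:
  assumes "a \<le> b" "finite I" "\<And>i. i \<in> I \<Longrightarrow> cont_off_diagonal a b n N M (g i)"
  shows "iterated_integral a b n (\<lambda>t. \<Sum>i\<in>I. g i t) = (\<Sum>i\<in>I. iterated_integral a b n (g i))"
  using assms(3)
proof (induction n arbitrary: g N)
  case (Suc n)
  show ?case
  proof (cases "I = {}")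
    case False
    then have "finite N"
      using Suc.prems by (auto simp: cont_off_diagonal_def)
    moreover have "iterated_integral a b n (\<lambda>t. \<Sum>i\<in>I. g i (case_nat s t)) =
        (\<Sum>i\<in>I. iterated_integral a b n (\<lambda>t. g i (case_nat s t)))" if "s \<in> {a..b} - N" for s
      using Suc.IH[OF cont_off_diagonal_slice[OF Suc.prems that]] .
    ultimately have "iterated_integral a b (Suc n) (\<lambda>t. \<Sum>i\<in>I. g i t) =
        integral {a..b} (\<lambda>s. \<Sum>i\<in>I. iterated_integral a b n (\<lambda>t. g i (case_nat s t)))"
      by (auto intro!: integral_spike[OF negligible_finite, of N])
    then show ?thesis
      using integral_sum[OF assms(2) iterated_integrable[OF assms(1) Suc.prems]] by simp
  next
    case True
    have "iterated_integral a b m (\<lambda>t. 0 :: 'h::chilbert_space) = 0" for m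
      by (induction m) auto
    from this[of "Suc n"] True show ?thesis
      by (simp del: iterated_integral.simps)
  qed
qed simp

section \<open>Fubini's theorem and invariance under permutations of the times\<close>

lemma double_integral_eq_lebesgue:
  fixes k :: "real \<Rightarrow> real \<Rightarrow> complex" and a b :: real and N :: "real set"
  defines "W \<equiv> {p. fst p \<in> {a..b} - N \<and> snd p \<in> {a..b} - N \<and> fst p \<noteq> snd p}"
  assumes fin: "finite N" and cont: "continuous_on W (\<lambda>p. k (fst p) (snd p))"
    and bnd: "\<And>p. p \<in> W \<Longrightarrow> cmod (k (fst p) (snd p)) \<le> M"
  defines "f \<equiv> \<lambda>p. indicator W p *\<^sub>R k (fst p) (snd p)"
  shows "integrable (lborel \<Otimes>\<^sub>M lborel) f"
    and "integral {a..b} (\<lambda>s. integral {a..b} (k s)) = (LINT s|lborel. LINT r|lborel. f (s, r))"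
proof -
  have W: "W \<in> sets borel"
  proof -
    have "W = ({a..b} - N) \<times> ({a..b} - N) - {p. \<exists>s. p = (s, s)}"
      by (auto simp: W_def)
    moreover have "{a..b} - N \<in> sets borel"
      using fin by (intro sets.Diff) (auto simp: finite_imp_closed)
    then have "({a..b} - N) \<times> ({a..b} - N) \<in> sets borel"
      unfolding borel_prod[symmetric] by (intro pair_measureI)
    ultimately show ?thesis
      using closed_diagonal[where 'a=real] by (auto intro!: sets.Diff)
  qed
  have meas: "f \<in> borel_measurable borel"
    unfolding f_def by (rule borel_measurable_continuous_on_indicator[OF W cont])
  then have meas': "f \<in> borel_measurable (lborel \<Otimes>\<^sub>M lborel)"
    by (simp add: borel_prod[symmetric])
  have int: "integrable lborel f"
  proof (rule integrableI_bounded_set[of "cbox (a, a) (b, b)" _ _ "\<bar>M\<bar>"])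
    show "AE p in lborel. p \<in> cbox (a, a) (b, b) \<longrightarrow> norm (f p) \<le> \<bar>M\<bar>"
      using bnd by (intro AE_I2) (auto simp: f_def indicator_def intro: order_trans[OF _ abs_ge_self])
    show "AE p in lborel. p \<notin> cbox (a, a) (b, b) \<longrightarrow> f p = 0"
      by (auto simp: f_def indicator_def W_def cbox_Pair_eq)
  qed (use meas in \<open>auto simp: emeasure_lborel_cbox_eq\<close>)
  then show int': "integrable (lborel \<Otimes>\<^sub>M lborel) f"
    by (simp add: lborel_prod)
  \<comment> \<open>The section of \<open>f\<close> at \<open>s\<close> differs from
    \<open>k s\<close> on the interval only at \<open>s\<close> and on \<open>N\<close>, a finite
    set.\<close>
  have inner: "integral {a..b} (k s) = (LINT r|lborel. f (s, r))" if s: "s \<in> {a..b} - N" for s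
  proof -
    have "integrable lborel (\<lambda>r. f (s, r))"
    proof (rule integrableI_bounded_set[of "{a..b}" _ _ "\<bar>M\<bar>"])
      show "(\<lambda>r. f (s, r)) \<in> borel_measurable lborel"
        using measurable_compose[OF measurable_Pair1' meas', of s] by simp
      show "AE r in lborel. r \<in> {a..b} \<longrightarrow> norm (f (s, r)) \<le> \<bar>M\<bar>"
        using bnd[of "(s, r)" for r]
        by (intro AE_I2) (auto simp: f_def indicator_def intro: order_trans[OF _ abs_ge_self])
      show "AE r in lborel. r \<notin> {a..b} \<longrightarrow> f (s, r) = 0"
        by (auto simp: f_def indicator_def W_def)
    qed (auto simp: emeasure_lborel_Icc_eq)
    then have "(LINT r|lborel. f (s, r)) = integral UNIV (\<lambda>r. f (s, r))"
      by (rule integral_lborel[symmetric])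
    also have "\<dots> = integral UNIV (\<lambda>r. if r \<in> {a..b} then f (s, r) else 0)"
      by (rule arg_cong[where f="integral UNIV"]) (auto simp: f_def indicator_def W_def)
    also have "\<dots> = integral {a..b} (\<lambda>r. f (s, r))"
      by (rule integral_restrict_UNIV)
    also have "\<dots> = integral {a..b} (k s)"
      using fin s by (intro integral_spike[of "insert s N"]) (auto simp: f_def W_def)
    finally show ?thesis ..
  qed
  have "(LINT s|lborel. LINT r|lborel. f (s, r)) = integral UNIV (\<lambda>s. LINT r|lborel. f (s, r))"
    by (rule integral_lborel[symmetric, OF lborel_pair.integrable_fst'[OF int']])
  also have "\<dots> = integral UNIV (\<lambda>s. if s \<in> {a..b} then LINT r|lborel. f (s, r) else 0)"
    by (rule arg_cong[where f="integral UNIV"]) (auto simp: f_def indicator_def W_def fun_eq_iff)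
  also have "\<dots> = integral {a..b} (\<lambda>s. LINT r|lborel. f (s, r))"
    by (rule integral_restrict_UNIV)
  also have "\<dots> = integral {a..b} (\<lambda>s. integral {a..b} (k s))"
    using fin inner by (intro integral_spike[of N]) auto
  finally show "integral {a..b} (\<lambda>s. integral {a..b} (k s)) = (LINT s|lborel. LINT r|lborel. f (s, r))" ..
qed

text \<open>The set \<open>W\<close> is symmetric, so both iterated integrals become Lebesgue
  integrals of one integrable function and Fubini's theorem applies.\<close>

lemma double_integral_swap_complex:
  fixes k :: "real \<Rightarrow> real \<Rightarrow> complex" and a b :: real and N :: "real set"
  defines "W \<equiv> {p. fst p \<in> {a..b} - N \<and> snd p \<in> {a..b} - N \<and> fst p \<noteq> snd p}"
  assumes fin: "finite N" and cont: "continuous_on W (\<lambda>p. k (fst p) (snd p))"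
    and bnd: "\<And>p. p \<in> W \<Longrightarrow> cmod (k (fst p) (snd p)) \<le> M"
  shows "integral {a..b} (\<lambda>s. integral {a..b} (\<lambda>r. k r s)) = integral {a..b} (\<lambda>s. integral {a..b} (k s))"
proof -
  let ?f = "\<lambda>p. indicator W p *\<^sub>R k (fst p) (snd p)"
  have swap: "prod.swap p \<in> W \<longleftrightarrow> p \<in> W" for p :: "real \<times> real"
    by (auto simp: W_def)
  have cont': "continuous_on W (\<lambda>p. k (snd p) (fst p))"
    by (rule continuous_on_eq[OF continuous_on_compose2[OF cont continuous_on_swap, of W]])
      (auto simp: W_def)
  have bnd': "cmod (k (snd p) (fst p)) \<le> M" if "p \<in> W" for p
    using bnd[of "prod.swap p"] that by (simp add: swap)
  note 1 = double_integral_eq_lebesgue[OF fin cont[unfolded W_def] bnd[unfolded W_def], folded W_def]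
  note 2 = double_integral_eq_lebesgue[OF fin cont'[unfolded W_def] bnd'[unfolded W_def], folded W_def]
  have "integral {a..b} (\<lambda>s. integral {a..b} (\<lambda>r. k r s)) =
      (LINT s|lborel. LINT r|lborel. indicator W (s, r) *\<^sub>R k r s)"
    using 2(2) by simp
  also have "\<dots> = (LINT s|lborel. LINT r|lborel. ?f (r, s))"
    using swap by (auto intro!: Bochner_Integration.integral_cong simp: indicator_def split: prod.splits)
  also have "\<dots> = (LINT s|lborel. LINT r|lborel. ?f (s, r))"
    using lborel_pair.Fubini_integral[OF lborel_pair.integrable_product_swap, of ?f] 1(1)
      lborel_pair.Fubini_integral[of "\<lambda>x y. ?f (x, y)"] by (simp add: split_beta')
  also have "\<dots> = integral {a..b} (\<lambda>s. integral {a..b} (k s))"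
    by (rule 1(2)[symmetric])
  finally show ?thesis .
qed

text \<open>Pairing with a fixed vector reduces the exchange of the two outermost integrals to the
  scalar case. The inner integral \<open>h\<close> is jointly continuous off the diagonal because
  dominated convergence tolerates two moving exceptional points.\<close>

lemma iterated_integral_swap:
  fixes g :: "(nat \<Rightarrow> real) \<Rightarrow> 'h::chilbert_space"
  assumes ab: "a \<le> b" and g: "cont_off_diagonal a b (Suc (Suc n)) N M g"
  shows "integral {a..b} (\<lambda>s. integral {a..b} (\<lambda>r. iterated_integral a b n (\<lambda>t. g (case_nat r (case_nat s t))))) =
    iterated_integral a b (Suc (Suc n)) g"
proof -
  define W where "W = {p. fst p \<in> {a..b} - N \<and> snd p \<in> {a..b} - N \<and> fst p \<noteq> snd p}"
  define h where "h s r = iterated_integral a b n (\<lambda>t. g (case_nat s (case_nat r t)))" for s r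
  have fin: "finite N" and M: "0 \<le> M"
    using g by (auto simp: cont_off_diagonal_def)
  have slice: "cont_off_diagonal a b n (insert (snd p) (insert (fst p) N)) M
      (\<lambda>t. g (case_nat (fst p) (case_nat (snd p) t)))" if "p \<in> W" for p
    using cont_off_diagonal_slice[OF cont_off_diagonal_slice[OF g, of "fst p"], of "snd p"] that by (auto simp: W_def)
  have cont: "continuous_on W (\<lambda>p. h (fst p) (snd p))"
    unfolding h_def
  proof (rule continuous_on_iterated_integral[OF iterated_dominated_convergence[OF ab] slice])
    fix P p assume P: "p \<in> W" "\<forall>k. P k \<in> W" "P \<longlonglongrightarrow> p"
    then have lim: "(\<lambda>k. fst (P k)) \<longlonglongrightarrow> fst p" "(\<lambda>k. snd (P k)) \<longlonglongrightarrow> snd p"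
      by (auto intro: tendsto_intros)
    have ev: "\<forall>\<^sub>F k in sequentially. fst (P k) \<noteq> s \<and> snd (P k) \<noteq> s" if "s \<noteq> fst p" "s \<noteq> snd p" for s
      by (intro eventually_conj eventually_not_insert[OF lim(1)] eventually_not_insert[OF lim(2)] that)
    show "\<forall>\<^sub>F k in sequentially. s \<notin> insert (snd (P k)) (insert (fst (P k)) N)"
      if "s \<in> {a..b} - insert (snd p) (insert (fst p) N)" for s
      by (rule eventually_mono[OF ev]) (use that in auto)
    fix t assume t: "t \<in> distinct_points a b n (insert (snd p) (insert (fst p) N))"
    show "(\<lambda>k. g (case_nat (fst (P k)) (case_nat (snd (P k)) t))) \<longlonglongrightarrow>
        g (case_nat (fst p) (case_nat (snd p) t))"
    proof (rule continuous_on_tendsto_compose[of "distinct_points a b (Suc (Suc n)) N" g])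
      have "continuous_on UNIV (\<lambda>p. case_nat (fst p) (case_nat (snd p) t))"
        by (intro continuous_on_case_nat continuous_on_fst continuous_on_snd continuous_on_id continuous_on_const
            continuous_on_product_then_coordinatewise)
      then show "(\<lambda>k. case_nat (fst (P k)) (case_nat (snd (P k)) t)) \<longlonglongrightarrow> case_nat (fst p) (case_nat (snd p) t)"
        by (rule continuous_on_tendsto_compose) (use P in auto)
      have "\<forall>\<^sub>F k in sequentially. \<forall>i\<in>{..<n}. fst (P k) \<noteq> t i \<and> snd (P k) \<noteq> t i"
        using t by (intro eventually_ball_finite ballI ev) (auto simp: distinct_points_def)
      then show "\<forall>\<^sub>F k in sequentially. case_nat (fst (P k)) (case_nat (snd (P k)) t) \<in> distinct_points a b (Suc (Suc n)) N"
      proof (rule eventually_mono)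
        fix k assume "\<forall>i\<in>{..<n}. fst (P k) \<noteq> t i \<and> snd (P k) \<noteq> t i"
        moreover have "P k \<in> W" using P by simp
        ultimately show "case_nat (fst (P k)) (case_nat (snd (P k)) t) \<in> distinct_points a b (Suc (Suc n)) N"
          using t unfolding distinct_points_case_nat by (auto simp: W_def distinct_points_def) (metis lessThan_iff)+
      qed
    qed (use g t P in \<open>auto simp: cont_off_diagonal_def distinct_points_case_nat W_def\<close>)
  qed
  have bnd: "norm (h (fst p) (snd p)) \<le> M * (b - a) ^ n" if "p \<in> W" for p
    unfolding h_def using norm_iterated_integral_le[OF ab slice[OF that]] .
  have good2: "t \<in> distinct_points a b (Suc (Suc 0)) N \<longleftrightarrow> (t 0, t 1) \<in> W" for t
    by (auto simp: distinct_points_def W_def lessThan_Suc)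
  \<comment> \<open>Viewing \<open>h\<close> as an integrand of two times lets a bounded functional
    be pulled through both outer integrals in either order.\<close>
  have nice2: "cont_off_diagonal a b (Suc (Suc 0)) N (M * (b - a) ^ n) (\<lambda>t. h (t 0) (t 1))"
    "cont_off_diagonal a b (Suc (Suc 0)) N (M * (b - a) ^ n) (\<lambda>t. h (t 1) (t 0))"
  proof -
    have "continuous_on (distinct_points a b (Suc (Suc 0)) N) (\<lambda>t. h (fst (t 0, t 1)) (snd (t 0, t 1)))"
      by (rule continuous_on_compose2[OF cont])
        (auto simp: good2 intro!: continuous_on_Pair continuous_on_subset[OF continuous_on_product_coordinates])
    moreover have "continuous_on (distinct_points a b (Suc (Suc 0)) N) (\<lambda>t. h (fst (t 1, t 0)) (snd (t 1, t 0)))"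
      by (rule continuous_on_compose2[OF cont])
        (auto simp: good2 W_def intro!: continuous_on_Pair continuous_on_subset[OF continuous_on_product_coordinates])
    ultimately show "cont_off_diagonal a b (Suc (Suc 0)) N (M * (b - a) ^ n) (\<lambda>t. h (t 0) (t 1))"
      "cont_off_diagonal a b (Suc (Suc 0)) N (M * (b - a) ^ n) (\<lambda>t. h (t 1) (t 0))"
      using bnd[of "(t 0, t (Suc 0))" for t] bnd[of "(t (Suc 0), t 0)" for t] fin M ab
      by (auto simp: cont_off_diagonal_def good2 W_def)
  qed
  have "integral {a..b} (\<lambda>s. integral {a..b} (\<lambda>r. h r s)) = integral {a..b} (\<lambda>s. integral {a..b} (h s))"
  proof (rule cinner_eqI)
    fix u :: 'h
    have bl: "bounded_linear (cinner u)"
      by (rule cinner.bounded_linear_right)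
    have "cinner u (integral {a..b} (\<lambda>s. integral {a..b} (\<lambda>r. h r s))) =
        integral {a..b} (\<lambda>s. integral {a..b} (\<lambda>r. cinner u (h r s)))"
      using iterated_integral_bounded_linear[OF ab bl nice2(2)] by simp
    also have "\<dots> = integral {a..b} (\<lambda>s. integral {a..b} (\<lambda>r. cinner u (h s r)))"
    proof (rule double_integral_swap_complex[OF fin])
      show "continuous_on {p. fst p \<in> {a..b} - N \<and> snd p \<in> {a..b} - N \<and> fst p \<noteq> snd p}
          (\<lambda>p. cinner u (h (fst p) (snd p)))"
        using bounded_linear.continuous_on[OF bl cont] by (simp add: W_def)
      show "cmod (cinner u (h (fst p) (snd p))) \<le> norm u * (M * (b - a) ^ n)"
        if "p \<in> {p. fst p \<in> {a..b} - N \<and> snd p \<in> {a..b} - N \<and> fst p \<noteq> snd p}" for p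
        using order_trans[OF norm_cinner_le mult_left_mono[OF bnd[of p]], of u] that
        by (simp add: W_def)
    qed
    also have "\<dots> = cinner u (integral {a..b} (\<lambda>s. integral {a..b} (h s)))"
      using iterated_integral_bounded_linear[OF ab bl nice2(1)] by simp
    finally show "cinner u (integral {a..b} (\<lambda>s. integral {a..b} (\<lambda>r. h r s))) =
        cinner u (integral {a..b} (\<lambda>s. integral {a..b} (h s)))" .
  qed
  then show ?thesis
    by (simp add: h_def[abs_def])
qed

lemma cont_off_diagonal_permute:
  assumes "\<sigma> permutes {..<n}" "cont_off_diagonal a b n N M g"
  shows "cont_off_diagonal a b n N M (\<lambda>t. g (t \<circ> \<sigma>))"
proof -
  have "t \<circ> \<sigma> \<in> distinct_points a b n N" if "t \<in> distinct_points a b n N" for t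
    using that permutes_image[OF assms(1)] permutes_inj_on[OF assms(1)]
    by (auto simp: distinct_points_def image_comp[symmetric] intro: comp_inj_on)
  moreover have "continuous_on (distinct_points a b n N) (\<lambda>t. t \<circ> \<sigma>)"
    unfolding o_def
    by (rule continuous_on_coordinatewise_then_product)
      (auto intro: continuous_on_subset[OF continuous_on_product_coordinates])
  ultimately show ?thesis
    using assms(2) unfolding cont_off_diagonal_def
    by (auto intro: continuous_on_compose2[of "distinct_points a b n N" g])
qed

text \<open>For the two outermost times this is Fubini's theorem; a deeper pair is exchanged inside
  each slice.\<close>

lemma iterated_integral_permute_adjacent:
  assumes "a \<le> b" "cont_off_diagonal a b n N M g" "Suc i < n"
  shows "iterated_integral a b n (\<lambda>t. g (t \<circ> Transposition.transpose i (Suc i))) = iterated_integral a b n g"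
  using assms(2,3)
proof (induction i arbitrary: n g N)
  case 0
  then obtain m where m: "n = Suc (Suc m)"
    using less_imp_Suc_add[of "Suc 0" n] by auto
  have *: "case_nat s (case_nat r t) \<circ> Transposition.transpose 0 (Suc 0) = case_nat r (case_nat s t)" for s r :: real and t
    by (auto simp: fun_eq_iff Transposition.transpose_def split: nat.splits)
  show ?case
    using iterated_integral_swap[OF assms(1) 0(1)[unfolded m]]
    unfolding m iterated_integral.simps * .
next
  case (Suc i)
  then obtain m where m: "n = Suc m"
    by (cases n) auto
  have *: "case_nat s t \<circ> Transposition.transpose (Suc i) (Suc (Suc i)) =
      case_nat s (t \<circ> Transposition.transpose i (Suc i))" for s :: real and t
    by (auto simp: fun_eq_iff Transposition.transpose_def split: nat.splits)
  have "iterated_integral a b m (\<lambda>t. g (case_nat s (t \<circ> Transposition.transpose i (Suc i)))) =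
      iterated_integral a b m (\<lambda>t. g (case_nat s t))" if "s \<in> {a..b} - N" for s
    using Suc.IH[OF cont_off_diagonal_slice[OF Suc.prems(1)[unfolded m] that]] Suc.prems(2) by (simp add: m)
  moreover have "finite N"
    using Suc.prems by (simp add: cont_off_diagonal_def)
  ultimately show ?case
    unfolding m iterated_integral.simps * by (auto intro!: integral_spike[OF negligible_finite, of N])
qed

lemma iterated_integral_permute_transpose:
  assumes "a \<le> b" "cont_off_diagonal a b n N M g" "i + d < n"
  shows "iterated_integral a b n (\<lambda>t. g (t \<circ> Transposition.transpose i (i + d))) = iterated_integral a b n g"
  using assms(2,3)
proof (induction d arbitrary: g)
  case 0
  then show ?case
    by (simp add: o_def)
next
  case (Suc d)
  let ?\<tau> = "Transposition.transpose (i + d) (Suc (i + d))"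
  let ?\<rho> = "Transposition.transpose i (i + d)"
  have perm: "?\<tau> permutes {..<n}" "?\<rho> permutes {..<n}"
    using Suc.prems by (auto intro!: permutes_swap_id)
  show ?case
  \<comment> \<open>Conjugating the transposition of i and i + d by an adjacent one gives that of i
    and i + d + 1, except for d = 0, where the conjugate is the identity.\<close>
  proof (cases "d = 0")
    case True
    then show ?thesis
      using iterated_integral_permute_adjacent[OF assms(1) Suc.prems(1), of i] Suc.prems(2) by simp
  next
    case False
    have eq: "Transposition.transpose i (i + Suc d) = ?\<tau> \<circ> (?\<rho> \<circ> ?\<tau>)"
      using False by (auto simp: fun_eq_iff Transposition.transpose_def)
    note nice1 = cont_off_diagonal_permute[OF perm(1) Suc.prems(1)]
    note nice2 = cont_off_diagonal_permute[OF perm(2) nice1]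
    have "iterated_integral a b n (\<lambda>t. g (t \<circ> Transposition.transpose i (i + Suc d))) =
        iterated_integral a b n (\<lambda>t. g (t \<circ> ?\<tau> \<circ> ?\<rho> \<circ> ?\<tau>))"
      unfolding eq by (simp add: comp_assoc)
    also have "\<dots> = iterated_integral a b n (\<lambda>t. g (t \<circ> ?\<rho> \<circ> ?\<tau>))"
      using iterated_integral_permute_adjacent[OF assms(1) nice2, of "i + d"] Suc.prems(2)
      by (simp only: add_Suc_right)
    also have "\<dots> = iterated_integral a b n (\<lambda>t. g (t \<circ> ?\<tau>))"
      using Suc.IH[OF nice1] Suc.prems(2) by (simp only: add_Suc_right)
    also have "\<dots> = iterated_integral a b n g"
      using iterated_integral_permute_adjacent[OF assms(1) Suc.prems(1), of "i + d"] Suc.prems(2)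
      by (simp only: add_Suc_right)
    finally show ?thesis .
  qed
qed

lemma iterated_integral_permute:
  assumes "a \<le> b" "cont_off_diagonal a b n N M g" "\<sigma> permutes {..<n}"
  shows "iterated_integral a b n (\<lambda>t. g (t \<circ> \<sigma>)) = iterated_integral a b n g"
  using finite_lessThan assms(3,2)
proof (induction arbitrary: g rule: permutes_rev_induct)
  case id
  then show ?case
    by simp
next
  case (swap i j p)
  let ?\<tau> = "Transposition.transpose i j"
  have \<tau>: "?\<tau> permutes {..<n}"
    using swap by (intro permutes_swap_id)
  have "iterated_integral a b n (\<lambda>t. g (t \<circ> (p \<circ> ?\<tau>))) = iterated_integral a b n (\<lambda>t. g (t \<circ> ?\<tau>))"
    using swap.IH[OF cont_off_diagonal_permute[OF \<tau> swap.prems]] by (simp only: comp_assoc)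
  also have "\<dots> = iterated_integral a b n g"
  proof (cases "i \<le> j")
    case True
    then show ?thesis
      using iterated_integral_permute_transpose[OF assms(1) swap.prems, of i "j - i"] swap.hyps(2)
      by (simp only: le_add_diff_inverse lessThan_iff)
  next
    case False
    then show ?thesis
      using iterated_integral_permute_transpose[OF assms(1) swap.prems, of j "i - j"] swap.hyps(1)
      by (simp only: transpose_commute[of i j] le_add_diff_inverse lessThan_iff linear nat_le_linear)
  qed
  finally show ?case .
qed

section \<open>Primitives of entire functions\<close>

definition primitive :: "complex \<Rightarrow> (complex \<Rightarrow> 'h::chilbert_space) \<Rightarrow> complex \<Rightarrow> 'h"
  where "primitive z0 f w = integral {0..1} (\<lambda>s. (w - z0) *\<^sub>C f (z0 + complex_of_real s * (w - z0)))"

lemma entire_imp_continuous_on: "entire f \<Longrightarrow> continuous_on S f"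
  unfolding entire_def
  by (meson continuous_at_imp_continuous_on has_derivative_continuous)

lemma entire_const [simp]: "entire (\<lambda>\<zeta>. x)"
  unfolding entire_def by (auto intro!: exI[of _ 0])

lemma entire_bounded_linear:
  assumes "bounded_linear L" "\<And>c x. L (c *\<^sub>C x) = c *\<^sub>C L x" "entire f"
  shows "entire (\<lambda>\<zeta>. L (f \<zeta>))"
  unfolding entire_def
proof
  fix \<zeta>
  obtain D where "(f has_derivative (\<lambda>h. h *\<^sub>C D)) (at \<zeta>)"
    using assms(3) by (auto simp: entire_def)
  from bounded_linear.has_derivative[OF assms(1) this]
  have "((\<lambda>\<zeta>. L (f \<zeta>)) has_derivative (\<lambda>h. h *\<^sub>C L D)) (at \<zeta>)"
    by (simp add: assms(2))
  then show "\<exists>D. ((\<lambda>\<zeta>. L (f \<zeta>)) has_derivative (\<lambda>h. h *\<^sub>C D)) (at \<zeta>)"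
    by blast
qed

text \<open>After pairing, Cauchy's theorem on the convex set of all complex numbers supplies a
  scalar primitive.\<close>

lemma entire_cinner_primitive:
  assumes "entire f"
  obtains g where "\<And>\<zeta>. (g has_field_derivative cinner u (f \<zeta>)) (at \<zeta>)"
proof -
  have "\<exists>D. ((\<lambda>\<zeta>. cinner u (f \<zeta>)) has_field_derivative D) (at \<zeta>)" for \<zeta>
  proof -
    obtain D where "(f has_derivative (\<lambda>h. h *\<^sub>C D)) (at \<zeta>)"
      using assms by (auto simp: entire_def)
    then have "((\<lambda>\<zeta>. cinner u (f \<zeta>)) has_derivative (\<lambda>h. cinner u (h *\<^sub>C D))) (at \<zeta>)"
      by (rule bounded_linear.has_derivative[OF cinner.bounded_linear_right])
    then show ?thesis
      by (auto simp: has_field_derivative_def cinner_scaleC_right mult.commute[of _ "cinner u D"] intro!: exI)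
  qed
  then have "(\<lambda>\<zeta>. cinner u (f \<zeta>)) holomorphic_on UNIV"
    by (auto simp: holomorphic_on_def field_differentiable_def)
  then obtain g where "\<And>\<zeta>. \<zeta> \<in> UNIV \<Longrightarrow> (g has_field_derivative cinner u (f \<zeta>)) (at \<zeta> within UNIV)"
    using holomorphic_convex_primitive'[of UNIV "\<lambda>\<zeta>. cinner u (f \<zeta>)"] by auto
  then show thesis
    by (intro that) simp
qed

lemma continuous_on_segment_integrand:
  assumes "entire f"
  shows "continuous_on S (\<lambda>s. (w - z0) *\<^sub>C f (z0 + complex_of_real s * (w - z0)))"
  by (intro bounded_bilinear.continuous_on[OF bounded_bilinear_scaleC] continuous_on_const
      continuous_on_compose2[OF entire_imp_continuous_on[OF assms, of UNIV]] continuous_intros) auto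

lemma integrable_segment:
  "entire f \<Longrightarrow> (\<lambda>s. (w - z0) *\<^sub>C f (z0 + complex_of_real s * (w - z0))) integrable_on {0..1}"
  by (intro integrable_continuous_real continuous_on_segment_integrand)

lemma cinner_primitive:
  assumes f: "entire f" and g: "\<And>\<zeta>. (g has_field_derivative cinner u (f \<zeta>)) (at \<zeta>)"
  shows "cinner u (primitive z0 f w) = g w - g z0"
proof -
  let ?p = "\<lambda>s. z0 + complex_of_real s * (w - z0)"
  have "(?p has_vector_derivative (w - z0)) (at s within {0..1})" for s
    by (auto intro!: derivative_eq_intros simp: scaleR_conv_of_real)
  from field_vector_diff_chain_within[OF this has_field_derivative_at_within[OF g]]
  have "((\<lambda>s. g (?p s)) has_vector_derivative ((w - z0) * cinner u (f (?p s)))) (at s within {0..1})" for s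
    by (simp add: o_def)
  then have "((\<lambda>s. (w - z0) * cinner u (f (?p s))) has_integral g (?p 1) - g (?p 0)) {0..1}"
    by (intro fundamental_theorem_of_calculus[where f="\<lambda>s. g (?p s)"]) simp_all
  moreover have "cinner u (primitive z0 f w) = integral {0..1} (\<lambda>s. cinner u ((w - z0) *\<^sub>C f (?p s)))"
    unfolding primitive_def
    using integral_linear[OF integrable_segment[OF f, of w z0] cinner.bounded_linear_right[of u]]
    by (simp add: o_def)
  ultimately show ?thesis
    by (simp only: cinner_scaleC_right integral_unique) simp
qed

text \<open>Path independence around a triangle, transferred from the scalar primitives because
  vectors are determined by their pairings.\<close>

lemma primitive_diff:
  assumes "entire f"
  shows "primitive z0 f w' - primitive z0 f w = primitive w f w'"
proof (rule cinner_eqI)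
  fix u
  obtain g where g: "\<And>\<zeta>. (g has_field_derivative cinner u (f \<zeta>)) (at \<zeta>)"
    using entire_cinner_primitive[OF assms] by metis
  show "cinner u (primitive z0 f w' - primitive z0 f w) = cinner u (primitive w f w')"
    by (simp add: cinner.diff_right cinner_primitive[OF assms g])
qed

text \<open>By \<open>primitive_diff\<close> the increment is an integral over the short segment
  from w, where \<open>f\<close> stays close to f w.\<close>

lemma primitive_has_derivative:
  assumes f: "entire f"
  shows "(primitive z0 f has_derivative (\<lambda>h. h *\<^sub>C f w)) (at w)"
  unfolding has_derivative_within_alt
proof (intro conjI allI impI)
  show "bounded_linear (\<lambda>h. h *\<^sub>C f w)"
    by (rule scaleC.bounded_linear_left)
  fix e :: real assume e: "0 < e"
  have "isCont f w"
    using entire_imp_continuous_on[OF f, of UNIV] by (simp add: continuous_on_eq_continuous_at)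
  then obtain d where d: "d > 0" "\<And>w'. dist w' w < d \<Longrightarrow> dist (f w') (f w) < e"
    using e unfolding continuous_at_eps_delta by blast
  have "norm (primitive z0 f y - primitive z0 f w - (y - w) *\<^sub>C f w) \<le> e * norm (y - w)"
    if y: "norm (y - w) < d" for y
  proof -
    let ?p = "\<lambda>s. w + complex_of_real s * (y - w)"
    have "primitive z0 f y - primitive z0 f w - (y - w) *\<^sub>C f w =
        integral {0..1} (\<lambda>s. (y - w) *\<^sub>C f (?p s)) - integral {0..1} (\<lambda>s::real. (y - w) *\<^sub>C f w)"
      unfolding primitive_diff[OF f] by (simp add: primitive_def)
    also have "\<dots> = integral {0..1} (\<lambda>s. (y - w) *\<^sub>C f (?p s) - (y - w) *\<^sub>C f w)"
      by (rule Henstock_Kurzweil_Integration.integral_diff[symmetric, OF integrable_segment[OF f]]) auto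
    also have "norm \<dots> \<le> (e * norm (y - w)) * (1 - 0)"
    proof (rule norm_integral_le_off_finite[of 0 1 "{}"])
      fix s :: real assume s: "s \<in> {0..1} - {}"
      then have "norm (complex_of_real s * (y - w)) \<le> norm (y - w)"
        by (simp add: norm_mult mult_left_le_one_le)
      then have "dist (f (?p s)) (f w) < e"
        using y by (intro d) (simp add: dist_norm)
      then have "norm (y - w) * norm (f (?p s) - f w) \<le> norm (y - w) * e"
        by (intro mult_left_mono) (auto simp: dist_norm)
      then show "norm ((y - w) *\<^sub>C f (?p s) - (y - w) *\<^sub>C f w) \<le> e * norm (y - w)"
        by (simp add: scaleC.diff_right[symmetric] norm_scaleC mult.commute)
    qed (use e in auto)
    finally show ?thesis
      by simp
  qed
  with d(1) show "\<exists>d>0. \<forall>y\<in>UNIV. norm (y - w) < d \<longrightarrow>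
      norm (primitive z0 f y - primitive z0 f w - (y - w) *\<^sub>C f w) \<le> e * norm (y - w)"
    by blast
qed

lemma entire_primitive: "entire f \<Longrightarrow> entire (primitive z0 f)"
  unfolding entire_def using primitive_has_derivative[unfolded entire_def] by blast

lemma primitive_base [simp]: "primitive z0 f z0 = 0"
  by (simp add: primitive_def)

lemma has_vector_derivative_along_curve:
  assumes "(P has_derivative (\<lambda>h. h *\<^sub>C y)) (at (\<Gamma> t))" "(\<Gamma> has_vector_derivative v) (at t)"
  shows "((\<lambda>t. P (\<Gamma> t)) has_vector_derivative (v *\<^sub>C y)) (at t)"
  using has_derivative_compose[OF assms(2)[unfolded has_vector_derivative_def] assms(1)]
  by (simp add: has_vector_derivative_def scaleC.scaleR_left)

section \<open>Operators raising the energy by a bounded amount\<close>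

interpretation pair: module "\<lambda>c (x, y). (c *\<^sub>C x, c *\<^sub>C y) :: 'a::chilbert_space \<times> 'a"
  by standard (auto simp: scaleC_add_right scaleC_add_left scaleC_scaleC)

lemma linear_operator_iff: "linear_operator T \<longleftrightarrow> single_valued T \<and> (0, 0) \<in> T \<and>
    (\<forall>x y x' y'. (x, y) \<in> T \<longrightarrow> (x', y') \<in> T \<longrightarrow> (x + x', y + y') \<in> T) \<and>
    (\<forall>c x y. (x, y) \<in> T \<longrightarrow> (c *\<^sub>C x, c *\<^sub>C y) \<in> T)"
  unfolding linear_operator_def pair.subspace_def
  by (auto simp: zero_prod_def Ball_def split_paired_All)

lemma op_apply_eq: "single_valued T \<Longrightarrow> (x, y) \<in> T \<Longrightarrow> op_apply T x = y"
  unfolding op_apply_def by (auto dest: single_valuedD)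

text \<open>What the Dyson series needs of one operator. The square root of H0 is bounded by sqrt e
  on V_e, so relative boundedness takes the form \<open>T_bound\<close>.\<close>

locale energy_raising = pvm_nonneg E for E :: "real set \<Rightarrow> 'h::chilbert_space \<Rightarrow> 'h" +
  fixes T :: "'h operator" and b \<alpha> \<beta> :: real
  assumes linear_T: "linear_operator T"
    and nonneg: "0 \<le> b" "0 \<le> \<alpha>" "0 \<le> \<beta>"
    and T_dom: "0 \<le> e \<Longrightarrow> spec_subspace E e \<subseteq> Domain T"
    and T_range: "0 \<le> e \<Longrightarrow> T `` spec_subspace E e \<subseteq> spec_subspace E (e + b)"
    and T_bound: "0 \<le> e \<Longrightarrow> x \<in> spec_subspace E e \<Longrightarrow> (x, y) \<in> T \<Longrightarrow> norm y \<le> (\<alpha> * sqrt e + \<beta>) * norm x"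
begin

lemma single_valued_T: "single_valued T"
  using linear_T by (simp add: linear_operator_iff)

text \<open>Projecting first makes the restriction of \<open>T\<close> to V_e an everywhere defined
  bounded operator.\<close>

definition L :: "real \<Rightarrow> 'h \<Rightarrow> 'h"
  where "L e x = op_apply T (E {0..e} x)"

lemma E_in: "E {0..e} x \<in> spec_subspace E e"
  by (simp add: spec_subspace_iff E_idem)

lemma L_in_T: "0 \<le> e \<Longrightarrow> (E {0..e} x, L e x) \<in> T"
  using T_dom[of e] E_in[of e x] op_apply_eq[OF single_valued_T] unfolding L_def by blast

lemma L_graph: "0 \<le> e \<Longrightarrow> x \<in> spec_subspace E e \<Longrightarrow> (x, L e x) \<in> T"
  using L_in_T[of e x] by (simp add: spec_subspace_iff)

lemma L_add:
  assumes e: "0 \<le> e"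
  shows "L e (x + y) = L e x + L e y"
proof -
  have "(E {0..e} x + E {0..e} y, L e x + L e y) \<in> T"
    using linear_T L_in_T[OF e] unfolding linear_operator_iff by blast
  then have "(E {0..e} (x + y), L e x + L e y) \<in> T"
    by (simp add: E_add)
  then show ?thesis
    by (rule single_valuedD[OF single_valued_T L_in_T[OF e]])
qed

lemma L_scaleC:
  assumes e: "0 \<le> e"
  shows "L e (c *\<^sub>C x) = c *\<^sub>C L e x"
proof -
  have "(c *\<^sub>C E {0..e} x, c *\<^sub>C L e x) \<in> T"
    using linear_T L_in_T[OF e] unfolding linear_operator_iff by blast
  then have "(E {0..e} (c *\<^sub>C x), c *\<^sub>C L e x) \<in> T"
    by (simp add: E_scaleC)
  then show ?thesis
    by (rule single_valuedD[OF single_valued_T L_in_T[OF e]])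
qed

lemma L_in: "0 \<le> e \<Longrightarrow> L e x \<in> spec_subspace E (e + b)"
  using T_range[of e] L_in_T[of e x] E_in[of e x] by blast

lemma norm_L_le: "0 \<le> e \<Longrightarrow> norm (L e x) \<le> (\<alpha> * sqrt e + \<beta>) * norm x"
proof -
  assume e: "0 \<le> e"
  have "norm (L e x) \<le> (\<alpha> * sqrt e + \<beta>) * norm (E {0..e} x)"
    by (rule T_bound[OF e E_in L_in_T[OF e]])
  also have "\<dots> \<le> (\<alpha> * sqrt e + \<beta>) * norm x"
    using nonneg e by (intro mult_left_mono norm_E_le) auto
  finally show ?thesis .
qed

lemma bounded_linear_L: "0 \<le> e \<Longrightarrow> bounded_linear (L e)"
  by (rule bounded_linear_intro[of _ "\<alpha> * sqrt e + \<beta>"])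
    (auto simp: L_add L_scaleC scaleR_scaleC norm_L_le mult.commute[of "norm x" for x])

text \<open>\<open>F e \<zeta>\<close> is \<open>-\<i> T(\<zeta>)\<close> on \<open>spec_subspace E e\<close>.\<close>

definition F :: "real \<Rightarrow> complex \<Rightarrow> 'h \<Rightarrow> 'h"
  where "F e \<zeta> x = (- \<i>) *\<^sub>C G (e + b) \<zeta> (L e (G e (- \<zeta>) x))"

lemma F_in: "F e \<zeta> x \<in> spec_subspace E (e + b)"
  unfolding F_def by (intro spec_subspace_scaleC G_in)

lemma bounded_linear_F: "0 \<le> e \<Longrightarrow> bounded_linear (F e \<zeta>)"
  unfolding F_def
  by (intro bounded_linear_compose[OF scaleC.bounded_linear_right]
      bounded_linear_compose[OF blinfun.bounded_linear_right]
      bounded_linear_compose[OF bounded_linear_L] blinfun.bounded_linear_right)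

lemma entire_F: "0 \<le> e \<Longrightarrow> entire y \<Longrightarrow> entire (\<lambda>\<zeta>. F e \<zeta> (y \<zeta>))"
  unfolding F_def using nonneg
  by (intro entire_bounded_linear[OF scaleC.bounded_linear_right] entire_G(1)
      entire_bounded_linear[OF bounded_linear_L] entire_G(2))
    (auto simp: L_scaleC scaleC_scaleC mult.commute)

lemma F_tendsto:
  assumes e: "0 \<le> e" and lim: "(Z \<longlongrightarrow> \<zeta>) net" "(Y \<longlongrightarrow> y) net"
  shows "((\<lambda>k. F e (Z k) (Y k)) \<longlongrightarrow> F e \<zeta> y) net"
proof -
  have G: "isCont (G e') \<eta>" if "0 \<le> e'" for e' \<eta>
    using G_has_derivative[OF that] by (rule has_derivative_continuous)
  have "((\<lambda>k. G e (- Z k)) \<longlongrightarrow> G e (- \<zeta>)) net" "((\<lambda>k. G (e + b) (Z k)) \<longlongrightarrow> G (e + b) \<zeta>) net"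
    using e nonneg by (auto intro!: isCont_tendsto_compose[OF G] lim tendsto_intros)
  then show ?thesis
    unfolding F_def
    by (intro scaleC.tendsto tendsto_const bounded_bilinear.tendsto[OF bounded_bilinear_blinfun_apply]
        bounded_linear.tendsto[OF bounded_linear_L[OF e]] lim)
qed

lemma spectral_integral_exp:
  assumes "x \<in> spec_subspace E e"
  shows "(x, G e \<zeta> x) \<in> spectral_integral E (\<lambda>l. exp (\<i> * \<zeta> * complex_of_real l))"
  unfolding G_def using assms bounded_borel_exp
  by (intro spectral_integral_range) (auto simp: spec_subspace_iff)

lemma F_graph:
  assumes e: "0 \<le> e" and x: "x \<in> spec_subspace E e"
  shows "(x, F e \<zeta> x) \<in> op_scale (- \<i>) (evolved E T \<zeta>)"
proof -
  have "(x, G e (- \<zeta>) x) \<in> spectral_integral E (\<lambda>l. exp (- \<i> * \<zeta> * complex_of_real l))"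
    using spectral_integral_exp[OF x, of "- \<zeta>"] by simp
  moreover have "(G e (- \<zeta>) x, L e (G e (- \<zeta>) x)) \<in> T"
    by (rule L_graph[OF e G_in])
  moreover have "(L e (G e (- \<zeta>) x), G (e + b) \<zeta> (L e (G e (- \<zeta>) x))) \<in>
      spectral_integral E (\<lambda>l. exp (\<i> * \<zeta> * complex_of_real l))"
    by (rule spectral_integral_exp[OF L_in[OF e]])
  ultimately have "(x, G (e + b) \<zeta> (L e (G e (- \<zeta>) x))) \<in>
      spectral_integral E (\<lambda>l. exp (\<i> * \<zeta> * complex_of_real l)) \<circ>\<^sub>o T \<circ>\<^sub>o
      spectral_integral E (\<lambda>l. exp (- \<i> * \<zeta> * complex_of_real l))"
    by blast
  then have "(x, G (e + b) \<zeta> (L e (G e (- \<zeta>) x))) \<in> evolved E T \<zeta>"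
    unfolding evolved_def by (rule subsetD[OF closure_subset])
  then show ?thesis
    unfolding op_scale_def F_def by blast
qed

section \<open>The Dyson terms and their majorants\<close>

primrec Phi :: "real \<Rightarrow> 'h \<Rightarrow> complex \<Rightarrow> nat \<Rightarrow> complex \<Rightarrow> 'h"
  where "Phi e x z0 0 = (\<lambda>w. x)"
  | "Phi e x z0 (Suc n) = primitive z0 (\<lambda>\<zeta>. F (e + real n * b) \<zeta> (Phi e x z0 n \<zeta>))"

lemma level_nonneg: "0 \<le> e \<Longrightarrow> 0 \<le> e + real n * b"
  using nonneg by simp

lemma entire_Phi: "0 \<le> e \<Longrightarrow> entire (Phi e x z0 n)"
  by (induction n) (auto intro: entire_primitive entire_F level_nonneg)

lemma Phi_has_derivative:
  "0 \<le> e \<Longrightarrow> (Phi e x z0 (Suc n) has_derivative (\<lambda>h. h *\<^sub>C F (e + real n * b) w (Phi e x z0 n w))) (at w)"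
  using primitive_has_derivative[OF entire_F[OF level_nonneg entire_Phi]] by simp

lemma primitive_in:
  assumes f: "entire f" "\<And>\<zeta>. f \<zeta> \<in> spec_subspace E e"
  shows "primitive z0 f w \<in> spec_subspace E e"
proof -
  have "E {0..e} (primitive z0 f w) =
      integral {0..1} (\<lambda>s. E {0..e} ((w - z0) *\<^sub>C f (z0 + complex_of_real s * (w - z0))))"
    unfolding primitive_def
    using integral_linear[OF integrable_segment[OF f(1)] bounded_linear_E[of "{0..e}"], of w z0]
    by (simp add: o_def)
  also have "\<dots> = primitive z0 f w"
    using f(2) by (simp add: primitive_def E_scaleC spec_subspace_iff)
  finally show ?thesis
    by (simp add: spec_subspace_iff)
qed

lemma Phi_in:
  assumes "0 \<le> e" "x \<in> spec_subspace E e"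
  shows "Phi e x z0 n w \<in> spec_subspace E (e + real n * b)"
proof (cases n)
  case (Suc m)
  have "F (e + real m * b) \<zeta> y \<in> spec_subspace E (e + real (Suc m) * b)" for \<zeta> y
    using F_in[of "e + real m * b" \<zeta> y] by (simp add: algebra_simps)
  then show ?thesis
    unfolding Suc Phi.simps
    by (intro primitive_in entire_F entire_Phi level_nonneg assms)
qed (use assms in simp)

text \<open>The free evolution is split off because \<open>G (-w) T(\<zeta>) = G (\<zeta> - w) T G (-\<zeta>)\<close> costs only
  \<open>exp (\<bar>w - \<zeta>\<bar> e)\<close>; bounding each \<open>T(\<zeta>)\<close> separately would produce a factor exponential in \<open>n\<^sup>2\<close>.\<close>

lemma norm_Phi_le_aux:
  assumes e: "0 \<le> e" and x: "x \<in> spec_subspace E e"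
  shows "norm (G (e + real n * b) (- w) (Phi e x z0 n w)) \<le>
    exp (cmod z0 * e) * norm x * exp (cmod (w - z0) * (e + real n * b)) *
    (\<Prod>j<n. \<alpha> * sqrt (e + real j * b) + \<beta>) * (cmod (w - z0) ^ n / fact n)"
proof (induction n arbitrary: w)
  case 0
  have "cmod w * e \<le> (cmod z0 + cmod (w - z0)) * e"
    using e norm_triangle_sub[of w z0] by (intro mult_right_mono) auto
  then have "exp (cmod w * e) \<le> exp (cmod z0 * e) * exp (cmod (w - z0) * e)"
    by (simp add: exp_add[symmetric] distrib_right)
  then have "exp (cmod w * e) * norm x \<le> (exp (cmod z0 * e) * exp (cmod (w - z0) * e)) * norm x"
    by (rule mult_right_mono) simp
  with norm_G_le[of e "- w" x] show ?case
    by (simp add: mult_ac)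
next
  case (Suc n)
  let ?e = "e + real n * b" and ?e' = "e + real (Suc n) * b"
  let ?\<Delta> = "w - z0"
  let ?p = "\<lambda>s. z0 + complex_of_real s * ?\<Delta>"
  let ?c = "\<alpha> * sqrt ?e + \<beta>"
  define K where "K = exp (cmod z0 * e) * norm x * (\<Prod>j<n. \<alpha> * sqrt (e + real j * b) + \<beta>)"
  have ee: "?e + b = ?e'" "0 \<le> ?e" "0 \<le> ?e'" "?e \<le> ?e'"
    using e nonneg by (auto simp: algebra_simps)
  have c: "0 \<le> \<alpha> * sqrt (e + real j * b) + \<beta>" for j
    using e nonneg by simp
  have K: "0 \<le> K"
    unfolding K_def using c by (intro mult_nonneg_nonneg prod_nonneg) auto
  let ?f = "\<lambda>\<zeta>. F ?e \<zeta> (Phi e x z0 n \<zeta>)"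
  have f: "entire ?f"
    by (intro entire_F entire_Phi ee e)
  have eq: "G ?e' (- w) (Phi e x z0 (Suc n) w) = integral {0..1} (\<lambda>s. G ?e' (- w) (?\<Delta> *\<^sub>C ?f (?p s)))"
    using integral_linear[OF integrable_segment[OF f] blinfun.bounded_linear_right[of "G ?e' (- w)"], of w z0]
    by (simp add: primitive_def o_def)
  let ?C = "K * ?c * exp (cmod ?\<Delta> * ?e') * cmod ?\<Delta> ^ Suc n / fact n"
  have le: "norm (G ?e' (- w) (?\<Delta> *\<^sub>C ?f (?p s))) \<le> ?C * s ^ n" if s: "s \<in> {0..1}" for s
  proof -
    let ?\<zeta> = "?p s"
    have 1: "G ?e' (- w) (?\<Delta> *\<^sub>C ?f ?\<zeta>) =
        (- \<i> * ?\<Delta>) *\<^sub>C G ?e' (?\<zeta> - w) (L ?e (G ?e (- ?\<zeta>) (Phi e x z0 n ?\<zeta>)))"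
      unfolding F_def ee G_scaleC by (simp add: G_group scaleC_scaleC mult.commute)
    have d1: "cmod (?\<zeta> - w) = (1 - s) * cmod ?\<Delta>"
    proof -
      have "?\<zeta> - w = complex_of_real (s - 1) * ?\<Delta>"
        by (simp add: algebra_simps)
      then show ?thesis
        using s by (simp only: norm_mult norm_of_real) simp
    qed
    have d2: "cmod (?\<zeta> - z0) = s * cmod ?\<Delta>"
      using s by (simp add: norm_mult)
    have "norm (G ?e' (- w) (?\<Delta> *\<^sub>C ?f ?\<zeta>)) =
        cmod ?\<Delta> * norm (G ?e' (?\<zeta> - w) (L ?e (G ?e (- ?\<zeta>) (Phi e x z0 n ?\<zeta>))))"
      unfolding 1 by (simp add: norm_scaleC norm_mult)
    also have "\<dots> \<le> cmod ?\<Delta> * (exp (cmod (?\<zeta> - w) * ?e') *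
        (?c * norm (G ?e (- ?\<zeta>) (Phi e x z0 n ?\<zeta>))))"
      using norm_L_le[OF ee(2)] by (intro mult_left_mono order_trans[OF norm_G_le] mult_left_mono) auto
    also have "\<dots> \<le> cmod ?\<Delta> * (exp (cmod (?\<zeta> - w) * ?e') *
        (?c * (K * exp (cmod (?\<zeta> - z0) * ?e) * (cmod (?\<zeta> - z0) ^ n / fact n))))"
      using Suc.IH[of ?\<zeta>] c by (intro mult_left_mono) (auto simp: K_def mult_ac)
    also have "\<dots> = K * ?c * (exp ((1 - s) * cmod ?\<Delta> * ?e') * exp (s * cmod ?\<Delta> * ?e)) *
        cmod ?\<Delta> ^ Suc n / fact n * s ^ n"
      unfolding d1 d2 by (simp add: power_mult_distrib mult_ac)
    \<comment> \<open>The two free evolutions cover the fractions 1 - s and s of the segment;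
      raising the lower energy level to \<open>?e'\<close> merges them into one exponential.\<close>
    also have "\<dots> \<le> K * ?c * exp (cmod ?\<Delta> * ?e') * cmod ?\<Delta> ^ Suc n / fact n * s ^ n"
    proof -
      have "s * cmod ?\<Delta> * ?e \<le> s * cmod ?\<Delta> * ?e'"
        using s ee by (intro mult_left_mono) auto
      then have "exp ((1 - s) * cmod ?\<Delta> * ?e') * exp (s * cmod ?\<Delta> * ?e) \<le> exp (cmod ?\<Delta> * ?e')"
        unfolding exp_add[symmetric] by (simp add: algebra_simps)
      then show ?thesis
        using K c s by (intro mult_right_mono divide_right_mono mult_left_mono) auto
    qed
    finally show ?thesis .
  qed
  \<comment> \<open>The integral of s^n contributes 1/(n+1) and thereby advances the
    factorial.\<close>
  have int: "((\<lambda>s. ?C * s ^ n) has_integral ?C * (1 / (real n + 1))) {0..1::real}"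
  proof (rule has_integral_mult_right)
    have "((\<lambda>s::real. s ^ n) has_integral 1 ^ Suc n / real (Suc n) - 0 ^ Suc n / real (Suc n)) {0..1}"
      by (rule fundamental_theorem_of_calculus)
        (auto intro!: derivative_eq_intros simp: has_real_derivative_iff_has_vector_derivative[symmetric] simp del: power_Suc)
    then show "((\<lambda>s::real. s ^ n) has_integral 1 / (real n + 1)) {0..1}"
      by (simp add: add.commute)
  qed
  have "norm (G ?e' (- w) (Phi e x z0 (Suc n) w)) \<le> integral {0..1} (\<lambda>s. ?C * s ^ n)"
    unfolding eq
  proof (rule integral_norm_bound_integral)
    show "(\<lambda>s. G ?e' (- w) (?\<Delta> *\<^sub>C ?f (?p s))) integrable_on {0..1}"
      using integrable_linear[OF integrable_segment[OF f] blinfun.bounded_linear_right[of "G ?e' (- w)"], of w z0]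
      by (simp add: o_def)
  qed (use int le in auto)
  also have "\<dots> = ?C * (1 / (real n + 1))"
    using int by (rule integral_unique)
  also have "\<dots> = exp (cmod z0 * e) * norm x * exp (cmod ?\<Delta> * ?e') *
    (\<Prod>j<Suc n. \<alpha> * sqrt (e + real j * b) + \<beta>) * (cmod ?\<Delta> ^ Suc n / fact (Suc n))"
    by (simp add: K_def mult_ac add.commute)
  finally show ?case .
qed

text \<open>The split-off evolution is undone once, at the end, at a cost exponential in
  \<open>n\<close>.\<close>

lemma norm_Phi_le:
  assumes e: "0 \<le> e" and x: "x \<in> spec_subspace E e"
  shows "norm (Phi e x z0 n w) \<le> exp (cmod w * (e + real n * b)) *
    (exp (cmod z0 * e) * norm x * exp (cmod (w - z0) * (e + real n * b)) *
    (\<Prod>j<n. \<alpha> * sqrt (e + real j * b) + \<beta>) * (cmod (w - z0) ^ n / fact n))"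
proof -
  have "Phi e x z0 n w = G (e + real n * b) w (G (e + real n * b) (- w) (Phi e x z0 n w))"
    using G_inverse[OF Phi_in[OF e x]] by simp
  then have "norm (Phi e x z0 n w) \<le>
      exp (cmod w * (e + real n * b)) * norm (G (e + real n * b) (- w) (Phi e x z0 n w))"
    using norm_G_le by metis
  also have "\<dots> \<le> exp (cmod w * (e + real n * b)) *
    (exp (cmod z0 * e) * norm x * exp (cmod (w - z0) * (e + real n * b)) *
    (\<Prod>j<n. \<alpha> * sqrt (e + real j * b) + \<beta>) * (cmod (w - z0) ^ n / fact n))"
    by (intro mult_left_mono norm_Phi_le_aux e x) simp
  finally show ?thesis .
qed

text \<open>Ratio test for the majorant: the exponentials contribute a constant \<open>q\<close> per
  step, and a new factor of order sqrt n meets a factor n + 1 from the factorial.\<close>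

lemma summable_norm_Phi:
  assumes e: "0 \<le> e" and x: "x \<in> spec_subspace E e"
  shows "summable (\<lambda>n. norm (Phi e x z0 n w))"
proof -
  let ?r = "cmod w + cmod (w - z0)"
  define q where "q = exp (?r * b)"
  define a where "a n = exp (cmod z0 * e) * norm x * exp (?r * e) *
    (q ^ n * (\<Prod>j<n. \<alpha> * sqrt (e + real j * b) + \<beta>) * cmod (w - z0) ^ n / fact n)" for n
  have a_le: "norm (Phi e x z0 n w) \<le> a n" for n
  proof -
    let ?P = "exp (cmod z0 * e) * norm x"
      and ?Q = "(\<Prod>j<n. \<alpha> * sqrt (e + real j * b) + \<beta>) * (cmod (w - z0) ^ n / fact n)"
    have "norm (Phi e x z0 n w) \<le> exp (cmod w * (e + real n * b)) *
        (?P * exp (cmod (w - z0) * (e + real n * b)) * ?Q)"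
      using norm_Phi_le[OF e x, of z0 n w] by (simp only: mult.assoc)
    also have "\<dots> = (exp (cmod w * (e + real n * b)) * exp (cmod (w - z0) * (e + real n * b))) * (?P * ?Q)"
      by (simp only: mult_ac)
    also have "exp (cmod w * (e + real n * b)) * exp (cmod (w - z0) * (e + real n * b)) = exp (?r * e) * q ^ n"
      unfolding q_def exp_of_nat_mult[symmetric] exp_add[symmetric] by (simp add: algebra_simps)
    also have "exp (?r * e) * q ^ n * (?P * ?Q) = a n"
      by (simp add: a_def mult_ac)
    finally show ?thesis .
  qed
  have c: "0 \<le> \<alpha> * sqrt (e + real j * b) + \<beta>" for j
    using e nonneg by simp
  have a_nonneg: "0 \<le> a n" for n
    by (rule order_trans[OF norm_ge_zero a_le])
  define \<rho> where "\<rho> n = q * cmod (w - z0) * ((\<alpha> * sqrt (e + real n * b) + \<beta>) / (real n + 1))" for n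
  have step: "a (Suc n) = \<rho> n * a n" for n
    by (simp add: a_def \<rho>_def field_simps)
  have "\<rho> \<longlonglongrightarrow> 0"
  proof -
    have "(\<lambda>n. q * cmod (w - z0) * ((\<alpha> * sqrt (e + real n * b) + \<beta>) / (real n + 1))) \<longlonglongrightarrow>
        q * cmod (w - z0) * 0"
    proof (intro tendsto_intros)
      have lim: "(\<lambda>n. \<alpha> * (sqrt (e + b) * (1 / sqrt (real n + 1))) + \<beta> * (1 / (real n + 1))) \<longlonglongrightarrow>
          \<alpha> * (sqrt (e + b) * 0) + \<beta> * 0"
        by (intro tendsto_intros; real_asymp)
      show "(\<lambda>n. (\<alpha> * sqrt (e + real n * b) + \<beta>) / (real n + 1)) \<longlonglongrightarrow> 0"
      proof (rule tendsto_sandwich[OF _ _ tendsto_const, of _ _ _ "\<lambda>n. \<alpha> * (sqrt (e + b) * (1 / sqrt (real n + 1))) + \<beta> * (1 / (real n + 1))"])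
        show "\<forall>\<^sub>F n in sequentially. 0 \<le> (\<alpha> * sqrt (e + real n * b) + \<beta>) / (real n + 1)"
          using c by (intro always_eventually allI divide_nonneg_nonneg) auto
        show "\<forall>\<^sub>F n in sequentially. (\<alpha> * sqrt (e + real n * b) + \<beta>) / (real n + 1) \<le>
            \<alpha> * (sqrt (e + b) * (1 / sqrt (real n + 1))) + \<beta> * (1 / (real n + 1))"
        proof (intro always_eventually allI)
          fix n
          \<comment> \<open>Separating the \<open>n\<close>-dependence as a power of n + 1 bounds
            the ratio by an explicit null sequence.\<close>
          have "e + real n * b \<le> (e + b) * (real n + 1)"
            using e nonneg by (simp add: algebra_simps)
          then have "sqrt (e + real n * b) \<le> sqrt (e + b) * sqrt (real n + 1)"
            by (simp add: real_sqrt_mult[symmetric])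
          then have "sqrt (e + real n * b) / (real n + 1) \<le> sqrt (e + b) * sqrt (real n + 1) / (real n + 1)"
            by (rule divide_right_mono) simp
          also have "\<dots> = sqrt (e + b) * (1 / sqrt (real n + 1))"
            by (simp add: real_div_sqrt field_simps)
          finally have "\<alpha> * (sqrt (e + real n * b) / (real n + 1)) \<le> \<alpha> * (sqrt (e + b) * (1 / sqrt (real n + 1)))"
            using nonneg by (intro mult_left_mono)
          then show "(\<alpha> * sqrt (e + real n * b) + \<beta>) / (real n + 1) \<le>
            \<alpha> * (sqrt (e + b) * (1 / sqrt (real n + 1))) + \<beta> * (1 / (real n + 1))"
            by (simp add: add_divide_distrib)
        qed
      qed (use lim in simp)
    qed
    then show ?thesis
      unfolding \<rho>_def by simp
  qed
  then have "\<forall>\<^sub>F n in sequentially. \<rho> n < 1 / 2"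
    by (rule order_tendstoD) simp
  then obtain N where N: "\<And>n. N \<le> n \<Longrightarrow> \<rho> n < 1 / 2"
    by (auto simp: eventually_sequentially)
  have "summable a"
  proof (rule summable_ratio_test[of "1 / 2" N])
    fix n assume "N \<le> n"
    then show "norm (a (Suc n)) \<le> 1 / 2 * norm (a n)"
      using a_nonneg[of n] a_nonneg[of "Suc n"] mult_right_mono[OF less_imp_le[OF N] a_nonneg, of n n]
      by (simp only: step real_norm_def abs_of_nonneg)
  qed simp
  then show ?thesis
    by (rule summable_comparison_test') (use a_le in simp)
qed

end

section \<open>Duality between an operator and a formal adjoint\<close>

locale dual_pair = A: energy_raising E A b \<alpha> \<beta> + B: energy_raising E B b \<alpha> \<beta>
  for E :: "real set \<Rightarrow> 'h::chilbert_space \<Rightarrow> 'h" and A B :: "'h operator" and b \<alpha> \<beta> :: real +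
  assumes dual: "(x, y) \<in> A \<Longrightarrow> (u, v) \<in> B \<Longrightarrow> cinner u y = cinner v x"
begin

text \<open>Formal duality is symmetric and both operators share the constants, so every result is
  also available with the roles exchanged.\<close>

lemma swapped: "dual_pair E B A b \<alpha> \<beta>"
proof
  fix x y u v assume "(x, y) \<in> B" "(u, v) \<in> A"
  then have "cinner x v = cinner y u"
    by (rule dual[rotated])
  then show "cinner u y = cinner v x"
    by (metis cinner_commute)
qed

text \<open>The three factors of the evolved operator are moved onto \<open>w\<close> one after
  another, the middle one by duality and the outer ones by cut-off at the levels e and e + b. The
  resulting identity is a closed condition on the pair, so it survives the closure in
  \<open>evolved\<close> and holds on the whole graph.\<close>

lemma cinner_evolved:
  assumes "(x, y) \<in> op_scale (- \<i>) (evolved E A \<zeta>)" and e: "0 \<le> e" and w: "w \<in> spec_subspace E e"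
  shows "cinner w y = - cinner (B.F e (cnj \<zeta>) w) x"
proof -
  obtain y' where y': "y = (- \<i>) *\<^sub>C y'" and "(x, y') \<in> evolved E A \<zeta>"
    using assms(1) by (auto simp: op_scale_def)
  define w1 where "w1 = A.G e (- cnj \<zeta>) w"
  define w2 where "w2 = B.L e w1"
  define w3 where "w3 = A.G (e + b) (cnj \<zeta>) w2"
  have w1: "w1 \<in> spec_subspace E e"
    unfolding w1_def by (rule A.G_in)
  have w2: "w2 \<in> spec_subspace E (e + b)"
    unfolding w2_def by (rule B.L_in[OF e])
  let ?S = "{(x, y). cinner w y = cinner w3 x}"
  have "evolved E A \<zeta> \<subseteq> ?S"
    unfolding evolved_def
  proof (rule closure_minimal)
    show "closed ?S"
      by (auto simp: case_prod_beta' intro!: closed_Collect_eq continuous_intros cinner.continuous_on)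
    show "spectral_integral E (\<lambda>l. exp (\<i> * \<zeta> * complex_of_real l)) \<circ>\<^sub>o A \<circ>\<^sub>o
        spectral_integral E (\<lambda>l. exp (- \<i> * \<zeta> * complex_of_real l)) \<subseteq> ?S"
    proof clarify
      fix x p q y
      assume xp: "(x, p) \<in> spectral_integral E (\<lambda>l. exp (- \<i> * \<zeta> * complex_of_real l))"
        and pq: "(p, q) \<in> A" and qy: "(q, y) \<in> spectral_integral E (\<lambda>l. exp (\<i> * \<zeta> * complex_of_real l))"
      have "cinner w y = cinner w (A.G e \<zeta> q)"
        unfolding A.G_def
        using A.cinner_spectral_integral[OF qy _ A.bounded_borel_exp] w by (simp add: A.spec_subspace_iff)
      also have "\<dots> = cinner w1 q"
        unfolding w1_def using A.G_adjoint[of e "- cnj \<zeta>" w q] by simp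
      also have "\<dots> = cinner w2 p"
        unfolding w2_def by (rule dual[OF pq B.L_graph[OF e w1]])
      also have "\<dots> = cinner w2 (A.G (e + b) (- \<zeta>) x)"
        unfolding A.G_def
        using A.cinner_spectral_integral[OF xp _ _ _ , of "{0..e + b}" w2] w2 A.bounded_borel_exp[of "e + b" "- \<zeta>"]
        by (simp add: A.spec_subspace_iff)
      also have "\<dots> = cinner w3 x"
        unfolding w3_def using A.G_adjoint[of "e + b" "cnj \<zeta>" w2 x] by simp
      finally show "cinner w y = cinner w3 x" .
    qed
  qed
  then have "cinner w y' = cinner w3 x"
    using \<open>(x, y') \<in> evolved E A \<zeta>\<close> by auto
  then show ?thesis
    by (simp add: y' B.F_def w3_def w2_def w1_def cinner_scaleC_right cinner_scaleC_left
        cinner.minus_left cinner.minus_right)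
qed

lemma cinner_F:
  assumes "0 \<le> e" "x \<in> spec_subspace E e" "0 \<le> e'" "w \<in> spec_subspace E e'"
  shows "cinner w (A.F e \<zeta> x) = - cinner (B.F e' (cnj \<zeta>) w) x"
  using cinner_evolved[OF A.F_graph[OF assms(1,2)] assms(3,4)] .

text \<open>This is closability of the conjugated operator: by \<open>cinner_evolved\<close> the
  pairings of a value with vectors of finite energy depend on \<open>x\<close> alone.\<close>

lemma single_valued_evolved: "single_valued (op_scale (- \<i>) (evolved E A \<zeta>))"
proof (rule single_valuedI)
  fix x y y' assume xy: "(x, y) \<in> op_scale (- \<i>) (evolved E A \<zeta>)" "(x, y') \<in> op_scale (- \<i>) (evolved E A \<zeta>)"
  have "y - y' = 0"
  proof (rule A.D_fin_separates)
    fix v assume "v \<in> D_fin E"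
    then obtain e where "0 \<le> e" "v \<in> spec_subspace E e"
      by (auto simp: D_fin_def)
    then show "cinner v (y - y') = 0"
      using cinner_evolved xy by (simp add: cinner.diff_right)
  qed
  then show "y = y'"
    by simp
qed

text \<open>The function \<open>\<zeta> \<mapsto> \<Sum>k\<le>n. \<langle>\<Psi>\<^bsub>n-k\<^esub>(\<zeta>\<^sup>*), \<Phi>\<^bsub>k\<^esub>(\<zeta>)\<rangle>\<close> has derivative 0, and its values
  at the end points are the two sides.\<close>

lemma cinner_Phi:
  assumes e: "0 \<le> e" and x: "x \<in> spec_subspace E e" and e': "0 \<le> e'" and v: "v \<in> spec_subspace E e'"
  shows "cinner v (A.Phi e x z' n z) = cinner (B.Phi e' v (cnj z) n (cnj z')) x"
proof -
  let ?\<Phi> = "\<lambda>k. A.Phi e x z' k" and ?\<Psi> = "\<lambda>k \<zeta>. B.Phi e' v (cnj z) k (cnj \<zeta>)"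
  define f where "f k \<zeta> = (if k = 0 then 0 else A.F (e + real (k - 1) * b) \<zeta> (?\<Phi> (k - 1) \<zeta>))" for k \<zeta>
  define g where "g k \<zeta> = (if k = 0 then 0 else B.F (e' + real (k - 1) * b) (cnj \<zeta>) (?\<Psi> (k - 1) \<zeta>))" for k \<zeta>
  have df: "(?\<Phi> k has_derivative (\<lambda>h. h *\<^sub>C f k \<zeta>)) (at \<zeta>)" for k \<zeta>
    using A.Phi_has_derivative[OF e] by (cases k) (auto simp: f_def)
  \<comment> \<open>The dual terms are antiholomorphic in \<zeta>; as the inner product is conjugate
    linear in its first argument, the increment still factors out linearly.\<close>
  have dg: "(?\<Psi> k has_derivative (\<lambda>h. cnj h *\<^sub>C g k \<zeta>)) (at \<zeta>)" for k \<zeta>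
  proof -
    have "(cnj has_derivative cnj) (at \<zeta>)"
      by (rule bounded_linear_imp_has_derivative[OF bounded_linear_cnj])
    moreover have "(B.Phi e' v (cnj z) k has_derivative (\<lambda>h. h *\<^sub>C g k \<zeta>)) (at (cnj \<zeta>))"
      using B.Phi_has_derivative[OF e'] by (cases k) (auto simp: g_def)
    ultimately show ?thesis
      by (rule has_derivative_compose)
  qed
  define h where "h \<zeta> = (\<Sum>k\<le>n. cinner (?\<Psi> (n - k) \<zeta>) (?\<Phi> k \<zeta>))" for \<zeta>
  have "(h has_derivative (\<lambda>d. 0)) (at \<zeta>)" for \<zeta>
  proof -
    have "(h has_derivative (\<lambda>d. \<Sum>k\<le>n. cinner (?\<Psi> (n - k) \<zeta>) (d *\<^sub>C f k \<zeta>) +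
        cinner (cnj d *\<^sub>C g (n - k) \<zeta>) (?\<Phi> k \<zeta>))) (at \<zeta>)"
      unfolding h_def by (intro has_derivative_sum cinner.FDERIV dg df)
    moreover have "(\<Sum>k\<le>n. cinner (?\<Psi> (n - k) \<zeta>) (d *\<^sub>C f k \<zeta>) + cinner (cnj d *\<^sub>C g (n - k) \<zeta>) (?\<Phi> k \<zeta>)) = 0" for d
    proof -
      \<comment> \<open>The derivative falling on the Dyson term of index k + 1 cancels the one
        falling on the dual term of index n - k.\<close>
      have shift: "cinner (?\<Psi> (n - Suc k) \<zeta>) (f (Suc k) \<zeta>) = - cinner (g (n - k) \<zeta>) (?\<Phi> k \<zeta>)" if "k < n" for k
      proof -
        have "n - k \<noteq> 0" "n - k - 1 = n - Suc k"
          using that by auto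
        then show ?thesis
          unfolding f_def g_def
          using cinner_F[OF A.level_nonneg[OF e] A.Phi_in[OF e x] B.level_nonneg[OF e'] B.Phi_in[OF e' v]]
          by simp
      qed
      have "(\<Sum>k\<le>n. cinner (?\<Psi> (n - k) \<zeta>) (f k \<zeta>)) = (\<Sum>k<n. cinner (?\<Psi> (n - Suc k) \<zeta>) (f (Suc k) \<zeta>))"
        by (simp add: sum.atMost_shift f_def cinner.zero_right)
      also have "\<dots> = - (\<Sum>k<n. cinner (g (n - k) \<zeta>) (?\<Phi> k \<zeta>))"
        using shift by (simp add: sum_negf)
      also have "(\<Sum>k<n. cinner (g (n - k) \<zeta>) (?\<Phi> k \<zeta>)) = (\<Sum>k\<le>n. cinner (g (n - k) \<zeta>) (?\<Phi> k \<zeta>))"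
        by (simp add: lessThan_Suc_atMost[symmetric] g_def cinner.zero_left)
      finally show ?thesis
        by (simp add: sum.distrib cinner_scaleC_right cinner_scaleC_left sum_distrib_left[symmetric])
    qed
    ultimately show ?thesis
      by simp
  qed
  then obtain c where c: "\<And>\<zeta>. h \<zeta> = c"
    using has_derivative_zero_constant[of UNIV h] by auto
  have "h z = (\<Sum>k\<le>n. if k = n then cinner v (?\<Phi> k z) else 0)"
    unfolding h_def
  proof (rule sum.cong)
    fix k assume "k \<in> {..n}"
    then show "cinner (?\<Psi> (n - k) z) (?\<Phi> k z) = (if k = n then cinner v (?\<Phi> k z) else 0)"
      by (cases "n - k") (auto simp: cinner.zero_left)
  qed simp
  moreover have "h z' = (\<Sum>k\<le>n. if k = 0 then cinner (?\<Psi> n z') x else 0)"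
    unfolding h_def
  proof (rule sum.cong)
    fix k show "cinner (?\<Psi> (n - k) z') (?\<Phi> k z') = (if k = 0 then cinner (?\<Psi> n z') x else 0)"
      by (cases k) (auto simp: cinner.zero_right)
  qed simp
  ultimately show ?thesis
    using c by (simp add: sum.delta)
qed

end

section \<open>Piecewise continuously differentiable curves\<close>

lemma piece_of_point:
  fixes p :: "nat \<Rightarrow> real"
  assumes "p 0 \<le> t" "t \<le> p n" "t \<notin> p ` {..n}"
  shows "\<exists>i<n. p i < t \<and> t < p (Suc i)"
  using assms(2,3)
proof (induction n)
  case 0
  with assms(1) show ?case
    by auto
next
  case (Suc n)
  show ?case
  proof (cases "t \<le> p n")
    case True
    have "t \<notin> p ` {..n}"
      using Suc.prems(2) by (auto simp: atMost_Suc)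
    then show ?thesis
      using Suc.IH[OF True] less_SucI by blast
  next
    case False
    then show ?thesis
      using Suc.prems by (intro exI[of _ n]) (auto simp: less_le)
  qed
qed

text \<open>\<open>N\<close> collects all break points, including both end points. Off
  \<open>N\<close> the derivative within the interval is two-sided and agrees with that of an open
  piece, from which it inherits continuity and a bound.\<close>

lemma piecewise_C1_regular:
  fixes \<Gamma> :: "real \<Rightarrow> complex"
  assumes "piecewise_C1 a b \<Gamma>"
  defines "v \<equiv> \<lambda>t. vector_derivative \<Gamma> (at t within {a..b})"
  obtains N M where "finite N" "0 \<le> M" "continuous_on {a..b} \<Gamma>" "continuous_on ({a..b} - N) v"
    "\<And>t. t \<in> {a..b} - N \<Longrightarrow> (\<Gamma> has_vector_derivative v t) (at t)"
    "\<And>t. t \<in> {a..b} - N \<Longrightarrow> cmod (v t) \<le> M"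
proof -
  obtain n p D where p: "p 0 = a" "p n = b" "\<And>i. i < n \<Longrightarrow> p i < p (Suc i)"
    and D: "\<And>i. i < n \<Longrightarrow> continuous_on {p i..p (Suc i)} (D i)"
      "\<And>i t. i < n \<Longrightarrow> t \<in> {p i..p (Suc i)} \<Longrightarrow>
        (\<Gamma> has_vector_derivative D i t) (at t within {p i..p (Suc i)})"
    using assms(1) unfolding piecewise_C1_def by metis
  have mono: "p i \<le> p j" if "i \<le> j" "j \<le> n" for i j
    using that
  proof (induction j)
    case (Suc j)
    then show ?case
      using p(3)[of j] by (cases "i = Suc j") auto
  qed simp
  define N where "N = p ` {..n}"
  have piece: "\<exists>i<n. p i < t \<and> t < p (Suc i)" if "t \<in> {a..b} - N" for t
    using piece_of_point[of p t n] that p by (auto simp: N_def)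
  have deriv: "(\<Gamma> has_vector_derivative D i t) (at t)" and v: "v t = D i t"
    if i: "i < n" "p i < t" "t < p (Suc i)" for i t
  proof -
    show 1: "(\<Gamma> has_vector_derivative D i t) (at t)"
      using D(2)[of i t] i by (simp add: at_within_Icc_at)
    have "a < t" "t < b"
      using mono[of 0 i] mono[of "Suc i" n] i p by auto
    then show "v t = D i t"
      using vector_derivative_at[OF 1] by (simp add: v_def at_within_Icc_at)
  qed
  have cont: "isCont v t" if t: "t \<in> {a..b} - N" for t
  proof -
    obtain i where i: "i < n" "p i < t" "t < p (Suc i)"
      using piece[OF t] by blast
    have "continuous_on {p i<..<p (Suc i)} (D i)"
      using D(1)[OF i(1)] by (rule continuous_on_subset) auto
    then have "continuous_on {p i<..<p (Suc i)} v"
      by (rule continuous_on_eq) (use v i in auto)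
    then show ?thesis
      using i by (simp add: continuous_on_eq_continuous_at)
  qed
  have "continuous_on {p 0..p m} \<Gamma>" if "m \<le> n" for m
    using that
  proof (induction m)
    case (Suc m)
    have "continuous_on {p m..p (Suc m)} \<Gamma>"
      unfolding continuous_on_eq_continuous_within
      using has_vector_derivative_continuous[OF D(2)] Suc.prems by auto
    moreover have "{p 0..p (Suc m)} = {p 0..p m} \<union> {p m..p (Suc m)}"
      using mono[of 0 m] p(3)[of m] Suc.prems by auto
    ultimately show ?case
      using Suc by (auto intro: continuous_on_closed_Un)
  qed simp
  then have "continuous_on {a..b} \<Gamma>"
    using p by auto
  moreover have "bounded (\<Union>i<n. D i ` {p i..p (Suc i)})"
    using D(1) by (intro bounded_UN finite_lessThan ballI compact_imp_bounded compact_continuous_image) auto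
  then obtain M where M: "0 < M" "\<And>i t. i < n \<Longrightarrow> t \<in> {p i..p (Suc i)} \<Longrightarrow> cmod (D i t) \<le> M"
    unfolding bounded_pos by blast
  ultimately show thesis
  proof (intro that[of N M])
    show "finite N"
      by (simp add: N_def)
    show "continuous_on ({a..b} - N) v"
      using cont by (intro continuous_at_imp_continuous_on ballI)
    fix t assume "t \<in> {a..b} - N"
    then obtain i where "i < n" "p i < t" "t < p (Suc i)"
      using piece by blast
    then show "(\<Gamma> has_vector_derivative v t) (at t)" "cmod (v t) \<le> M"
      using deriv v M(2)[of i t] by auto
  qed (use M in auto)
qed

section \<open>The time-ordered exponential on the finite energy subspace\<close>

text \<open>Times decrease with the index, so the leftmost factor is the latest. The bound
  \<open>r\<close> serves the recursion: the first time becomes the bound for the others.\<close>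

primrec ordered :: "nat \<Rightarrow> real \<Rightarrow> (nat \<Rightarrow> real) \<Rightarrow> bool"
  where "ordered 0 r t \<longleftrightarrow> True"
  | "ordered (Suc n) r t \<longleftrightarrow> t 0 < r \<and> ordered n (t 0) (\<lambda>i. t (Suc i))"

lemma ordered_iff: "ordered n r t \<longleftrightarrow> (0 < n \<longrightarrow> t 0 < r) \<and> (\<forall>i. Suc i < n \<longrightarrow> t (Suc i) < t i)"
proof (induction n arbitrary: r t)
  case (Suc n)
  have "(\<forall>i. Suc i < Suc n \<longrightarrow> t (Suc i) < t i) \<longleftrightarrow>
      (0 < n \<longrightarrow> t 1 < t 0) \<and> (\<forall>i. Suc i < n \<longrightarrow> t (Suc (Suc i)) < t (Suc i))"
    (is "?L \<longleftrightarrow> ?R")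
  proof
    assume R: ?R
    show ?L
    proof (intro allI impI)
      fix i assume "Suc i < Suc n"
      with R show "t (Suc i) < t i"
        by (cases i) auto
    qed
  qed auto
  then show ?case
    by (simp add: Suc.IH)
qed simp

text \<open>Strict comparisons between distinct reals are locally constant, hence so is the whole
  ordering condition.\<close>

lemma eventually_ordered:
  fixes T :: "'a \<Rightarrow> nat \<Rightarrow> real"
  assumes "\<And>i. i < n \<Longrightarrow> ((\<lambda>k. T k i) \<longlongrightarrow> t i) net" "(R \<longlongrightarrow> r) net"
    "inj_on t {..<n}" "r \<notin> t ` {..<n}"
  shows "\<forall>\<^sub>F k in net. ordered n (R k) (T k) \<longleftrightarrow> ordered n r t"
  using assms
proof (induction n arbitrary: T t R r)
  case (Suc n)
  have ne: "t 0 \<noteq> r"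
    using Suc.prems(4) by (auto simp: image_iff)
  have "((\<lambda>k. R k - T k 0) \<longlongrightarrow> r - t 0) net"
    using Suc.prems by (intro tendsto_diff) auto
  then have 1: "\<forall>\<^sub>F k in net. (T k 0 < R k) = (t 0 < r)"
    using order_tendstoD[of "\<lambda>k. R k - T k 0" "r - t 0" net 0] ne
    by (cases "t 0 < r") (auto elim: eventually_mono)
  have 2: "\<forall>\<^sub>F k in net. ordered n (T k 0) (\<lambda>i. T k (Suc i)) = ordered n (t 0) (\<lambda>i. t (Suc i))"
  proof (rule Suc.IH)
    show "inj_on (\<lambda>i. t (Suc i)) {..<n}" "t 0 \<notin> (\<lambda>i. t (Suc i)) ` {..<n}"
      using Suc.prems(3) by (auto simp: inj_on_def)
  qed (use Suc.prems in auto)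
  show ?case
    using eventually_conj[OF 1 2] by (rule eventually_mono) auto
qed simp

context energy_raising
begin

lemma F_scaleC: "0 \<le> e \<Longrightarrow> F e \<zeta> (c *\<^sub>C x) = c *\<^sub>C F e \<zeta> x"
  by (simp add: F_def G_scaleC L_scaleC scaleC_scaleC mult.commute scaleC.minus_right)

lemma norm_F_le:
  assumes "0 \<le> e"
  shows "norm (F e \<zeta> x) \<le> exp (cmod \<zeta> * (e + b)) * ((\<alpha> * sqrt e + \<beta>) * (exp (cmod \<zeta> * e) * norm x))"
proof -
  have "norm (F e \<zeta> x) \<le> exp (cmod \<zeta> * (e + b)) * norm (L e (G e (- \<zeta>) x))"
    using norm_G_le by (simp add: F_def norm_scaleC del: scaleC.minus_left)
  also have "\<dots> \<le> exp (cmod \<zeta> * (e + b)) * ((\<alpha> * sqrt e + \<beta>) * norm (G e (- \<zeta>) x))"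
    using norm_L_le[OF assms] by (intro mult_left_mono) auto
  also have "\<dots> \<le> exp (cmod \<zeta> * (e + b)) * ((\<alpha> * sqrt e + \<beta>) * (exp (cmod \<zeta> * e) * norm x))"
    using norm_G_le[of e "- \<zeta>" x] nonneg assms by (intro mult_left_mono) auto
  finally show ?thesis .
qed

text \<open>The cut-off form of the product of the evolved factors applied to \<open>x\<close>: the
  factor with index 0 acts last and therefore at the highest level.\<close>

primrec W :: "real \<Rightarrow> 'h \<Rightarrow> nat \<Rightarrow> (nat \<Rightarrow> complex) \<Rightarrow> 'h"
  where "W e x 0 \<zeta> = x"
  | "W e x (Suc n) \<zeta> = F (e + real n * b) (\<zeta> 0) (W e x n (\<lambda>i. \<zeta> (Suc i)))"

lemma W_cong: "(\<And>i. i < n \<Longrightarrow> \<zeta> i = \<zeta>' i) \<Longrightarrow> W e x n \<zeta> = W e x n \<zeta>'"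
proof (induction n arbitrary: \<zeta> \<zeta>')
  case (Suc n)
  have "W e x n (\<lambda>i. \<zeta> (Suc i)) = W e x n (\<lambda>i. \<zeta>' (Suc i))"
    by (rule Suc.IH) (simp add: Suc.prems)
  moreover have "\<zeta> 0 = \<zeta>' 0"
    by (rule Suc.prems) simp
  ultimately show ?case
    by simp
qed simp

lemma W_in: "x \<in> spec_subspace E e \<Longrightarrow> W e x n \<zeta> \<in> spec_subspace E (e + real n * b)"
proof (cases n)
  case (Suc m)
  then show ?thesis
    using F_in[of "e + real m * b" "\<zeta> 0"] by (simp add: algebra_simps)
qed simp

lemma W_tendsto:
  assumes e: "0 \<le> e" and "\<And>i. i < n \<Longrightarrow> ((\<lambda>k. Z k i) \<longlongrightarrow> \<zeta> i) net"
  shows "((\<lambda>k. W e x n (Z k)) \<longlongrightarrow> W e x n \<zeta>) net"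
  using assms(2)
proof (induction n arbitrary: Z \<zeta>)
  case (Suc n)
  have "((\<lambda>k. W e x n (\<lambda>i. Z k (Suc i))) \<longlongrightarrow> W e x n (\<lambda>i. \<zeta> (Suc i))) net"
    using Suc.prems by (intro Suc.IH) auto
  moreover have "((\<lambda>k. Z k 0) \<longlongrightarrow> \<zeta> 0) net"
    using Suc.prems by auto
  ultimately show ?case
    using F_tendsto[OF level_nonneg[OF e]] by simp
qed simp

lemma W_bounded:
  assumes e: "0 \<le> e"
  shows "\<exists>C\<ge>0. \<forall>\<zeta>. (\<forall>i<n. cmod (\<zeta> i) \<le> R) \<longrightarrow> norm (W e x n \<zeta>) \<le> C"
proof (induction n)
  case 0
  then show ?case
    by (intro exI[of _ "norm x"]) auto
next
  case (Suc n)
  let ?e = "e + real n * b"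
  obtain C where C: "0 \<le> C" "\<And>\<zeta>. (\<forall>i<n. cmod (\<zeta> i) \<le> R) \<Longrightarrow> norm (W e x n \<zeta>) \<le> C"
    using Suc.IH by blast
  have e': "0 \<le> ?e"
    by (rule level_nonneg[OF e])
  let ?C = "exp (R * (?e + b)) * ((\<alpha> * sqrt ?e + \<beta>) * (exp (R * ?e) * C))"
  show ?case
  proof (intro exI[of _ ?C] conjI allI impI)
    show "0 \<le> ?C"
      using C nonneg e' by simp
    fix \<zeta> :: "nat \<Rightarrow> complex" assume \<zeta>: "\<forall>i<Suc n. cmod (\<zeta> i) \<le> R"
    have "norm (W e x (Suc n) \<zeta>) \<le> exp (cmod (\<zeta> 0) * (?e + b)) *
        ((\<alpha> * sqrt ?e + \<beta>) * (exp (cmod (\<zeta> 0) * ?e) * norm (W e x n (\<lambda>i. \<zeta> (Suc i)))))"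
      unfolding W.simps by (rule norm_F_le[OF e'])
    also have "\<dots> \<le> ?C"
      using C \<zeta> nonneg e' by (intro mult_mono) (auto intro!: mult_right_mono)
    finally show "norm (W e x (Suc n) \<zeta>) \<le> ?C" .
  qed
qed

abbreviation evolved_F :: "complex \<Rightarrow> 'h operator"
  where "evolved_F \<zeta> \<equiv> op_scale (- \<i>) (evolved E T \<zeta>)"

lemma W_graph:
  assumes "0 \<le> e" "x \<in> spec_subspace E e"
  shows "(x, W e x n (\<lambda>i. \<zeta> (\<sigma> i))) \<in> F_prod evolved_F n \<sigma> \<zeta>"
proof (induction n arbitrary: \<sigma>)
  case 0
  then show ?case
    by (simp add: F_prod_def op_prod_def)
next
  case (Suc n)
  have "F_prod evolved_F (Suc n) \<sigma> \<zeta> = F_prod evolved_F n (\<lambda>i. \<sigma> (Suc i)) \<zeta> O evolved_F (\<zeta> (\<sigma> 0))"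
    by (simp add: F_prod_def op_prod_def map_upt_Suc del: upt_Suc)
  moreover have "(W e x n (\<lambda>i. \<zeta> (\<sigma> (Suc i))), W e x (Suc n) (\<lambda>i. \<zeta> (\<sigma> i))) \<in> evolved_F (\<zeta> (\<sigma> 0))"
    using F_graph[OF level_nonneg[OF assms(1)] W_in[OF assms(2)]] by simp
  ultimately show ?case
    using Suc.IH by blast
qed

lemma single_valued_F_prod:
  assumes "\<And>\<zeta>. single_valued (evolved_F \<zeta>)"
  shows "single_valued (F_prod evolved_F n \<sigma> \<zeta>)"
proof -
  have "single_valued (foldr (\<lambda>S T. S \<circ>\<^sub>o T) (map (\<lambda>i. evolved_F (\<zeta> (\<sigma> i))) is) Id)" for "is"
    by (induction "is") (auto intro!: single_valued_relcomp assms)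
  then show ?thesis
    by (simp add: F_prod_def op_prod_def)
qed

lemma F_prod_apply:
  assumes "\<And>\<zeta>. single_valued (evolved_F \<zeta>)" "0 \<le> e" "x \<in> spec_subspace E e"
  shows "op_apply (F_prod evolved_F n \<sigma> \<zeta>) x = W e x n (\<lambda>i. \<zeta> (\<sigma> i))"
  by (rule op_apply_eq[OF single_valued_F_prod[OF assms(1)] W_graph[OF assms(2,3)]])

text \<open>The region can be taken to be the whole of C^n, on which the product is defined and
  jointly continuous.\<close>

lemma spec_subspace_C_space:
  assumes sv: "\<And>\<zeta>. single_valued (evolved_F \<zeta>)" and e: "0 \<le> e" and x: "x \<in> spec_subspace E e"
  shows "x \<in> C_space a b' \<Gamma> evolved_F"
proof -
  have "\<exists>S. openin (product_topology (\<lambda>_. euclidean) {..<n}) S \<and>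
      connectedin (product_topology (\<lambda>_. euclidean) {..<n}) S \<and>
      curve_power a b' \<Gamma> n \<subseteq> S \<and>
      (\<forall>\<zeta>\<in>S. x \<in> Domain (F_prod evolved_F n id \<zeta>)) \<and>
      continuous_map (subtopology (product_topology (\<lambda>_. euclidean) {..<n}) S) euclidean
        (\<lambda>\<zeta>. op_apply (F_prod evolved_F n id \<zeta>) x)" for n
  proof (intro exI[of _ "{..<n} \<rightarrow>\<^sub>E UNIV"] conjI)
    let ?X = "product_topology (\<lambda>_. euclidean) {..<n} :: (nat \<Rightarrow> complex) topology"
    have top: "topspace ?X = {..<n} \<rightarrow>\<^sub>E UNIV"
      by simp
    show "openin ?X ({..<n} \<rightarrow>\<^sub>E UNIV)"
      unfolding top[symmetric] by (rule openin_topspace)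
    show "connectedin ?X ({..<n} \<rightarrow>\<^sub>E UNIV)"
      using connectedin_PiE[of "\<lambda>_. euclidean" "{..<n}" "\<lambda>_. UNIV :: complex set"]
      by (simp add: convex_connected)
    show "curve_power a b' \<Gamma> n \<subseteq> {..<n} \<rightarrow>\<^sub>E UNIV"
      by (auto simp: curve_power_def PiE_def)
    show "\<forall>\<zeta>\<in>{..<n} \<rightarrow>\<^sub>E UNIV. x \<in> Domain (F_prod evolved_F n id \<zeta>)"
      using W_graph[OF e x] by blast
    have "continuous_map ?X euclidean (W e x n)"
      unfolding continuous_map_atin limitin_canonical_iff
    proof
      fix \<zeta> assume \<zeta>: "\<zeta> \<in> topspace ?X"
      show "(W e x n \<longlongrightarrow> W e x n \<zeta>) (atin ?X \<zeta>)"
      proof (rule W_tendsto[OF e])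
        fix i assume "i < n"
        then have "continuous_map ?X euclidean (\<lambda>\<zeta>. \<zeta> i)"
          by (intro continuous_map_product_coordinates) auto
        then show "((\<lambda>\<zeta>. \<zeta> i) \<longlongrightarrow> \<zeta> i) (atin ?X \<zeta>)"
          using \<zeta> unfolding continuous_map_atin limitin_canonical_iff by blast
      qed
    qed
    then show "continuous_map (subtopology ?X ({..<n} \<rightarrow>\<^sub>E UNIV)) euclidean
        (\<lambda>\<zeta>. op_apply (F_prod evolved_F n id \<zeta>) x)"
      unfolding F_prod_apply[OF sv e x] top[symmetric] subtopology_topspace by simp
  qed
  then show ?thesis
    unfolding C_space_def by (intro cvs.span_base) blast
qed

definition ordered_integrand ::
    "real \<Rightarrow> 'h \<Rightarrow> (real \<Rightarrow> complex) \<Rightarrow> (real \<Rightarrow> complex) \<Rightarrow> nat \<Rightarrow> real \<Rightarrow> (nat \<Rightarrow> real) \<Rightarrow> 'h"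
  where "ordered_integrand e x \<Gamma> v n r t =
    (if ordered n r t then (\<Prod>i<n. v (t i)) *\<^sub>C W e x n (\<lambda>i. \<Gamma> (t i)) else 0)"

text \<open>Where the ordering is locally constant the integrand is locally zero or a product of
  continuous factors. The bound \<open>r\<close> joins the exceptional points because the cut-off at
  \<open>r\<close> jumps there.\<close>

lemma cont_off_diagonal_ordered_integrand:
  assumes e: "0 \<le> e" and N: "finite N" and M: "0 \<le> M"
    and \<Gamma>: "continuous_on {c..d} \<Gamma>" and v: "continuous_on ({c..d} - N) v"
    and vM: "\<And>t. t \<in> {c..d} - N \<Longrightarrow> cmod (v t) \<le> M"
  shows "\<exists>M'. cont_off_diagonal c d n (insert r N) M' (ordered_integrand e x \<Gamma> v n r)"
proof -
  have "bounded (\<Gamma> ` {c..d})"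
    by (intro compact_imp_bounded compact_continuous_image \<Gamma>) simp
  then obtain R where R: "\<And>t. t \<in> {c..d} \<Longrightarrow> cmod (\<Gamma> t) \<le> R"
    unfolding bounded_iff by blast
  obtain C where C: "0 \<le> C" "\<And>\<zeta>. (\<forall>i<n. cmod (\<zeta> i) \<le> R) \<Longrightarrow> norm (W e x n \<zeta>) \<le> C"
    using W_bounded[OF e] by blast
  let ?S = "distinct_points c d n (insert r N)"
  have coord: "t i \<in> {c..d} - N" "t i \<noteq> r" if "t \<in> ?S" "i < n" for t i
    using that by (auto simp: distinct_points_def)
  have "norm (ordered_integrand e x \<Gamma> v n r t) \<le> M ^ n * C" if t: "t \<in> ?S" for t
  proof -
    have "cmod (\<Prod>i<n. v (t i)) \<le> (\<Prod>i<n. M)"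
      unfolding prod_norm[symmetric] using vM coord[OF t] by (intro prod_mono) auto
    then have "cmod (\<Prod>i<n. v (t i)) * norm (W e x n (\<lambda>i. \<Gamma> (t i))) \<le> M ^ n * C"
      using C R coord[OF t] M by (intro mult_mono) auto
    then show ?thesis
      using M C by (simp add: ordered_integrand_def norm_scaleC)
  qed
  moreover have "continuous_on ?S (ordered_integrand e x \<Gamma> v n r)"
    unfolding continuous_on_def
  proof
    fix t assume t: "t \<in> ?S"
    let ?net = "at t within ?S"
    have coord_lim: "((\<lambda>s. s i) \<longlongrightarrow> t i) ?net" for i
      using continuous_on_product_coordinates[of i] by (auto simp: continuous_on_def intro: tendsto_within_subset)
    have comp: "((\<lambda>s. f (s i)) \<longlongrightarrow> f (t i)) ?net" if "continuous_on ({c..d} - N) f" "i < n"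
      for f :: "real \<Rightarrow> complex" and i
      by (rule continuous_on_tendsto_compose[OF that(1) coord_lim])
        (use coord that(2) t in \<open>auto simp: eventually_at_filter\<close>)
    have \<Gamma>': "continuous_on ({c..d} - N) \<Gamma>"
      using \<Gamma> by (rule continuous_on_subset) auto
    have lim: "((\<lambda>s. (\<Prod>i<n. v (s i)) *\<^sub>C W e x n (\<lambda>i. \<Gamma> (s i))) \<longlongrightarrow>
        (\<Prod>i<n. v (t i)) *\<^sub>C W e x n (\<lambda>i. \<Gamma> (t i))) ?net"
      by (intro scaleC.tendsto tendsto_prod W_tendsto e comp v \<Gamma>') auto
    have ev: "\<forall>\<^sub>F s in ?net. ordered n r s = ordered n r t"
      using t coord_lim by (intro eventually_ordered) (auto simp: distinct_points_def)
    show "(ordered_integrand e x \<Gamma> v n r \<longlongrightarrow> ordered_integrand e x \<Gamma> v n r t) ?net"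
    proof (cases "ordered n r t")
      case True
      have "\<forall>\<^sub>F s in ?net. (\<Prod>i<n. v (s i)) *\<^sub>C W e x n (\<lambda>i. \<Gamma> (s i)) = ordered_integrand e x \<Gamma> v n r s"
        using ev by (rule eventually_mono) (simp add: ordered_integrand_def True)
      then show ?thesis
        using Lim_transform_eventually[OF lim] True
        by (simp add: ordered_integrand_def[of e x \<Gamma> v n r t])
    next
      case False
      have "\<forall>\<^sub>F s in ?net. 0 = ordered_integrand e x \<Gamma> v n r s"
        using ev by (rule eventually_mono) (simp add: ordered_integrand_def False)
      then show ?thesis
        using Lim_transform_eventually[OF tendsto_const, of "0 :: 'h" _ ?net] False
        by (simp add: ordered_integrand_def[of e x \<Gamma> v n r t])
    qed
  qed
  ultimately show ?thesis
    using N M C by (intro exI[of _ "M ^ n * C"]) (auto simp: cont_off_diagonal_def)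
qed

text \<open>Slicing off the outermost time s leaves the ordered integrand with bound s, hence the
  induction for all \<open>r\<close>. The inner integral is a Dyson term at the point of time s, and
  the remaining integrand is the derivative of the next Dyson term along the curve.\<close>

lemma iterated_integral_ordered:
  assumes e: "0 \<le> e" and cd: "c \<le> d" and N: "finite N" and M: "0 \<le> M"
    and \<Gamma>: "continuous_on {c..d} \<Gamma>" and v: "continuous_on ({c..d} - N) v"
    and vM: "\<And>t. t \<in> {c..d} - N \<Longrightarrow> cmod (v t) \<le> M"
    and deriv: "\<And>t. t \<in> {c..d} - N \<Longrightarrow> (\<Gamma> has_vector_derivative v t) (at t)"
    and r: "r \<in> {c..d}"
  shows "iterated_integral c d n (ordered_integrand e x \<Gamma> v n r) = Phi e x (\<Gamma> c) n (\<Gamma> r)"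
  using r
proof (induction n arbitrary: r)
  case 0
  then show ?case
    by (simp add: ordered_integrand_def)
next
  case (Suc n)
  let ?e = "e + real n * b"
  let ?f = "\<lambda>s. v s *\<^sub>C F ?e (\<Gamma> s) (Phi e x (\<Gamma> c) n (\<Gamma> s))"
  have e': "0 \<le> ?e"
    by (rule level_nonneg[OF e])
  have slice: "iterated_integral c d n (\<lambda>t. ordered_integrand e x \<Gamma> v (Suc n) r (case_nat s t)) =
      (if s \<in> {c..r} then ?f s else 0)" if s: "s \<in> {c..d} - insert r N" for s
  proof -
    \<comment> \<open>Cut-off, velocity and outermost factor do not depend on the inner times;
      together they form a bounded linear map that leaves the inner integral.\<close>
    let ?L = "\<lambda>y. (if s < r then v s else 0) *\<^sub>C F ?e (\<Gamma> s) y"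
    have L: "bounded_linear ?L"
      by (intro bounded_linear_compose[OF scaleC.bounded_linear_right] bounded_linear_F e')
    have "(\<Prod>i<Suc n. v (case_nat s t i)) = v s * (\<Prod>i<n. v (t i))" for t
      by (subst prod.lessThan_Suc_shift) simp
    then have eq: "ordered_integrand e x \<Gamma> v (Suc n) r (case_nat s t) =
        ?L (ordered_integrand e x \<Gamma> v n s t)" for t
      by (simp add: ordered_integrand_def F_scaleC[OF e'] scaleC_scaleC
          linear_0[OF bounded_linear.linear[OF bounded_linear_F[OF e']]] scaleC.zero_right scaleC.zero_left del: prod.lessThan_Suc)
    obtain M' where M': "cont_off_diagonal c d n (insert s N) M' (ordered_integrand e x \<Gamma> v n s)"
      using cont_off_diagonal_ordered_integrand[OF e N M \<Gamma> v vM] by blast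
    have "iterated_integral c d n (\<lambda>t. ordered_integrand e x \<Gamma> v (Suc n) r (case_nat s t)) =
        ?L (Phi e x (\<Gamma> c) n (\<Gamma> s))"
      unfolding eq iterated_integral_bounded_linear[OF cd L M'] using Suc.IH[of s] s by simp
    then show ?thesis
      using s by (auto simp: scaleC.zero_left)
  qed
  have "iterated_integral c d (Suc n) (ordered_integrand e x \<Gamma> v (Suc n) r) =
      integral {c..d} (\<lambda>s. if s \<in> {c..r} then ?f s else 0)"
    unfolding iterated_integral.simps using slice N
    by (intro integral_spike[of "insert r N"]) auto
  also have "\<dots> = integral ({c..r} \<inter> {c..d}) ?f"
    by (rule integral_restrict_Int)
  also have "{c..r} \<inter> {c..d} = {c..r}"
    using Suc.prems by auto
  \<comment> \<open>The fundamental theorem applies off the finitely many break points; the lower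
    boundary term is zero by the initial condition.\<close>
  also have "integral {c..r} ?f = Phi e x (\<Gamma> c) (Suc n) (\<Gamma> r) - Phi e x (\<Gamma> c) (Suc n) (\<Gamma> c)"
  proof (rule integral_unique, rule fundamental_theorem_of_calculus_interior_strong[OF N])
    show "c \<le> r"
      using Suc.prems by simp
    show "continuous_on {c..r} (\<lambda>s. Phi e x (\<Gamma> c) (Suc n) (\<Gamma> s))"
      by (rule continuous_on_compose2[OF entire_imp_continuous_on[OF entire_Phi[OF e], of UNIV]
            continuous_on_subset[OF \<Gamma>]]) (use Suc.prems in auto)
    fix s assume "s \<in> {c<..<r} - N"
    then show "((\<lambda>s. Phi e x (\<Gamma> c) (Suc n) (\<Gamma> s)) has_vector_derivative ?f s) (at s)"
      using Suc.prems by (intro has_vector_derivative_along_curve Phi_has_derivative e deriv) auto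
  qed
  also have "\<dots> = Phi e x (\<Gamma> c) (Suc n) (\<Gamma> r)"
    by simp
  finally show ?case .
qed

text \<open>Each permutation contributes the ordered integrand at the permuted times, the product of
  the velocities being symmetric. Permutation invariance of the iterated integral makes all n!
  contributions equal.\<close>

lemma line_integral_T_prod:
  assumes sv: "\<And>\<zeta>. single_valued (evolved_F \<zeta>)" and e: "0 \<le> e" and x: "x \<in> spec_subspace E e"
    and curve: "simple_curve c d \<Gamma> z' z"
  shows "line_integral c d \<Gamma> n (\<lambda>\<zeta>. T_prod c d \<Gamma> evolved_F n \<zeta> x) = fact n *\<^sub>R Phi e x z' n z"
proof -
  have cd: "c \<le> d" and inj: "inj_on \<Gamma> {c..d}" and ends: "\<Gamma> c = z'" "\<Gamma> d = z"
    using curve by (auto simp: simple_curve_def)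
  define v where "v t = vector_derivative \<Gamma> (at t within {c..d})" for t
  obtain N M where N: "finite N" and M: "0 \<le> M" and \<Gamma>: "continuous_on {c..d} \<Gamma>"
    and v: "continuous_on ({c..d} - N) v"
    and deriv: "\<And>t. t \<in> {c..d} - N \<Longrightarrow> (\<Gamma> has_vector_derivative v t) (at t)"
    and vM: "\<And>t. t \<in> {c..d} - N \<Longrightarrow> cmod (v t) \<le> M"
    using piecewise_C1_regular[of c d \<Gamma>] curve unfolding simple_curve_def v_def[abs_def] by metis
  let ?k = "ordered_integrand e x \<Gamma> v n d"
  obtain M' where nice: "cont_off_diagonal c d n (insert d N) M' ?k"
    using cont_off_diagonal_ordered_integrand[OF e N M \<Gamma> v vM] by blast
  let ?P = "{\<sigma>. \<sigma> permutes {..<n}}"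
  have "(\<Prod>i<n. v (t i)) *\<^sub>C T_prod c d \<Gamma> evolved_F n (\<lambda>i\<in>{..<n}. \<Gamma> (t i)) x = (\<Sum>\<sigma>\<in>?P. ?k (t \<circ> \<sigma>))"
    if t: "t \<in> distinct_points c d n (insert d N)" for t
  proof -
    let ?\<zeta> = "\<lambda>i\<in>{..<n}. \<Gamma> (t i)"
    have coord: "t i \<in> {c..d}" "t i \<noteq> d" if "i < n" for i
      using t that by (auto simp: distinct_points_def)
    have "(\<Prod>i<n. v (t i)) *\<^sub>C (if ?\<zeta> \<in> ordered_region c d \<Gamma> n \<sigma>
        then op_apply (F_prod evolved_F n \<sigma> ?\<zeta>) x else 0) = ?k (t \<circ> \<sigma>)" if \<sigma>: "\<sigma> permutes {..<n}" for \<sigma>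
    proof -
      have \<sigma>n: "\<sigma> i < n" if "i < n" for i
        using permutes_in_image[OF \<sigma>, of i] that by simp
      \<comment> \<open>Injectivity recovers the parameters, so the order of points on the curve is
        the order of times.\<close>
      have succ: "curve_succ c d \<Gamma> (\<Gamma> s) (\<Gamma> s') \<longleftrightarrow> s' < s" if "s \<in> {c..d}" "s' \<in> {c..d}" for s s'
      proof
        assume "curve_succ c d \<Gamma> (\<Gamma> s) (\<Gamma> s')"
        then obtain t1 t2 where "t1 \<in> {c..d}" "t2 \<in> {c..d}" "\<Gamma> s = \<Gamma> t1" "\<Gamma> s' = \<Gamma> t2" "t1 > t2"
          unfolding curve_succ_def by blast
        then show "s' < s"
          using inj_onD[OF inj, of s t1] inj_onD[OF inj, of s' t2] that by simp
      next
        assume "s' < s"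
        with that show "curve_succ c d \<Gamma> (\<Gamma> s) (\<Gamma> s')"
          unfolding curve_succ_def by blast
      qed
      have "?\<zeta> \<in> ordered_region c d \<Gamma> n \<sigma> \<longleftrightarrow> ordered n d (t \<circ> \<sigma>)"
      proof -
        have "?\<zeta> \<in> curve_power c d \<Gamma> n"
          using coord by (auto simp: curve_power_def)
        then have "?\<zeta> \<in> ordered_region c d \<Gamma> n \<sigma> \<longleftrightarrow> (\<forall>i. Suc i < n \<longrightarrow> t (\<sigma> (Suc i)) < t (\<sigma> i))"
          using \<sigma>n coord succ by (auto simp: ordered_region_def)
        \<comment> \<open>The extra bound in \<open>ordered\<close> holds automatically, since
          \<open>d\<close> counts as exceptional.\<close>
        moreover have "t (\<sigma> 0) < d" if "0 < n"
          using coord[OF \<sigma>n[OF that]] by auto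
        ultimately show ?thesis
          by (simp add: ordered_iff)
      qed
      moreover have "op_apply (F_prod evolved_F n \<sigma> ?\<zeta>) x = W e x n (\<lambda>i. \<Gamma> (t (\<sigma> i)))"
        unfolding F_prod_apply[OF sv e x] using \<sigma>n by (intro W_cong) simp
      moreover have "(\<Prod>i<n. v (t i)) = (\<Prod>i<n. v (t (\<sigma> i)))"
        using prod.permute[OF \<sigma>, of "\<lambda>i. v (t i)"] by (simp add: o_def)
      ultimately show ?thesis
        by (simp add: ordered_integrand_def scaleC.zero_right)
    qed
    then show ?thesis
      unfolding T_prod_def by (simp add: scaleC.sum_right)
  qed
  then have "line_integral c d \<Gamma> n (\<lambda>\<zeta>. T_prod c d \<Gamma> evolved_F n \<zeta> x) =
      iterated_integral c d n (\<lambda>t. \<Sum>\<sigma>\<in>?P. ?k (t \<circ> \<sigma>))"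
    unfolding line_integral_def v_def[symmetric] using N
    by (intro iterated_integral_cong[of "insert d N"]) auto
  also have "\<dots> = (\<Sum>\<sigma>\<in>?P. iterated_integral c d n (\<lambda>t. ?k (t \<circ> \<sigma>)))"
    by (intro iterated_integral_sum[OF cd]) (auto simp: finite_permutations intro: cont_off_diagonal_permute nice)
  also have "\<dots> = (\<Sum>\<sigma>\<in>?P. Phi e x (\<Gamma> c) n (\<Gamma> d))"
    using iterated_integral_permute[OF cd nice]
      iterated_integral_ordered[OF e cd N M \<Gamma> v vM deriv, of d n x] cd
    by (intro sum.cong) auto
  also have "\<dots> = fact n *\<^sub>R Phi e x z' n z"
    by (simp add: card_permutations ends sum_constant_scaleR del: sum_constant)
  finally show ?thesis .
qed

text \<open>The factor n! cancels 1/n!, so the exponential is the sum of the Dyson terms, which know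
  only the end points; absolute summability places \<open>x\<close> in the domain.\<close>

lemma T_exp_spec_subspace:
  assumes sv: "\<And>\<zeta>. single_valued (evolved_F \<zeta>)" and e: "0 \<le> e" and x: "x \<in> spec_subspace E e"
    and curve: "simple_curve c d \<Gamma> z' z"
  shows "(x, y) \<in> T_exp_evolved E T c d \<Gamma> \<longleftrightarrow> y = (\<Sum>n. Phi e x z' n z)"
proof -
  have "summable (\<lambda>n. norm (Phi e x z' n z))"
    by (rule summable_norm_Phi[OF e x])
  then show ?thesis
    unfolding T_exp_evolved_def T_exp_def line_integral_T_prod[OF sv e x curve]
    using spec_subspace_C_space[OF sv e x] line_integral_T_prod[OF sv e x curve] by auto
qed

end

section \<open>The operator U, its closability and its adjoint\<close>

context dual_pair
begin

lemma Domain_T_exp: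
  assumes "simple_curve c d \<Gamma> z' z"
  shows "D_fin E \<subseteq> Domain (T_exp_evolved E A c d \<Gamma>)"
  using A.T_exp_spec_subspace[OF single_valued_evolved _ _ assms] unfolding D_fin_def by blast

lemma T_exp_restrict_eq:
  assumes "simple_curve c d \<Gamma> z' z" "simple_curve c' d' \<Gamma>' z' z"
  shows "op_restrict (T_exp_evolved E A c d \<Gamma>) (D_fin E) = op_restrict (T_exp_evolved E A c' d' \<Gamma>') (D_fin E)"
proof -
  have "(x, y) \<in> T_exp_evolved E A c d \<Gamma> \<longleftrightarrow> (x, y) \<in> T_exp_evolved E A c' d' \<Gamma>'" if "x \<in> D_fin E" for x y
    using that A.T_exp_spec_subspace[OF single_valued_evolved _ _ assms(1)]
      A.T_exp_spec_subspace[OF single_valued_evolved _ _ assms(2)]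
    unfolding D_fin_def by blast
  then show ?thesis
    unfolding op_restrict_def by auto
qed

lemma U_op_eq:
  assumes "simple_curve c d \<Gamma> z' z"
  shows "U_op E A z z' = op_restrict (T_exp_evolved E A c d \<Gamma>) (D_fin E)"
proof -
  obtain c' d' \<Gamma>' where some: "(SOME (a, b, \<Gamma>). simple_curve a b \<Gamma> z' z) = (c', d', \<Gamma>')"
    by (metis prod_cases3)
  have "case (SOME (a, b, \<Gamma>). simple_curve a b \<Gamma> z' z) of (a, b, \<Gamma>) \<Rightarrow> simple_curve a b \<Gamma> z' z"
    using assms by (intro someI_ex[of "\<lambda>(a, b, \<Gamma>). simple_curve a b \<Gamma> z' z"]) auto
  then have "simple_curve c' d' \<Gamma>' z' z"
    by (simp add: some)
  then show ?thesis
    unfolding U_op_def some Let_def by (simp add: T_exp_restrict_eq[OF _ assms])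
qed

lemma U_op_iff:
  assumes "0 \<le> e" "x \<in> spec_subspace E e"
  shows "(x, y) \<in> U_op E A z z' \<longleftrightarrow> y = (\<Sum>n. A.Phi e x z' n z)"
proof -
  obtain c d \<Gamma> where "simple_curve c d \<Gamma> z' z"
    using simple_curve_exists by blast
  then show ?thesis
    using A.T_exp_spec_subspace[OF single_valued_evolved assms] A.D_finI[OF assms]
    by (simp add: U_op_eq op_restrict_def)
qed

lemma U_op_Domain: "(x, y) \<in> U_op E A z z' \<Longrightarrow> x \<in> D_fin E"
  using simple_curve_exists[of z' z] by (auto simp: U_op_eq op_restrict_def)

text \<open>Both sides expand into absolutely convergent Dyson series, and \<open>cinner_Phi\<close>
  matches them term by term.\<close>

lemma cinner_U_op:
  assumes "(x, y) \<in> U_op E A z z'" "(v, w) \<in> U_op E B (cnj z') (cnj z)"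
  shows "cinner v y = cinner w x"
proof -
  interpret swapped: dual_pair E B A b \<alpha> \<beta>
    by (rule swapped)
  obtain e where e: "0 \<le> e" "x \<in> spec_subspace E e"
    using U_op_Domain[OF assms(1)] by (auto simp: D_fin_def)
  obtain e' where e': "0 \<le> e'" "v \<in> spec_subspace E e'"
    using swapped.U_op_Domain[OF assms(2)] by (auto simp: D_fin_def)
  have "cinner v y = (\<Sum>n. cinner v (A.Phi e x z' n z))"
    using assms(1) unfolding U_op_iff[OF e]
    by (simp add: bounded_linear.suminf[OF cinner.bounded_linear_right]
        summable_norm_cancel[OF A.summable_norm_Phi[OF e]])
  also have "\<dots> = (\<Sum>n. cinner (B.Phi e' v (cnj z) n (cnj z')) x)"
    by (simp add: cinner_Phi[OF e e'])
  also have "\<dots> = cinner w x"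
    using assms(2) unfolding swapped.U_op_iff[OF e']
    by (simp add: bounded_linear.suminf[OF cinner.bounded_linear_left]
        summable_norm_cancel[OF B.summable_norm_Phi[OF e']])
  finally show ?thesis .
qed

lemma U_op_total: "x \<in> D_fin E \<Longrightarrow> \<exists>y. (x, y) \<in> U_op E A z z'"
  using U_op_iff unfolding D_fin_def by blast

text \<open>For fixed \<open>v\<close> the adjoint identity is a closed condition on the pair, so on
  the closure \<open>x\<close> still determines the pairing of its value with every vector of finite
  energy.\<close>

lemma closable_U_op: "closable (U_op E A z z')"
  unfolding closable_def
proof (rule single_valuedI)
  interpret swapped: dual_pair E B A b \<alpha> \<beta>
    by (rule swapped)
  fix x y y' assume xy: "(x, y) \<in> closure (U_op E A z z')" "(x, y') \<in> closure (U_op E A z z')"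
  have "y - y' = 0"
  proof (rule A.D_fin_separates)
    fix v assume "v \<in> D_fin E"
    then obtain w where w: "(v, w) \<in> U_op E B (cnj z') (cnj z)"
      using swapped.U_op_total by blast
    have "closure (U_op E A z z') \<subseteq> {(x, y). cinner v y = cinner w x}"
    proof (rule closure_minimal)
      show "closed {(x, y). cinner v y = cinner w x}"
        by (auto simp: case_prod_beta' intro!: closed_Collect_eq continuous_intros cinner.continuous_on)
    qed (use cinner_U_op w in auto)
    with xy have "cinner v y = cinner w x" "cinner v y' = cinner w x"
      by auto
    then show "cinner v (y - y') = 0"
      by (simp add: cinner.diff_right)
  qed
  then show "y = y'"
    by simp
qed

lemma closure_U_op_subset_adjoint:
  "closure (U_op E B (cnj z') (cnj z)) \<subseteq> adjoint_op (U_op E A z z')"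
proof (rule closure_minimal)
  show "U_op E B (cnj z') (cnj z) \<subseteq> adjoint_op (U_op E A z z')"
    using cinner_U_op by (auto simp: adjoint_op_def)
  have "adjoint_op (U_op E A z z') = (\<Inter>(x, y)\<in>U_op E A z z'. {(u, v). cinner u y = cinner v x})"
    by (auto simp: adjoint_op_def)
  moreover have "closed {(u, v). cinner u y = cinner v x}" for x y :: 'h
    by (auto simp: case_prod_beta' intro!: closed_Collect_eq continuous_intros cinner.continuous_on)
  ultimately show "closed (adjoint_op (U_op E A z z'))"
    by auto
qed

end

section \<open>Operators of class C0\<close>

context pvm_nonneg
begin

text \<open>\<open>op_apply\<close> is a definite description, so uniqueness of the value at
  \<open>x\<close> has to come first: vectors of finite energy lie in the domain of the square root
  and separate points.\<close>

lemma sqrt_bound: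
  assumes S: "S = spectral_integral E (\<lambda>l. complex_of_real (sqrt l))"
    and e: "0 \<le> e" and x: "x \<in> spec_subspace E e"
  shows "x \<in> Domain S" "norm (op_apply S x) \<le> sqrt e * norm x"
proof -
  let ?f = "\<lambda>l. complex_of_real (sqrt l)"
  have f: "bounded_borel (\<lambda>l. indicator {0..e'} l * ?f l)" and f_le: "cmod (indicator {0..e'} l * ?f l) \<le> sqrt e'"
    if "0 \<le> e'" for e' l
  proof -
    show le: "cmod (indicator {0..e'} l * ?f l) \<le> sqrt e'" for l
      using that by (auto simp: indicator_def)
    show "bounded_borel (\<lambda>l. indicator {0..e'} l * ?f l)"
      by (rule bounded_borelI[OF _ le]) auto
  qed
  have graph: "(x, opf (\<lambda>l. indicator {0..e} l * ?f l) x) \<in> S"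
    unfolding S using x by (intro spectral_integral_range f e) (auto simp: spec_subspace_iff)
  then show "x \<in> Domain S"
    by blast
  have unique: "y = opf (\<lambda>l. indicator {0..e} l * ?f l) x" if "(x, y) \<in> S" for y
  proof -
    have "y - opf (\<lambda>l. indicator {0..e} l * ?f l) x = 0"
    proof (rule D_fin_separates)
      fix v assume "v \<in> D_fin E"
      then obtain e' where e': "0 \<le> e'" "v \<in> spec_subspace E e'"
        by (auto simp: D_fin_def)
      then have "v \<in> spectral_domain E ?f"
        by (intro spectral_domain_range[of ?f "{0..e'}"] f) (auto simp: spec_subspace_iff)
      then show "cinner v (y - opf (\<lambda>l. indicator {0..e} l * ?f l) x) = 0"
        using that graph unfolding S by (auto simp: spectral_integral_def cinner.diff_right)
    qed
    then show ?thesis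
      by simp
  qed
  have "op_apply S x = opf (\<lambda>l. indicator {0..e} l * ?f l) x"
    unfolding op_apply_def using graph unique by (rule the_equality)
  then show "norm (op_apply S x) \<le> sqrt e * norm x"
    using norm_opf_le[OF f[OF e] f_le[OF e]] by simp
qed

lemma adjoint_op_iff:
  "(u, v) \<in> adjoint_op A \<longleftrightarrow> (\<forall>x y. (x, y) \<in> A \<longrightarrow> cinner u y = cinner v x)"
  by (auto simp: adjoint_op_def)

lemma linear_operator_adjoint:
  assumes "D_fin E \<subseteq> Domain A"
  shows "linear_operator (adjoint_op A)"
  unfolding linear_operator_iff
proof (intro conjI allI impI)
  show "single_valued (adjoint_op A)"
  proof (rule single_valuedI)
    fix u v v' assume uv: "(u, v) \<in> adjoint_op A" "(u, v') \<in> adjoint_op A"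
    have "v - v' = 0"
    proof (rule D_fin_separates)
      fix x assume "x \<in> D_fin E"
      then obtain y where "(x, y) \<in> A"
        using assms by blast
      with uv have "cinner v x = cinner v' x"
        unfolding adjoint_op_iff by metis
      then show "cinner x (v - v') = 0"
        by (metis cinner.diff_right cinner_commute right_minus_eq)
    qed
    then show "v = v'"
      by simp
  qed
qed (auto simp: adjoint_op_iff cinner.zero_left cinner_add_left cinner_scaleC_left)

lemma relatively_bounded_spec_subspace:
  assumes T: "single_valued T"
    and "relatively_bounded T (spectral_integral E (\<lambda>l. complex_of_real (sqrt l)))"
  obtains \<alpha> \<beta> where "0 \<le> \<alpha>" "0 \<le> \<beta>"
    "\<And>e x y. 0 \<le> e \<Longrightarrow> x \<in> spec_subspace E e \<Longrightarrow> (x, y) \<in> T \<Longrightarrow> norm y \<le> (\<alpha> * sqrt e + \<beta>) * norm x"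
proof -
  let ?S = "spectral_integral E (\<lambda>l. complex_of_real (sqrt l))"
  obtain \<alpha> \<beta> where ab: "0 \<le> \<alpha>" "0 \<le> \<beta>"
    "\<And>x. x \<in> Domain ?S \<Longrightarrow> norm (op_apply T x) \<le> \<alpha> * norm (op_apply ?S x) + \<beta> * norm x"
    using assms(2) unfolding relatively_bounded_def by blast
  have "norm y \<le> (\<alpha> * sqrt e + \<beta>) * norm x"
    if "0 \<le> e" "x \<in> spec_subspace E e" "(x, y) \<in> T" for e x y
  proof -
    note sq = sqrt_bound[OF refl that(1,2)]
    have "norm y \<le> \<alpha> * norm (op_apply ?S x) + \<beta> * norm x"
      using ab(3)[OF sq(1)] op_apply_eq[OF T that(3)] by simp
    also have "\<dots> \<le> \<alpha> * (sqrt e * norm x) + \<beta> * norm x"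
      using sq(2) ab by (intro add_mono mult_left_mono) auto
    finally show ?thesis
      by (simp add: algebra_simps)
  qed
  with ab show thesis
    using that by blast
qed

lemma class_C0_dual_pair:
  assumes "A \<in> class_C0 E"
  obtains b \<alpha> \<beta> where "dual_pair E A (adjoint_op A) b \<alpha> \<beta>"
proof -
  let ?B = "adjoint_op A" and ?S = "spectral_integral E (\<lambda>l. complex_of_real (sqrt l))"
  have A: "linear_operator A" "relatively_bounded A ?S" "relatively_bounded ?B ?S"
    using assms by (auto simp: class_C0_def)
  obtain b where b: "0 \<le> b"
    "\<And>e. 0 \<le> e \<Longrightarrow> spec_subspace E e \<subseteq> Domain A" "\<And>e. 0 \<le> e \<Longrightarrow> A `` spec_subspace E e \<subseteq> spec_subspace E (e + b)"
    "\<And>e. 0 \<le> e \<Longrightarrow> spec_subspace E e \<subseteq> Domain ?B" "\<And>e. 0 \<le> e \<Longrightarrow> ?B `` spec_subspace E e \<subseteq> spec_subspace E (e + b)"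
    using assms unfolding class_C0_def by blast
  have B: "linear_operator ?B"
    using b(2) by (intro linear_operator_adjoint) (auto simp: D_fin_def)
  obtain \<alpha> \<beta> where ab: "0 \<le> \<alpha>" "0 \<le> \<beta>"
    "\<And>e x y. 0 \<le> e \<Longrightarrow> x \<in> spec_subspace E e \<Longrightarrow> (x, y) \<in> A \<Longrightarrow> norm y \<le> (\<alpha> * sqrt e + \<beta>) * norm x"
    using relatively_bounded_spec_subspace[OF _ A(2)] A(1) unfolding linear_operator_iff by metis
  obtain \<alpha>' \<beta>' where ab': "0 \<le> \<alpha>'" "0 \<le> \<beta>'"
    "\<And>e x y. 0 \<le> e \<Longrightarrow> x \<in> spec_subspace E e \<Longrightarrow> (x, y) \<in> ?B \<Longrightarrow> norm y \<le> (\<alpha>' * sqrt e + \<beta>') * norm x"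
    using relatively_bounded_spec_subspace[OF _ A(3)] B unfolding linear_operator_iff by metis
  have mono: "(\<gamma> * sqrt e + \<delta>) * norm x \<le> ((\<alpha> + \<alpha>') * sqrt e + (\<beta> + \<beta>')) * norm x"
    if "\<gamma> \<le> \<alpha> + \<alpha>'" "\<delta> \<le> \<beta> + \<beta>'" "0 \<le> e" for \<gamma> \<delta> e and x :: 'h
    using that by (intro mult_right_mono add_mono) auto
  \<comment> \<open>The sums of the two pairs of constants bound both operators, as a symmetric pair
    requires.\<close>
  have "dual_pair E A ?B b (\<alpha> + \<alpha>') (\<beta> + \<beta>')"
  proof unfold_locales
    show "norm y \<le> ((\<alpha> + \<alpha>') * sqrt e + (\<beta> + \<beta>')) * norm x"
      if "0 \<le> e" "x \<in> spec_subspace E e" "(x, y) \<in> A" for e x y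
      by (rule order_trans[OF ab(3)[OF that] mono]) (use ab ab' that in auto)
    show "norm y \<le> ((\<alpha> + \<alpha>') * sqrt e + (\<beta> + \<beta>')) * norm x"
      if "0 \<le> e" "x \<in> spec_subspace E e" "(x, y) \<in> ?B" for e x y
      by (rule order_trans[OF ab'(3)[OF that] mono]) (use ab ab' that in auto)
    show "cinner u y = cinner v x" if "(x, y) \<in> A" "(u, v) \<in> ?B" for x y u v
      using that by (auto simp: adjoint_op_def)
  qed (use A B b ab ab' in auto)
  then show thesis
    by (rule that)
qed

end

theorem theorem2p1:
  fixes H0 A :: "'h::chilbert_space operator"
    and E :: "real set \<Rightarrow> 'h \<Rightarrow> 'h"
    and z z' :: complex
  assumes "self_adjoint H0" and "nonnegative_op H0" and "spectral_measure_of H0 E"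
    and "A \<in> class_C0 E"
    and "Im z \<le> Im z'"
  shows "(\<forall>a b \<Gamma>. simple_curve a b \<Gamma> z' z \<longrightarrow> D_fin E \<subseteq> Domain (T_exp_evolved E A a b \<Gamma>)) \<and>
    (\<forall>a b \<Gamma> a' b' \<Gamma>'. simple_curve a b \<Gamma> z' z \<longrightarrow> simple_curve a' b' \<Gamma>' z' z \<longrightarrow>
      op_restrict (T_exp_evolved E A a b \<Gamma>) (D_fin E) =
      op_restrict (T_exp_evolved E A a' b' \<Gamma>') (D_fin E)) \<and>
    (\<forall>a b \<Gamma>. simple_curve a b \<Gamma> z' z \<longrightarrow>
      U_op E A z z' = op_restrict (T_exp_evolved E A a b \<Gamma>) (D_fin E)) \<and>
    closable (U_op E A z z') \<and>
    closure (U_op E (adjoint_op A) (cnj z') (cnj z)) \<subseteq> adjoint_op (U_op E A z z')"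
proof -
  have E: "projection_valued_measure E" "spectral_integral E complex_of_real = H0"
    using assms(3) by (auto simp: spectral_measure_of_def)
  interpret pvm E
    by unfold_locales (rule E(1))
  \<comment> \<open>Non-negativity of H0 enters here: the spectral measure has no mass on the
    negative axis, so the V_e exhaust the space.\<close>
  interpret pvm_nonneg E
    by unfold_locales (rule E_negative, use E(2) assms(2) in simp)
  obtain b \<alpha> \<beta> where "dual_pair E A (adjoint_op A) b \<alpha> \<beta>"
    using class_C0_dual_pair[OF assms(4)] .
  then interpret dual_pair E A "adjoint_op A" b \<alpha> \<beta> .
  show ?thesis
    by (intro conjI allI impI Domain_T_exp T_exp_restrict_eq U_op_eq closable_U_op
        closure_U_op_subset_adjoint)
qed

end
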